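(* Suppose there exist computable constants $\beta_1$ and $\beta_2$ such that $$\|v-\Pi_{\rm CR}v\|\le\beta_1h\|\nabla_{\rm NC}(v-\Pi_{\rm CR}v)\|\quad\text{for any }v\in V_{\rm GCR},$$ $$\|w-\Pi_{\rm c}w\|\le\beta_2h\|\nabla_{\rm NC}w\|\quad\text{for any }w\in V_{\rm CR}.$$ Then the space $\Pi_{\rm c}(\Pi_{\rm CR}E_{\ell,\rm GCR})$ is $\ell$-dimensional provided that $$h<\frac{1}{(\beta_1+\beta_2)C_A\sqrt{\lambda_{\ell,\rm GCR}}}.$$
   Context: $\Omega\subset\mathbb{R}^n$ is a bounded polytopal domain, exactly covered by a shape-regular partition $\mathcal{T}$ into $n$-simplices, $h=\max_{K\in\mathcal{T}}\mathrm{diam}(K)$. $(\cdot,\cdot)$, $\|\cdot\|$ are the $L^2(\Omega)$ inner product and norm; $\nabla_{\rm NC}$ is the elementwise gradient. $A$ is a symmetric matrix-valued function on $\Omega$ with components piecewise Lipschitz continuous on subdomains of $\Omega$ and $(q,q)\le C(Aq,q)$ for all $q\in(L^2(\Omega))^n$ and some $C>0$; $\|\nabla_{\rm NC}v\|_A=(A\nabla_{\rm NC}v,\nabla_{\rm NC}v)^{1/2}$. $\bar A$ is a symmetric positive-definite approximation of $A$, constant on each $K\in\mathcal{T}$. $C_A$ is a constant with $\|\nabla_{\rm NC}v\|\le C_A\|\nabla_{\rm NC}v\|_A$ for all $v\in H^1_0(\Omega)+V_{\rm GCR}$. GCR (generalized Crouzeix–Raviart) space: $\mathcal{E}$, $\mathcal{E}(\Omega)$,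 $\mathcal{E}(\partial\Omega)$ are all, the interior and the boundary $(n-1)$-dimensional faces of $\mathcal{T}$; $[\cdot]$ is the jump. For $K\in\mathcal{T}$ with vertices $a_p=(x_{1p},\dots,x_{np})$, $1\le p\le n+1$, centroid $\mathrm{mid}(K)$, and $\bar B|_K=(\bar A|_K)^{-1}=(b_{ij})$, put $$H=\sum_{i} b_{ii}\sum_{p<q}(x_{ip}-x_{iq})^2+2\sum_{i<j}b_{ij}\sum_{p<q}(x_{ip}-x_{iq})(x_{jp}-x_{jq}),$$ $$\phi_K(x)=\frac{n+2}{2}-\frac{n(n+1)^2(n+2)}{2H}(x-\mathrm{mid}(K))^T\bar B|_K(x-\mathrm{mid}(K)).$$ $V_{\rm CR}$ is the space of $v\in L^2(\Omega)$ with $v|_K\in P_1(K)$ for all $K$, $\int_E[v]\,ds=0$ for $E\in\mathcal{E}(\Omega)$, $\int_Ev\,ds=0$ for $E\in\mathcal{E}(\partial\Omega)$; $V_{\rm B}=\{v\in L^2(\Omega):v|_K\in\mathrm{span}\{\phi_K\}\ \forall K\}$; $V_{\rm GCR}=V_{\rm CR}+V_{\rm B}$. Discrete eigenvalue problem: $0<\lambda_{1,\rm GCR}\le\cdots\le\lambda_{Z,\rm GCR}$, $Z=\dim V_{\rm GCR}$, with $L^2$-orthonormal eigenfunctions $u_{1,\rm GCR},\dots,u_{Z,\rm GCR}\in V_{\rm GCR}$, are the solutions of $(A\nabla_{\rm NC}u_{\rm GCR},\nabla_{\rm NC}v)=\lambda_{\rm GCR}(u_{\rm GCR},v)$ for all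 $v\in V_{\rm GCR}$, $\|u_{\rm GCR}\|=1$. $E_{\ell,\rm GCR}=\mathrm{span}\{u_{1,\rm GCR},\dots,u_{\ell,\rm GCR}\}$. Interpolations: $\Pi_{\rm CR}:V_{\rm GCR}\to V_{\rm CR}$ is defined by $\int_E\Pi_{\rm CR}v\,ds=\int_Ev\,ds$ for all $E\in\mathcal{E}$. $\Pi_{\rm c}:V_{\rm CR}\to V_{\rm CR}\cap H^1_0(\Omega)$ (continuous piecewise linear functions) is defined by its vertex values: $(\Pi_{\rm c}v)(z)=0$ for vertices $z\in\partial\Omega$, and $(\Pi_{\rm c}v)(z)=\frac1{|\omega_z|}\sum_{K\ni z}v|_K(z)$ for vertices $z\notin\partial\Omega$, where $|\omega_z|$ is the number of elements containing $z$. *)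

theory Defs
  imports "HOL-Analysis.Analysis" "HOL-Library.Function_Algebras"
begin

text \<open>Pointwise scalar multiplication, so that \<open>span\<close> and \<open>dim\<close> apply to spaces of functions.\<close>

instantiation "fun" :: (type, real_vector) real_vector
begin

definition scaleR_fun :: "real \<Rightarrow> ('a \<Rightarrow> 'b) \<Rightarrow> 'a \<Rightarrow> 'b"
  where "scaleR_fun c f = (\<lambda>x. c *\<^sub>R f x)"

instance
  by standard (simp_all add: scaleR_fun_def plus_fun_def fun_eq_iff algebra_simps)

end


section \<open>Lebesgue and Sobolev spaces\<close>

definition in_L2 :: "'a::euclidean_space set \<Rightarrow> ('a \<Rightarrow> 'b::euclidean_space) \<Rightarrow> bool"
  where "in_L2 \<Omega> f \<longleftrightarrow> f \<in> borel_measurable (lebesgue_on \<Omega>) \<and>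
    integrable (lebesgue_on \<Omega>) (\<lambda>x. (norm (f x))\<^sup>2)"

definition L2_ip ::
    "'a::euclidean_space set \<Rightarrow> ('a \<Rightarrow> 'b::euclidean_space) \<Rightarrow> ('a \<Rightarrow> 'b) \<Rightarrow> real"
  where "L2_ip \<Omega> f g = integral\<^sup>L (lebesgue_on \<Omega>) (\<lambda>x. f x \<bullet> g x)"

definition L2_nrm :: "'a::euclidean_space set \<Rightarrow> ('a \<Rightarrow> 'b::euclidean_space) \<Rightarrow> real"
  where "L2_nrm \<Omega> f = sqrt (L2_ip \<Omega> f f)"

definition energy_ip ::
    "(real^'n) set \<Rightarrow> (real^'n \<Rightarrow> real^'n^'n) \<Rightarrow> (real^'n \<Rightarrow> real^'n) \<Rightarrow> (real^'n \<Rightarrow> real^'n) \<Rightarrow> real"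
  where "energy_ip \<Omega> A p q = L2_ip \<Omega> (\<lambda>x. A x *v p x) q"

definition energy_nrm ::
    "(real^'n) set \<Rightarrow> (real^'n \<Rightarrow> real^'n^'n) \<Rightarrow> (real^'n \<Rightarrow> real^'n) \<Rightarrow> real"
  where "energy_nrm \<Omega> A q = sqrt (energy_ip \<Omega> A q q)"

definition grad :: "(real^'n \<Rightarrow> real) \<Rightarrow> real^'n \<Rightarrow> real^'n"
  where "grad f x = (\<chi> i. frechet_derivative f (at x) (axis i 1))"

primrec k_times_cont_diff :: "nat \<Rightarrow> (real^'n \<Rightarrow> real) \<Rightarrow> bool"
  where
    "k_times_cont_diff 0 f \<longleftrightarrow> continuous_on UNIV f"
  | "k_times_cont_diff (Suc k) f \<longleftrightarrow>
       (\<forall>x. f differentiable (at x)) \<and> (\<forall>i. k_times_cont_diff k (\<lambda>x. grad f x $ i))"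

definition test_function :: "(real^'n) set \<Rightarrow> (real^'n \<Rightarrow> real) \<Rightarrow> bool"
  where "test_function \<Omega> f \<longleftrightarrow> (\<forall>k. k_times_cont_diff k f) \<and>
    compact (closure {x. f x \<noteq> 0}) \<and> closure {x. f x \<noteq> 0} \<subseteq> \<Omega>"

text \<open>\<open>H10_with_grad \<Omega> u g\<close> says that \<open>u\<close> lies in $H^1_0(\Omega)$, the closure of the test
  functions in the $H^1$ norm, and that \<open>g\<close> is its weak gradient: an $L^2$ limit of the gradients
  of test functions that converge to \<open>u\<close> in $L^2$ is the weak gradient of \<open>u\<close>.\<close>

definition H10_with_grad :: "(real^'n) set \<Rightarrow> (real^'n \<Rightarrow> real) \<Rightarrow> (real^'n \<Rightarrow> real^'n) \<Rightarrow> bool"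
  where "H10_with_grad \<Omega> u g \<longleftrightarrow> in_L2 \<Omega> u \<and> in_L2 \<Omega> g \<and>
    (\<exists>\<psi>. (\<forall>k. test_function \<Omega> (\<psi> k)) \<and>
      (\<lambda>k. L2_nrm \<Omega> (\<lambda>x. \<psi> k x - u x)) \<longlonglongrightarrow> 0 \<and>
      (\<lambda>k. L2_nrm \<Omega> (\<lambda>x. grad (\<psi> k) x - g x)) \<longlonglongrightarrow> 0)"


section \<open>The coefficient matrix\<close>

definition piecewise_lipschitz :: "(real^'n) set \<Rightarrow> (real^'n \<Rightarrow> real^'n^'n) \<Rightarrow> bool"
  where "piecewise_lipschitz \<Omega> A \<longleftrightarrow>
    (\<exists>D. finite D \<and> pairwise disjnt D \<and> negligible (\<Omega> - \<Union>D) \<and>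
      (\<forall>S\<in>D. open S \<and> connected S \<and> S \<subseteq> \<Omega> \<and>
        (\<forall>i j. \<exists>L. L-lipschitz_on S (\<lambda>x. A x $ i $ j))))"

definition coercive :: "(real^'n) set \<Rightarrow> (real^'n \<Rightarrow> real^'n^'n) \<Rightarrow> bool"
  where "coercive \<Omega> A \<longleftrightarrow> (\<exists>C>0. \<forall>q. in_L2 \<Omega> q \<longrightarrow> L2_ip \<Omega> q q \<le> C * energy_ip \<Omega> A q q)"

definition sym_pos_def :: "real^'n^'n \<Rightarrow> bool"
  where "sym_pos_def M \<longleftrightarrow> transpose M = M \<and> (\<forall>y. y \<noteq> 0 \<longrightarrow> y \<bullet> (M *v y) > 0)"


section \<open>The partition\<close>

definition faces :: "(real^'n) set set \<Rightarrow> (real^'n) set set"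
  where "faces \<T> = {E. \<exists>K\<in>\<T>. E facet_of K}"

definition boundary_faces :: "(real^'n) set \<Rightarrow> (real^'n) set set \<Rightarrow> (real^'n) set set"
  where "boundary_faces \<Omega> \<T> = {E \<in> faces \<T>. E \<subseteq> frontier \<Omega>}"

definition interior_faces :: "(real^'n) set \<Rightarrow> (real^'n) set set \<Rightarrow> (real^'n) set set"
  where "interior_faces \<Omega> \<T> = faces \<T> - boundary_faces \<Omega> \<T>"

text \<open>The library's \<open>triangulation\<close> includes that two elements meet in a common face. That the
  boundary faces make up the boundary is part of \<open>\<T>\<close> covering \<open>\<Omega>\<close> exactly; the
  closures alone would not exclude, for instance, removing from \<open>\<Omega>\<close> a closed nowhere
  dense set of positive measure.\<close>

definition exact_simplicial_partition :: "(real^'n) set \<Rightarrow> (real^'n) set set \<Rightarrow> bool"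
  where "exact_simplicial_partition \<Omega> \<T> \<longleftrightarrow> triangulation \<T> \<and>
    (\<forall>K\<in>\<T>. int CARD('n) simplex K) \<and>
    closure \<Omega> = \<Union>\<T> \<and> frontier \<Omega> = \<Union>(boundary_faces \<Omega> \<T>)"

definition shape_regular :: "real \<Rightarrow> (real^'n) set set \<Rightarrow> bool"
  where "shape_regular \<kappa> \<T> \<longleftrightarrow> \<kappa> > 0 \<and> (\<forall>K\<in>\<T>. \<exists>c. cball c (diameter K / \<kappa>) \<subseteq> K)"

definition mesh_size :: "(real^'n) set set \<Rightarrow> real"
  where "mesh_size \<T> = Max (diameter ` \<T>)"

definition vertices :: "(real^'n) set \<Rightarrow> (real^'n) set"
  where "vertices K = {z. z extreme_point_of K}"

definition mid :: "(real^'n) set \<Rightarrow> real^'n"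
  where "mid K = (1 / (real CARD('n) + 1)) *\<^sub>R (\<Sum>z\<in>vertices K. z)"

text \<open>Surface integral over a flat face \<open>E\<close> of codimension one: the integrand is extended
  constantly in the normal direction and integrated over the prism of height one centred at
  \<open>E\<close>. By Fubini this is the integral with respect to $(n-1)$-dimensional measure (for
  $n = 1$, point evaluation).\<close>

definition unit_prism :: "(real^'n) set \<Rightarrow> (real^'n) set"
  where "unit_prism E = {x. closest_point (affine hull E) x \<in> E \<and>
    dist x (closest_point (affine hull E) x) \<le> 1 / 2}"

definition face_integral :: "(real^'n) set \<Rightarrow> (real^'n \<Rightarrow> real) \<Rightarrow> real"
  where "face_integral E f =
    integral\<^sup>L (lebesgue_on (unit_prism E)) (\<lambda>x. f (closest_point (affine hull E) x))"


section \<open>Piecewise functions\<close>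

text \<open>Elements of the discrete spaces are $L^2$ classes of functions that are polynomial on each
  element. Each class is represented by its unique member that is polynomial on the interior of
  each element and zero elsewhere, so that \<open>dim\<close> is the dimension in $L^2(\Omega)$. The
  one-sided boundary values on an element are recovered by \<open>trace_on\<close>.\<close>

definition elementwise :: "(real^'n) set set \<Rightarrow> (real^'n \<Rightarrow> real) set"
  where "elementwise \<T> = {v. \<forall>x. x \<notin> (\<Union>K\<in>\<T>. interior K) \<longrightarrow> v x = 0}"

definition trace_on :: "(real^'n) set \<Rightarrow> (real^'n \<Rightarrow> real) \<Rightarrow> real^'n \<Rightarrow> real"
  where "trace_on K v x = Lim (at x within interior K) v"

definition grad_NC :: "(real^'n) set set \<Rightarrow> (real^'n \<Rightarrow> real) \<Rightarrow> real^'n \<Rightarrow> real^'n"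
  where "grad_NC \<T> v x = (if x \<in> (\<Union>K\<in>\<T>. interior K) then grad v x else 0)"

definition broken_P1 :: "(real^'n) set set \<Rightarrow> (real^'n \<Rightarrow> real) set"
  where "broken_P1 \<T> =
    {v \<in> elementwise \<T>. \<forall>K\<in>\<T>. \<exists>a b. \<forall>x\<in>interior K. v x = a + b \<bullet> x}"

definition V_CR :: "(real^'n) set \<Rightarrow> (real^'n) set set \<Rightarrow> (real^'n \<Rightarrow> real) set"
  where "V_CR \<Omega> \<T> = {v \<in> broken_P1 \<T>.
    (\<forall>E\<in>interior_faces \<Omega> \<T>. \<forall>K\<in>\<T>. \<forall>K'\<in>\<T>. K \<noteq> K' \<longrightarrow> E facet_of K \<longrightarrow> E facet_of K' \<longrightarrow>
      face_integral E (\<lambda>x. trace_on K v x - trace_on K' v x) = 0) \<and>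
    (\<forall>E\<in>boundary_faces \<Omega> \<T>. \<forall>K\<in>\<T>. E facet_of K \<longrightarrow>
      face_integral E (trace_on K v) = 0)}"


section \<open>Generalized Crouzeix-Raviart space\<close>

text \<open>Sum over the unordered pairs of vertices, hence the factor $1/2$.\<close>

definition edge_sum :: "(real^'n) set \<Rightarrow> 'n \<Rightarrow> 'n \<Rightarrow> real"
  where "edge_sum K i j =
    (\<Sum>p\<in>vertices K. \<Sum>q\<in>vertices K. (p $ i - q $ i) * (p $ j - q $ j)) / 2"

text \<open>The type \<open>'n\<close> carries no order; the sum over $i \neq j$ is twice the sum over
  $i < j$ because the matrix \<open>B\<close> is symmetric.\<close>

definition bubble_H :: "real^'n^'n \<Rightarrow> (real^'n) set \<Rightarrow> real"
  where "bubble_H B K = (\<Sum>i\<in>UNIV. B $ i $ i * edge_sum K i i) +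
    (\<Sum>i\<in>UNIV. \<Sum>j\<in>UNIV - {i}. B $ i $ j * edge_sum K i j)"

definition bubble :: "real^'n^'n \<Rightarrow> (real^'n) set \<Rightarrow> real^'n \<Rightarrow> real"
  where "bubble B K x = (let n = real CARD('n) in
    (n + 2) / 2 - n * (n + 1)\<^sup>2 * (n + 2) / (2 * bubble_H B K) *
      ((x - mid K) \<bullet> (B *v (x - mid K))))"

text \<open>The elementwise constant matrix function is given by its value \<open>Abar K\<close> on each
  element \<open>K\<close>.\<close>

definition V_B ::
    "(real^'n) set set \<Rightarrow> ((real^'n) set \<Rightarrow> real^'n^'n) \<Rightarrow> (real^'n \<Rightarrow> real) set"
  where "V_B \<T> Abar = {v \<in> elementwise \<T>.
    \<forall>K\<in>\<T>. \<exists>c. \<forall>x\<in>interior K. v x = c * bubble (matrix_inv (Abar K)) K x}"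

definition V_GCR ::
    "(real^'n) set \<Rightarrow> (real^'n) set set \<Rightarrow> ((real^'n) set \<Rightarrow> real^'n^'n) \<Rightarrow> (real^'n \<Rightarrow> real) set"
  where "V_GCR \<Omega> \<T> Abar = {w + b | w b. w \<in> V_CR \<Omega> \<T> \<and> b \<in> V_B \<T> Abar}"

definition discrete_eigensystem ::
    "(real^'n) set \<Rightarrow> (real^'n) set set \<Rightarrow> (real^'n \<Rightarrow> real^'n^'n) \<Rightarrow> (real^'n \<Rightarrow> real) set \<Rightarrow>
     (nat \<Rightarrow> real) \<Rightarrow> (nat \<Rightarrow> real^'n \<Rightarrow> real) \<Rightarrow> bool"
  where "discrete_eigensystem \<Omega> \<T> A V lam u \<longleftrightarrow>
    (\<forall>i\<in>{1..dim V}. 0 < lam i \<and> u i \<in> V \<and>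
      (\<forall>v\<in>V. energy_ip \<Omega> A (grad_NC \<T> (u i)) (grad_NC \<T> v) = lam i * L2_ip \<Omega> (u i) v)) \<and>
    (\<forall>i\<in>{1..dim V}. \<forall>j\<in>{1..dim V}. i \<le> j \<longrightarrow> lam i \<le> lam j) \<and>
    (\<forall>i\<in>{1..dim V}. \<forall>j\<in>{1..dim V}. L2_ip \<Omega> (u i) (u j) = (if i = j then 1 else 0))"


section \<open>Interpolations\<close>

text \<open>For arguments in \<open>V_GCR\<close> the face integral does not depend on the element from which
  the trace is taken, so the condition on every pair of an element and one of its faces is the
  condition on every face.\<close>

definition Pi_CR ::
    "(real^'n) set \<Rightarrow> (real^'n) set set \<Rightarrow> (real^'n \<Rightarrow> real) \<Rightarrow> real^'n \<Rightarrow> real"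
  where "Pi_CR \<Omega> \<T> v = (THE w. w \<in> V_CR \<Omega> \<T> \<and>
    (\<forall>E\<in>faces \<T>. \<forall>K\<in>\<T>. E facet_of K \<longrightarrow>
      face_integral E (trace_on K w) = face_integral E (trace_on K v)))"

definition nodal_average ::
    "(real^'n) set \<Rightarrow> (real^'n) set set \<Rightarrow> (real^'n \<Rightarrow> real) \<Rightarrow> real^'n \<Rightarrow> real"
  where "nodal_average \<Omega> \<T> v z = (if z \<in> frontier \<Omega> then 0
    else (\<Sum>K\<in>{K\<in>\<T>. z \<in> K}. trace_on K v z) / real (card {K\<in>\<T>. z \<in> K}))"

text \<open>A piecewise affine function is determined by its vertex values on each element. As these
  are single-valued here and zero on the boundary, \<open>Pi_c \<Omega> \<T> v\<close> is continuous
  and in $V_{CR} \cap H^1_0(\Omega)$.\<close>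

definition Pi_c ::
    "(real^'n) set \<Rightarrow> (real^'n) set set \<Rightarrow> (real^'n \<Rightarrow> real) \<Rightarrow> real^'n \<Rightarrow> real"
  where "Pi_c \<Omega> \<T> v = (THE w. w \<in> broken_P1 \<T> \<and>
    (\<forall>K\<in>\<T>. \<forall>z\<in>vertices K. trace_on K w z = nodal_average \<Omega> \<T> v z))"

end

theory Submission
  imports Defs
begin

text \<open>The bubble \<open>\<phi>\<^sub>K\<close> has vanishing mean on every face of \<open>K\<close>, so the Crouzeix-Raviart
  interpolation maps \<open>v = w + b\<close> to \<open>w\<close>. The gradient of \<open>b\<close> has mean zero on each element and
  that of \<open>w\<close> is constant there, so the two are orthogonal and each is bounded by the gradient of
  \<open>v\<close>. If \<open>v\<close> lies in the span of the first \<open>l\<close> eigenfunctions and both interpolations together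
  annihilate it, the triangle inequality gives
  \<open>\<parallel>v\<parallel> \<le> (\<beta>\<^sub>1 + \<beta>\<^sub>2) h \<parallel>\<nabla>v\<parallel> \<le> (\<beta>\<^sub>1 + \<beta>\<^sub>2) h C\<^sub>A sqrt (lam l) \<parallel>v\<parallel>\<close>, which forces \<open>v = 0\<close>.
  Hence the composed interpolation is injective on this span.

  The face means need the first and second moments of a simplex. They are obtained from two
  symmetries, the exchange of two vertices and the bisection of an edge, without computing any
  volume or determinant.\<close>

section \<open>Affine substitutions in Lebesgue integrals\<close>

text \<open>The normalisation of the bubble encodes its zero face means. Let Q be the quadratic form
  of \<open>Bbar K\<close> about \<open>mid K\<close> and S its sum over the n+1 vertices. Then H =
  (n+1) S, the mean of Q over each face is S / (n (n+1)), and this mean times the factor in front of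
  Q equals the constant term (n+2)/2. All faces give the same mean because the deviations of the
  vertices from \<open>mid K\<close> add up to zero: the vertex missing from a face re-enters
  through the sum of the others.

  A face is null in the ambient space, so its integral is a volume integral over a prism of height
  one, while an element is its own prism. One locale therefore yields the moments of both, with n
  and n+1 vertices.

  The orthogonality is that of the unweighted inner product, although the eigenvalue problem carries
  the weight \<open>A\<close>. The weight enters only through the energy of the discrete eigenspace
  and through \<open>C\<^sub>A\<close>, so the two constants simply add. That a zero norm means the
  zero function is read off from the coefficients with respect to the orthonormal
  eigenfunctions.\<close>

lemma nn_integral_lborel_translate:
  fixes f :: "'a::euclidean_space \<Rightarrow> ennreal"
  assumes [measurable]: "f \<in> borel_measurable borel"
  shows "(\<integral>\<^sup>+x. f (x + t) \<partial>lborel) = (\<integral>\<^sup>+x. f x \<partial>lborel)"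
proof -
  have "(\<integral>\<^sup>+x. f x \<partial>lborel) = (\<integral>\<^sup>+x. f x \<partial>distr lborel borel ((+) t))"
    by (simp add: lborel_distr_plus)
  also have "\<dots> = (\<integral>\<^sup>+x. f (t + x) \<partial>lborel)"
    by (subst nn_integral_distr) auto
  finally show ?thesis by (simp add: add.commute)
qed

text \<open>As in the uniqueness proof for Haar measure: integrate over translates by points of the unit
  box and apply Fubini. The library's change of variables needs a well-ordered index type.\<close>

lemma lborel_distr_affine:
  fixes L :: "'a::euclidean_space \<Rightarrow> 'a"
  assumes "linear L" "inj L"
  obtains c :: real where "c \<ge> 0" "distr lborel borel (\<lambda>x. L x + t) = density lborel (\<lambda>_. ennreal c)"
proof -
  obtain G where G: "linear G" "\<And>x. G (L x) = x" "\<And>x. L (G x) = x"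
    using linear_injective_isomorphism[OF assms] by blast
  have cont: "continuous_on UNIV L" "continuous_on UNIV G"
    using assms(1) G(1) by (simp_all add: linear_continuous_on linear_conv_bounded_linear)
  define f where "f x = L x + t" for x
  have [measurable]: "f \<in> borel_measurable borel"
    unfolding f_def by (intro borel_measurable_continuous_onI continuous_intros cont)
  have shift: "f (z + G y) = f z + y" for z y
    using assms(1) G(3) by (simp add: f_def linear_add)
  define B where "B = cbox 0 (One :: 'a)"
  have B [measurable]: "B \<in> sets borel" by (simp add: B_def)
  have volB: "emeasure lborel B = 1"
    by (simp add: B_def emeasure_lborel_cbox)
  \<comment> \<open>What is left of the inner integral once translation invariance has removed
    \<open>y\<close>: \<open>shift\<close> turns \<open>y - f (z + G y)\<close> into
    \<open>- f z\<close>. So \<open>c\<close> is the volume of the preimage of \<open>- B\<close>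
    under \<open>f\<close>.\<close>
  define c where "c = (\<integral>\<^sup>+z. indicator B (- f z) \<partial>lborel)"
  have eq: "(\<integral>\<^sup>+z. F (f z) \<partial>lborel) = c * (\<integral>\<^sup>+y. F y \<partial>lborel)"
    if [measurable]: "F \<in> borel_measurable borel" for F :: "'a \<Rightarrow> ennreal"
  proof -
    have "(\<integral>\<^sup>+z. F (f z) \<partial>lborel) = (\<integral>\<^sup>+y. indicator B y * (\<integral>\<^sup>+z. F (f z) \<partial>lborel) \<partial>lborel)"
      by (subst nn_integral_multc) (auto simp: volB)
    also have "\<dots> = (\<integral>\<^sup>+y. indicator B y * (\<integral>\<^sup>+z. F (f z + y) \<partial>lborel) \<partial>lborel)"
    proof -
      have "(\<integral>\<^sup>+z. F (f z) \<partial>lborel) = (\<integral>\<^sup>+z. F (f (z + G y)) \<partial>lborel)" for y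
        by (rule nn_integral_lborel_translate[symmetric]) measurable
      then show ?thesis by (simp add: shift)
    qed
    also have "\<dots> = (\<integral>\<^sup>+y. \<integral>\<^sup>+z. indicator B y * F (f z + y) \<partial>lborel \<partial>lborel)"
      by (simp add: nn_integral_cmult)
    also have "\<dots> = (\<integral>\<^sup>+z. \<integral>\<^sup>+y. indicator B y * F (f z + y) \<partial>lborel \<partial>lborel)"
      by (rule lborel_pair.Fubini') measurable
    also have "\<dots> = (\<integral>\<^sup>+z. \<integral>\<^sup>+y. indicator B (y - f z) * F y \<partial>lborel \<partial>lborel)"
    proof (rule nn_integral_cong)
      fix z
      have "(\<integral>\<^sup>+y. indicator B (y - f z) * F y \<partial>lborel)
          = (\<integral>\<^sup>+y. indicator B (y + f z - f z) * F (y + f z) \<partial>lborel)"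
        by (rule nn_integral_lborel_translate[symmetric]) measurable
      then show "(\<integral>\<^sup>+y. indicator B y * F (f z + y) \<partial>lborel)
          = (\<integral>\<^sup>+y. indicator B (y - f z) * F y \<partial>lborel)"
        by (simp add: add.commute)
    qed
    also have "\<dots> = (\<integral>\<^sup>+y. \<integral>\<^sup>+z. indicator B (y - f z) * F y \<partial>lborel \<partial>lborel)"
      by (rule lborel_pair.Fubini') measurable
    also have "\<dots> = (\<integral>\<^sup>+y. c * F y \<partial>lborel)"
    proof (rule nn_integral_cong)
      fix y
      have "(\<integral>\<^sup>+z. indicator B (y - f z) * F y \<partial>lborel)
          = (\<integral>\<^sup>+z. indicator B (y - f (z + G y)) * F y \<partial>lborel)"
        by (rule nn_integral_lborel_translate[symmetric]) measurable
      also have "\<dots> = c * F y"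
        unfolding c_def by (subst nn_integral_multc) (auto simp: shift)
      finally show "(\<integral>\<^sup>+z. indicator B (y - f z) * F y \<partial>lborel) = c * F y" .
    qed
    also have "\<dots> = c * (\<integral>\<^sup>+y. F y \<partial>lborel)"
      by (simp add: nn_integral_cmult)
    finally show ?thesis .
  qed
  \<comment> \<open>Makes \<open>c\<close> a real number: the preimage lies in a continuous image of
    the compact box.\<close>
  have "c \<le> emeasure lborel ((\<lambda>y. G (- y - t)) ` B)"
  proof -
    have "compact ((\<lambda>y. G (- y - t)) ` B)"
      unfolding B_def by (intro compact_continuous_image continuous_intros
          continuous_on_compose2[OF cont(2)]) auto
    then have [measurable]: "(\<lambda>y. G (- y - t)) ` B \<in> sets borel"
      by (rule borel_compact)
    have "c \<le> (\<integral>\<^sup>+z. indicator ((\<lambda>y. G (- y - t)) ` B) z \<partial>lborel)"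
      unfolding c_def
    proof (rule nn_integral_mono)
      fix z
      have "z = G (- (- f z) - t)" by (simp add: f_def G)
      then have "- f z \<in> B \<Longrightarrow> z \<in> (\<lambda>y. G (- y - t)) ` B"
        by (rule image_eqI)
      then show "indicator B (- f z) \<le> (indicator ((\<lambda>y. G (- y - t)) ` B) z :: ennreal)"
        by (auto simp: indicator_def)
    qed
    then show ?thesis by simp
  qed
  also have "\<dots> < \<infinity>"
    unfolding B_def by (intro emeasure_bounded_finite compact_imp_bounded compact_continuous_image
        continuous_intros continuous_on_compose2[OF cont(2)]) auto
  finally have fin: "c = ennreal (enn2real c)" by simp
  have "distr lborel borel f = density lborel (\<lambda>_. ennreal (enn2real c))"
  proof (rule measure_eqI)
    fix A assume "A \<in> sets (distr lborel borel f)"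
    then have [measurable]: "A \<in> sets borel" by simp
    have "emeasure (distr lborel borel f) A = (\<integral>\<^sup>+z. indicator A z \<partial>distr lborel borel f)"
      by simp
    also have "\<dots> = (\<integral>\<^sup>+z. indicator A (f z) \<partial>lborel)"
      by (subst nn_integral_distr) auto
    also have "\<dots> = emeasure (density lborel (\<lambda>_. ennreal (enn2real c))) A"
      by (subst eq) (auto simp: emeasure_density_const fin[symmetric])
    finally show "emeasure (distr lborel borel f) A
        = emeasure (density lborel (\<lambda>_. ennreal (enn2real c))) A" .
  qed simp
  then show ?thesis
    using that[of "enn2real c"] by (simp add: f_def[abs_def])
qed

text \<open>Both later substitutions, the exchange of two coordinates and the bisection, move a
  point along one edge by an affine amount and hence have this form;
  \<open>1 + v \<bullet> w\<close> is the determinant of the linear part. The factor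
  \<open>c\<close> is the same for all \<open>F\<close>, so a single test function can reveal
  it.\<close>

lemma lborel_integral_rank_one_perturbation:
  fixes v w :: "'a::euclidean_space"
  assumes "1 + v \<bullet> w \<noteq> 0"
  obtains c :: real where "c \<ge> 0"
    "\<And>F :: 'a \<Rightarrow> real. F \<in> borel_measurable borel \<Longrightarrow>
      (\<integral>x. F (x + (v \<bullet> x + d) *\<^sub>R w) \<partial>lborel) = c * (\<integral>x. F x \<partial>lborel)"
proof -
  define L where "L x = x + (v \<bullet> x) *\<^sub>R w" for x
  have "linear L"
    by (rule linearI) (simp_all add: L_def inner_simps algebra_simps)
  moreover have "inj L"
    unfolding linear_injective_0[OF \<open>linear L\<close>]
  proof (intro allI impI)
    fix x assume x: "L x = 0"
    then have "v \<bullet> L x = 0" by simp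
    then have "(v \<bullet> x) * (1 + v \<bullet> w) = 0"
      by (simp add: L_def inner_simps algebra_simps)
    then show "x = 0" using x assms by (simp add: L_def)
  qed
  ultimately obtain c where c: "c \<ge> 0"
    "distr lborel borel (\<lambda>x. L x + d *\<^sub>R w) = density lborel (\<lambda>_. ennreal c)"
    by (rule lborel_distr_affine)
  have [measurable]: "(\<lambda>x. L x + d *\<^sub>R w) \<in> borel_measurable borel"
    unfolding L_def by measurable
  show ?thesis
  proof (rule that[OF c(1)])
    fix F :: "'a \<Rightarrow> real" assume [measurable]: "F \<in> borel_measurable borel"
    have "(\<integral>x. F (x + (v \<bullet> x + d) *\<^sub>R w) \<partial>lborel) = (\<integral>x. F (L x + d *\<^sub>R w) \<partial>lborel)"
      by (simp add: L_def algebra_simps)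
    also have "\<dots> = (\<integral>x. F x \<partial>distr lborel borel (\<lambda>x. L x + d *\<^sub>R w))"
      by (subst integral_distr) auto
    also have "\<dots> = c * (\<integral>x. F x \<partial>lborel)"
      unfolding c(2) by (subst integral_density) (auto simp: c(1))
    finally show "(\<integral>x. F (x + (v \<bullet> x + d) *\<^sub>R w) \<partial>lborel) = c * (\<integral>x. F x \<partial>lborel)" .
  qed
qed

section \<open>Moments of a simplex\<close>

lemma closest_point_affine_orthogonal:
  fixes S :: "'a::euclidean_space set"
  assumes "affine S" "a \<in> S" "b \<in> S"
  shows "(x - closest_point S x) \<bullet> (a - b) = 0"
proof -
  have S: "convex S" "closed S" "S \<noteq> {}"
    using assms by (auto simp: affine_imp_convex affine_closed)
  define y where "y = closest_point S x"
  have y: "y \<in> S" unfolding y_def using S by (simp add: closest_point_in_set)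
  have le: "(x - y) \<bullet> (z - y) \<le> 0" if "z \<in> S" for z
    unfolding y_def by (rule closest_point_dot) (use S that in auto)
  have "(x - y) \<bullet> (z - y) = 0" if "z \<in> S" for z
  proof -
    \<comment> \<open>The reflection of \<open>z\<close> in \<open>y\<close> stays in the affine
      set, so the variational inequality \<open>le\<close> holds with both signs.\<close>
    have "2 *\<^sub>R y + (-1) *\<^sub>R z \<in> S"
      by (rule mem_affine) (use assms y that in auto)
    from le[OF this] le[OF that] show ?thesis
      by (simp add: inner_simps)
  qed
  from this[OF assms(2)] this[OF assms(3)] show ?thesis
    by (simp add: y_def inner_simps)
qed

lemma integrable_indicator_compact:
  fixes f :: "'a::euclidean_space \<Rightarrow> real"
  assumes "compact S" "continuous_on UNIV f"
  shows "integrable lborel (\<lambda>x. indicator S x * f x)"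
  using borel_integrable_compact[OF assms(1), of f] continuous_on_subset[OF assms(2)] by simp

text \<open>\<open>C\<close> is meant to be the vertex set of a face (n points) or of an element
  (n+1 points), so that one computation of moments serves both.\<close>

locale affinely_independent =
  fixes C :: "(real^'n) set"
  assumes indep: "\<not> affine_dependent C" and nonempty: "C \<noteq> {}"
begin

lemma finite_C: "finite C"
  using indep by (rule aff_independent_finite)

lemma card_pos: "card C > 0"
  using finite_C nonempty by (simp add: card_gt_0_iff)

definition proj :: "real^'n \<Rightarrow> real^'n"
  where "proj x = closest_point (affine hull C) x"

lemma proj_in: "proj x \<in> affine hull C"
  unfolding proj_def
  by (rule closest_point_in_set) (use nonempty in \<open>auto simp: affine_closed\<close>)

lemma proj_self: "x \<in> affine hull C \<Longrightarrow> proj x = x"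
  unfolding proj_def by (rule closest_point_self)

lemma proj_orthogonal: "a \<in> affine hull C \<Longrightarrow> b \<in> affine hull C \<Longrightarrow> (x - proj x) \<bullet> (a - b) = 0"
  unfolding proj_def by (rule closest_point_affine_orthogonal) auto

lemma continuous_proj: "continuous_on UNIV proj"
  unfolding proj_def[abs_def]
  by (rule continuous_on_closest_point)
    (use nonempty in \<open>auto simp: affine_imp_convex affine_closed\<close>)

text \<open>The vector \<open>v p\<close> points to \<open>p\<close> from the foot \<open>q\<close>
  of its perpendicular on the opposite face, scaled so that the affine function rises from 0 to 1
  between them. Orthogonality to \<open>x - proj x\<close> makes the coordinates constant along the
  normal fibres, so they can be used on the whole prism.\<close>

lemma ex_barycentric:
  "\<exists>v b. \<forall>p\<in>C. (\<forall>q\<in>C. v p \<bullet> q + b p = of_bool (p = q)) \<and> (\<forall>x. v p \<bullet> (x - proj x) = 0)"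
proof -
  have "\<exists>v b. (\<forall>q\<in>C. v \<bullet> q + b = of_bool (p = q)) \<and> (\<forall>x. v \<bullet> (x - proj x) = 0)"
    if p: "p \<in> C" for p
  proof (cases "C - {p} = {}")
    case True
    then have "C = {p}" using p by auto
    \<comment> \<open>A single vertex has no opposite face; its coordinate is the constant 1. This
      occurs for the faces of an interval.\<close>
    then show ?thesis by (intro exI[of _ 0] exI[of _ 1]) auto
  next
    case False
    define S where "S = affine hull (C - {p})"
    define q where "q = closest_point S p"
    have qS: "q \<in> S" unfolding q_def S_def
      by (rule closest_point_in_set) (use False in \<open>auto simp: affine_closed\<close>)
    have "p \<notin> S" using indep p unfolding affine_dependent_def S_def by blast
    then have pq: "p - q \<noteq> 0" using qS by auto
    have orth: "(p - q) \<bullet> (z - q) = 0" if "z \<in> S" for z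
      unfolding q_def by (rule closest_point_affine_orthogonal) (use that qS q_def S_def in auto)
    have SC: "S \<subseteq> affine hull C" unfolding S_def by (rule hull_mono) auto
    define v where "v = (1 / ((p - q) \<bullet> (p - q))) *\<^sub>R (p - q)"
    have vv: "v \<bullet> z = ((p - q) \<bullet> z) / ((p - q) \<bullet> (p - q))" for z by (simp add: v_def)
    have "v \<bullet> z + - (v \<bullet> q) = of_bool (p = z)" if z: "z \<in> C" for z
    proof (cases "z = p")
      case True
      have "v \<bullet> p - v \<bullet> q = v \<bullet> (p - q)" by (simp add: inner_diff_right)
      also have "\<dots> = 1" using pq by (simp add: vv)
      finally show ?thesis using True by simp
    next
      case False
      then have "z \<in> S" unfolding S_def using z by (intro hull_inc) auto
      have "v \<bullet> z - v \<bullet> q = v \<bullet> (z - q)" by (simp add: inner_diff_right)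
      also have "\<dots> = 0" using orth[OF \<open>z \<in> S\<close>] by (simp add: vv)
      finally show ?thesis using False by simp
    qed
    moreover have "v \<bullet> (x - proj x) = 0" for x
      unfolding v_def using proj_orthogonal[of p q x] SC qS p
      by (simp add: inner_commute hull_inc subset_iff)
    ultimately show ?thesis by blast
  qed
  then show ?thesis by metis
qed

definition bary_grad :: "real^'n \<Rightarrow> real^'n"
  where "bary_grad = (SOME v. \<exists>b. \<forall>p\<in>C. (\<forall>q\<in>C. v p \<bullet> q + b p = of_bool (p = q)) \<and>
      (\<forall>x. v p \<bullet> (x - proj x) = 0))"

definition bary_const :: "real^'n \<Rightarrow> real"
  where "bary_const = (SOME b. \<forall>p\<in>C. (\<forall>q\<in>C. bary_grad p \<bullet> q + b p = of_bool (p = q)) \<and>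
      (\<forall>x. bary_grad p \<bullet> (x - proj x) = 0))"

definition bary :: "real^'n \<Rightarrow> real^'n \<Rightarrow> real"
  where "bary p x = bary_grad p \<bullet> x + bary_const p"

lemma bary_ex: "\<forall>p\<in>C. (\<forall>q\<in>C. bary_grad p \<bullet> q + bary_const p = of_bool (p = q)) \<and>
      (\<forall>x. bary_grad p \<bullet> (x - proj x) = 0)"
proof -
  have "\<exists>b. \<forall>p\<in>C. (\<forall>q\<in>C. bary_grad p \<bullet> q + b p = of_bool (p = q)) \<and>
      (\<forall>x. bary_grad p \<bullet> (x - proj x) = 0)"
    using someI_ex[OF ex_barycentric] unfolding bary_grad_def .
  then show ?thesis
    unfolding bary_const_def by (rule someI_ex)
qed

lemma bary_vertex: "p \<in> C \<Longrightarrow> q \<in> C \<Longrightarrow> bary p q = of_bool (p = q)"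
  using bary_ex unfolding bary_def by blast

lemma bary_proj: "p \<in> C \<Longrightarrow> bary p (proj x) = bary p x"
proof -
  assume "p \<in> C"
  then have "bary_grad p \<bullet> (x - proj x) = 0" using bary_ex by blast
  then show ?thesis unfolding bary_def inner_diff_right by linarith
qed

lemma continuous_bary: "continuous_on UNIV (bary p)"
  unfolding bary_def[abs_def] by (intro continuous_intros)

lemma bary_affine_combination:
  assumes "p \<in> C" "sum c C = 1"
  shows "bary p (\<Sum>q\<in>C. c q *\<^sub>R q) = c p"
proof -
  have "bary p (\<Sum>q\<in>C. c q *\<^sub>R q) = (\<Sum>q\<in>C. c q * bary p q)"
    using assms(2) by (simp add: bary_def inner_sum_right algebra_simps sum.distrib flip: sum_distrib_right)
  also have "\<dots> = (\<Sum>q\<in>C. if p = q then c q else 0)"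
    using assms(1) by (intro sum.cong) (auto simp: bary_vertex)
  finally show ?thesis using finite_C assms(1) by simp
qed

lemma
  assumes "x \<in> affine hull C"
  shows sum_bary_hull: "(\<Sum>p\<in>C. bary p x) = 1"
    and bary_expansion_hull: "(\<Sum>p\<in>C. bary p x *\<^sub>R p) = x"
proof -
  obtain c where c: "sum c C = 1" "(\<Sum>q\<in>C. c q *\<^sub>R q) = x"
    using assms unfolding affine_hull_finite[OF finite_C] by auto
  have "bary p x = c p" if "p \<in> C" for p
    using bary_affine_combination[OF that c(1)] c(2) by simp
  then show "(\<Sum>p\<in>C. bary p x) = 1" "(\<Sum>p\<in>C. bary p x *\<^sub>R p) = x"
    using c by simp_all
qed

lemma sum_bary: "(\<Sum>p\<in>C. bary p x) = 1"
proof -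
  have "(\<Sum>p\<in>C. bary p x) = (\<Sum>p\<in>C. bary p (proj x))"
    by (rule sum.cong) (auto simp only: bary_proj)
  then show ?thesis by (simp only: sum_bary_hull[OF proj_in])
qed

lemma proj_eq: "proj x = (\<Sum>p\<in>C. bary p x *\<^sub>R p)"
proof -
  have "(\<Sum>p\<in>C. bary p x *\<^sub>R p) = (\<Sum>p\<in>C. bary p (proj x) *\<^sub>R p)"
    by (rule sum.cong) (auto simp only: bary_proj)
  then show ?thesis by (simp only: bary_expansion_hull[OF proj_in])
qed

lemma mem_convex_hull_iff:
  assumes "x \<in> affine hull C"
  shows "x \<in> convex hull C \<longleftrightarrow> (\<forall>p\<in>C. 0 \<le> bary p x)"
proof
  assume "x \<in> convex hull C"
  then obtain c where c: "\<forall>p\<in>C. 0 \<le> c p" "sum c C = 1" "(\<Sum>q\<in>C. c q *\<^sub>R q) = x"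
    unfolding convex_hull_finite[OF finite_C] by auto
  have "bary p x = c p" if "p \<in> C" for p
    using bary_affine_combination[OF that c(2)] c(3) by simp
  then show "\<forall>p\<in>C. 0 \<le> bary p x"
    using c(1) by simp
next
  assume "\<forall>p\<in>C. 0 \<le> bary p x"
  then show "x \<in> convex hull C"
    unfolding convex_hull_finite[OF finite_C]
    by (intro CollectI exI[of _ "\<lambda>p. bary p x"])
      (simp add: sum_bary_hull[OF assms] bary_expansion_hull[OF assms])
qed

section \<open>The prism over a simplex in barycentric coordinates\<close>

abbreviation prism :: "(real^'n) set"
  where "prism \<equiv> unit_prism (convex hull C)"

text \<open>Membership is reduced to the signs of the coordinates and the distance from the affine
  hull. A motion along an edge leaves the distance alone, so only signs have to be followed under
  the substitutions.\<close>

lemma prism_eq: "prism = {x. (\<forall>p\<in>C. 0 \<le> bary p x) \<and> dist x (proj x) \<le> 1 / 2}"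
proof -
  have "proj x \<in> convex hull C \<longleftrightarrow> (\<forall>p\<in>C. 0 \<le> bary p x)" for x
    using mem_convex_hull_iff[OF proj_in[of x]] by (simp add: bary_proj)
  then show ?thesis
    unfolding unit_prism_def affine_hull_convex_hull proj_def by simp
qed

lemma proj_prism: "x \<in> prism \<Longrightarrow> proj x \<in> convex hull C"
  unfolding unit_prism_def affine_hull_convex_hull proj_def by simp

lemma compact_prism: "compact prism"
proof -
  have "prism = (\<Inter>p\<in>C. {x. 0 \<le> bary p x}) \<inter> {x. dist x (proj x) \<le> 1 / 2}"
    unfolding prism_eq by blast
  moreover have "closed \<dots>"
    by (intro closed_Int closed_INT ballI closed_Collect_le continuous_intros
        continuous_proj continuous_bary)
  ultimately have "closed prism" by simp
  moreover have "bounded prism"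
  proof -
    obtain B where B: "\<And>x. x \<in> convex hull C \<Longrightarrow> norm x \<le> B"
      using compact_imp_bounded[OF finite_imp_compact_convex_hull[OF finite_C]]
      unfolding bounded_iff by blast
    have "norm x \<le> B + 1 / 2" if "x \<in> prism" for x
      using B[OF proj_prism[OF that]] that norm_triangle_sub[of x "proj x"]
      unfolding prism_eq by (simp add: dist_norm)
    then show ?thesis unfolding bounded_iff by blast
  qed
  ultimately show ?thesis by (simp add: compact_eq_bounded_closed)
qed

lemma prism_borel [measurable]: "prism \<in> sets borel"
  by (rule borel_compact[OF compact_prism])

definition prism_integral :: "(real^'n \<Rightarrow> real) \<Rightarrow> real"
  where "prism_integral f = (\<integral>x. indicator prism x * f x \<partial>lborel)"

text \<open>A positive volume can be cancelled, which is how Jacobians are found below. The open set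
  \<open>U\<close>, the prism with strict inequalities, contains the centroid \<open>m\<close> of
  the vertices.\<close>

lemma vol_pos: "prism_integral (\<lambda>_. 1) > 0"
proof -
  define U where "U = {x. (\<forall>p\<in>C. 0 < bary p x) \<and> dist x (proj x) < 1 / 2}"
  define m where "m = (\<Sum>p\<in>C. (1 / real (card C)) *\<^sub>R p)"
  have s1: "(\<Sum>p\<in>C. 1 / real (card C)) = 1" using card_pos by simp
  have "m \<in> affine hull C"
    unfolding affine_hull_finite[OF finite_C] m_def
    by (rule CollectI, rule exI[of _ "\<lambda>_. 1 / real (card C)"]) (use s1 in auto)
  then have "m \<in> U"
    using card_pos bary_affine_combination[OF _ s1] by (simp add: U_def m_def[symmetric] proj_self)
  moreover have "open U"
  proof -
    have "U = (\<Inter>p\<in>C. {x. 0 < bary p x}) \<inter> {x. dist x (proj x) < 1 / 2}"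
      unfolding U_def by blast
    moreover have "open \<dots>"
      by (intro open_Int open_INT ballI finite_C open_Collect_less continuous_intros
          continuous_proj continuous_bary)
    ultimately show ?thesis by simp
  qed
  moreover have "U \<subseteq> prism" unfolding U_def prism_eq by (simp add: less_imp_le subset_iff)
  ultimately have "\<not> negligible prism"
    by (metis empty_iff negligible_subset open_not_negligible)
  then have "emeasure lborel prism \<noteq> 0"
    by (simp add: negligible_iff_null_sets null_sets_def)
  moreover have "emeasure lborel prism < \<infinity>"
    by (rule emeasure_bounded_finite[OF compact_imp_bounded[OF compact_prism]])
  ultimately show ?thesis
    unfolding prism_integral_def by (simp add: measure_def enn2real_positive_iff zero_less_iff_neq_zero less_top)
qed

end

section \<open>Exchange of two vertices and bisection of an edge\<close>

context affinely_independent
begin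

lemma integrable_prism: "continuous_on UNIV f \<Longrightarrow> integrable lborel (\<lambda>x. indicator prism x * f x :: real)"
  by (rule integrable_indicator_compact[OF compact_prism])

lemma prism_integral_add: "continuous_on UNIV f \<Longrightarrow> continuous_on UNIV g \<Longrightarrow> prism_integral (\<lambda>x. f x + g x) = prism_integral f + prism_integral g"
  unfolding prism_integral_def distrib_left by (intro Bochner_Integration.integral_add integrable_prism)

lemma prism_integral_cmult: "prism_integral (\<lambda>x. c * f x) = c * prism_integral f"
  unfolding prism_integral_def by (simp add: mult.left_commute)

lemma prism_integral_sum:
  "(\<And>i. i \<in> J \<Longrightarrow> continuous_on UNIV (f i)) \<Longrightarrow> prism_integral (\<lambda>x. \<Sum>i\<in>J. f i x) = (\<Sum>i\<in>J. prism_integral (f i))"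
  unfolding prism_integral_def sum_distrib_left by (intro Bochner_Integration.integral_sum integrable_prism)

lemma bary_shift:
  assumes "p \<in> C" "i \<in> C" "j \<in> C"
  shows "bary p (x + c *\<^sub>R (i - j)) = bary p x + c * (of_bool (p = i) - of_bool (p = j))"
proof -
  have "bary p (x + c *\<^sub>R (i - j)) = bary p x + c * (bary p i - bary p j)"
    by (simp add: bary_def inner_simps algebra_simps)
  then show ?thesis
    by (simp only: bary_vertex[OF assms(1,2)] bary_vertex[OF assms(1,3)])
qed

lemma proj_shift:
  assumes "i \<in> C" "j \<in> C"
  shows "proj (x + c *\<^sub>R (i - j)) = proj x + c *\<^sub>R (i - j)"
proof -
  have *: "(\<Sum>p\<in>C. of_bool (p = k) *\<^sub>R p) = k" if "k \<in> C" for k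
  proof -
    have "(\<Sum>p\<in>C. of_bool (p = k) *\<^sub>R p) = (\<Sum>p\<in>C. if p = k then p else 0)"
      by (rule sum.cong) auto
    then show ?thesis using finite_C that by simp
  qed
  have "proj (x + c *\<^sub>R (i - j))
      = (\<Sum>p\<in>C. (bary p x + c * (of_bool (p = i) - of_bool (p = j))) *\<^sub>R p)"
    unfolding proj_eq by (rule sum.cong) (auto simp only: bary_shift assms)
  also have "\<dots> = (\<Sum>p\<in>C. bary p x *\<^sub>R p)
      + c *\<^sub>R ((\<Sum>p\<in>C. of_bool (p = i) *\<^sub>R p) - (\<Sum>p\<in>C. of_bool (p = j) *\<^sub>R p))"
    by (simp only: scaleR_left_distrib scaleR_left_diff_distrib right_diff_distrib
        sum.distrib sum_subtractf scaleR_right_diff_distrib scaleR_sum_right scaleR_scaleR)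
  also have "\<dots> = proj x + c *\<^sub>R (i - j)"
    by (simp only: *[OF assms(1)] *[OF assms(2)] proj_eq)
  finally show ?thesis .
qed

text \<open>The direction \<open>i - j\<close> is parallel to the affine hull, so the distance from
  it is unchanged; among the coordinates only those of \<open>i\<close> and \<open>j\<close> move,
  in opposite senses. As the claim is pointwise, \<open>c\<close> may be chosen depending on
  \<open>x\<close>, and both substitutions do so.\<close>

lemma shift_mem_prism_iff:
  assumes "i \<in> C" "j \<in> C" "i \<noteq> j"
  shows "x + c *\<^sub>R (i - j) \<in> prism \<longleftrightarrow> (\<forall>p\<in>C - {i, j}. 0 \<le> bary p x) \<and>
    0 \<le> bary i x + c \<and> 0 \<le> bary j x - c \<and> dist x (proj x) \<le> 1 / 2"
proof -
  have b: "bary p (x + c *\<^sub>R (i - j)) = bary p x" if "p \<in> C - {i, j}" for p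
    using that bary_shift[of p i j x c] assms by simp
  have i: "bary i (x + c *\<^sub>R (i - j)) = bary i x + c"
    using bary_shift[of i i j x c] assms by simp
  have j: "bary j (x + c *\<^sub>R (i - j)) = bary j x - c"
    using bary_shift[of j i j x c] assms by simp
  have d: "dist (x + c *\<^sub>R (i - j)) (proj (x + c *\<^sub>R (i - j))) = dist x (proj x)"
    by (simp add: proj_shift[OF assms(1,2)] dist_norm)
  have "(\<forall>p\<in>C. 0 \<le> bary p y) \<longleftrightarrow> (\<forall>p\<in>C - {i, j}. 0 \<le> bary p y) \<and> 0 \<le> bary i y \<and> 0 \<le> bary j y" for y
    using assms by blast
  then show ?thesis unfolding prism_eq mem_Collect_eq d using b i j by auto
qed

definition prism_le :: "real^'n \<Rightarrow> real^'n \<Rightarrow> (real^'n) set"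
  where "prism_le j i = {x \<in> prism. bary j x \<le> bary i x}"

lemma closed_le_bary: "closed {x. bary j x \<le> bary i x}"
  by (intro closed_Collect_le continuous_bary)

lemma prism_le_borel [measurable]: "prism_le j i \<in> sets borel"
proof -
  have "prism_le j i = prism \<inter> {x. bary j x \<le> bary i x}" by (auto simp: prism_le_def)
  moreover have "{x. bary j x \<le> bary i x} \<in> sets borel"
    by (rule borel_closed[OF closed_le_bary])
  ultimately show ?thesis by simp
qed

definition prism_integral_le :: "real^'n \<Rightarrow> real^'n \<Rightarrow> (real^'n \<Rightarrow> real) \<Rightarrow> real"
  where "prism_integral_le j i f = (\<integral>x. indicator (prism_le j i) x * f x \<partial>lborel)"

lemma compact_prism_le: "compact (prism_le j i)"
proof -
  have "prism_le j i = prism \<inter> {x. bary j x \<le> bary i x}" by (auto simp: prism_le_def)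
  then show ?thesis using compact_prism closed_le_bary by (simp add: compact_Int_closed)
qed

lemma continuous_borel: "continuous_on UNIV f \<Longrightarrow> f \<in> borel_measurable borel"
  for f :: "real^'n \<Rightarrow> real"
  by (rule borel_measurable_continuous_onI)

lemma prism_integral_split:
  assumes "i \<in> C" "j \<in> C" "i \<noteq> j" "continuous_on UNIV f"
  shows "prism_integral f = prism_integral_le j i f + prism_integral_le i j f"
proof -
  define N where "N = {x. (bary_grad i - bary_grad j) \<bullet> x = bary_const j - bary_const i}"
  \<comment> \<open>Otherwise \<open>bary i - bary j\<close> would be constant, but it is 1 at
    \<open>i\<close> and -1 at \<open>j\<close>. So the overlap \<open>N\<close> of the two halves
    lies in a genuine hyperplane and is null.\<close>
  have "bary_grad i \<noteq> bary_grad j"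
  proof
    assume "bary_grad i = bary_grad j"
    moreover have "bary i i - bary j i \<noteq> bary i j - bary j j"
      using bary_vertex[of i i] bary_vertex[of i j] bary_vertex[of j i] bary_vertex[of j j] assms
      by simp
    ultimately show False by (simp add: bary_def)
  qed
  then have "negligible N"
    unfolding N_def by (intro negligible_hyperplane) simp
  moreover have "N \<in> sets borel"
    unfolding N_def by (intro borel_closed closed_hyperplane)
  ultimately have N: "N \<in> null_sets lborel"
    by (simp add: negligible_iff_null_sets null_sets_completion_iff)
  have "prism_integral f = (\<integral>x. indicator (prism_le j i) x * f x + indicator (prism_le i j) x * f x \<partial>lborel)"
    unfolding prism_integral_def
  proof (rule integral_cong_AE)
    show "AE x in lborel. indicator prism x * f x
        = indicator (prism_le j i) x * f x + indicator (prism_le i j) x * f x"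
      using AE_not_in[OF N]
    proof eventually_elim
      case (elim x)
      then have "bary i x \<noteq> bary j x" by (simp add: N_def bary_def inner_diff_left)
      then show ?case by (auto simp: prism_le_def indicator_def)
    qed
  qed (use continuous_borel[OF assms(4)] in measurable)
  also have "\<dots> = prism_integral_le j i f + prism_integral_le i j f"
    unfolding prism_integral_le_def
    by (intro Bochner_Integration.integral_add integrable_indicator_compact compact_prism_le assms)
  finally show ?thesis .
qed

lemma swap_mem_prism_iff:
  assumes "i \<in> C" "j \<in> C" "i \<noteq> j"
  shows "x + (bary j x - bary i x) *\<^sub>R (i - j) \<in> prism \<longleftrightarrow> x \<in> prism"
  using shift_mem_prism_iff[OF assms, of x "bary j x - bary i x"] shift_mem_prism_iff[OF assms, of x 0]
  by auto

text \<open>The substitution exchanges the barycentric coordinates of \<open>i\<close> and \<open>j\<close> and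
  maps the prism onto itself; the latter forces its Jacobian to be one.\<close>

lemma integral_swap:
  fixes F :: "real^'n \<Rightarrow> real"
  assumes "i \<in> C" "j \<in> C" "i \<noteq> j" "F \<in> borel_measurable borel"
  shows "(\<integral>x. F (x + (bary j x - bary i x) *\<^sub>R (i - j)) \<partial>lborel) = (\<integral>x. F x \<partial>lborel)"
proof -
  define v where "v = bary_grad j - bary_grad i"
  define d where "d = bary_const j - bary_const i"
  have vd: "bary j x - bary i x = v \<bullet> x + d" for x
    by (simp add: bary_def v_def d_def inner_diff_left)
  \<comment> \<open>The substitution is an oblique reflection, with determinant -1.\<close>
  have "1 + v \<bullet> (i - j) = -1"
  proof -
    have "v \<bullet> (i - j) = (v \<bullet> i + d) - (v \<bullet> j + d)" by (simp add: inner_diff_right)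
    also have "\<dots> = -2"
      unfolding vd[symmetric]
      using bary_vertex[of i i] bary_vertex[of i j] bary_vertex[of j i] bary_vertex[of j j] assms
      by simp
    finally show ?thesis by simp
  qed
  then have "1 + v \<bullet> (i - j) \<noteq> 0" by simp
  from lborel_integral_rank_one_perturbation[OF this, of d]
  obtain c where c: "c \<ge> 0" "\<And>F :: real^'n \<Rightarrow> real. F \<in> borel_measurable borel \<Longrightarrow>
      (\<integral>x. F (x + (v \<bullet> x + d) *\<^sub>R (i - j)) \<partial>lborel) = c * (\<integral>x. F x \<partial>lborel)"
    by blast
  have "(\<integral>x. indicator prism (x + (bary j x - bary i x) *\<^sub>R (i - j)) \<partial>lborel)
      = c * (\<integral>x. indicator prism x \<partial>lborel)"
    unfolding vd by (rule c(2)) measurable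
  then have "prism_integral (\<lambda>_. 1) = c * prism_integral (\<lambda>_. 1)"
    using swap_mem_prism_iff[OF assms(1-3)] by (simp add: prism_integral_def indicator_def)
  then have "c = 1" using vol_pos by simp
  then show ?thesis using c(2)[OF assms(4)] by (simp add: vd)
qed

lemma bary_swap:
  assumes "i \<in> C" "j \<in> C" "i \<noteq> j"
  shows "bary i (x + (bary j x - bary i x) *\<^sub>R (i - j)) = bary j x"
    and "bary j (x + (bary j x - bary i x) *\<^sub>R (i - j)) = bary i x"
  using bary_shift[of i i j x] bary_shift[of j i j x] assms by simp_all

text \<open>By exchange of \<open>i\<close> and \<open>j\<close>. The exponent 1 serves the first
  moments, the exponent 2 the squares.\<close>

lemma prism_integral_bary_eq:
  assumes "i \<in> C" "j \<in> C"
  shows "prism_integral (\<lambda>x. bary i x ^ k) = prism_integral (\<lambda>x. bary j x ^ k)"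
proof (cases "i = j")
  case False
  have [measurable]: "bary i \<in> borel_measurable borel"
    by (rule continuous_borel[OF continuous_bary])
  have "(\<integral>x. indicator prism (x + (bary j x - bary i x) *\<^sub>R (i - j)) *
      bary i (x + (bary j x - bary i x) *\<^sub>R (i - j)) ^ k \<partial>lborel) = prism_integral (\<lambda>x. bary i x ^ k)"
    unfolding prism_integral_def by (rule integral_swap[OF assms False]) measurable
  then show ?thesis
    using swap_mem_prism_iff[OF assms False] bary_swap(1)[OF assms False]
    by (simp add: prism_integral_def indicator_def)
qed simp

text \<open>The hyperplane on which the coordinates of \<open>i\<close> and \<open>j\<close> agree cuts the prism into two
  halves, and each of them is an affine copy of the prism. This self-similarity determines the
  second moments.\<close>

lemma prism_integral_le_halving:
  assumes "i \<in> C" "j \<in> C" "i \<noteq> j"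
  obtains c :: real where
    "\<And>f. continuous_on UNIV f \<Longrightarrow> prism_integral_le j i (\<lambda>x. f (x + bary j x *\<^sub>R (j - i))) = c * prism_integral f"
proof -
  have "1 + bary_grad j \<bullet> (j - i) = 2"
  proof -
    have "bary_grad j \<bullet> (j - i) = bary j j - bary j i" by (simp add: bary_def inner_diff_right)
    also have "\<dots> = 1"
      using bary_vertex[of j i] bary_vertex[of j j] assms by simp
    finally show ?thesis by simp
  qed
  then have "1 + bary_grad j \<bullet> (j - i) \<noteq> 0" by simp
  from lborel_integral_rank_one_perturbation[OF this, of "bary_const j"]
  obtain c where c: "\<And>F :: real^'n \<Rightarrow> real. F \<in> borel_measurable borel \<Longrightarrow>
      (\<integral>x. F (x + bary j x *\<^sub>R (j - i)) \<partial>lborel) = c * (\<integral>x. F x \<partial>lborel)"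
    unfolding bary_def by blast
  \<comment> \<open>The substitution doubles coordinate \<open>j\<close> and lowers coordinate
    \<open>i\<close> by \<open>bary j x\<close>; nonnegativity of the new coordinate
    \<open>i\<close> is the inequality that defines the half.\<close>
  have mem: "x + bary j x *\<^sub>R (j - i) \<in> prism \<longleftrightarrow> x \<in> prism_le j i" for x
    using shift_mem_prism_iff[of j i x "bary j x"] shift_mem_prism_iff[of j i x 0] assms
    by (auto simp: prism_le_def)
  show ?thesis
  proof (rule that)
    fix f :: "real^'n \<Rightarrow> real" assume "continuous_on UNIV f"
    note [measurable] = continuous_borel[OF this]
    have "(\<integral>x. indicator prism (x + bary j x *\<^sub>R (j - i)) * f (x + bary j x *\<^sub>R (j - i)) \<partial>lborel) = c * prism_integral f"
      unfolding prism_integral_def by (rule c) measurable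
    then show "prism_integral_le j i (\<lambda>x. f (x + bary j x *\<^sub>R (j - i))) = c * prism_integral f"
      by (simp add: prism_integral_le_def indicator_def mem)
  qed
qed

text \<open>The exchange of \<open>i\<close> and \<open>j\<close> maps one half onto the other.
  Tested with the constant 1, this value fixes the unknown factor of the halving
  substitution.\<close>

lemma prism_integral_le_vol:
  assumes "i \<in> C" "j \<in> C" "i \<noteq> j"
  shows "prism_integral_le j i (\<lambda>_. 1) = prism_integral (\<lambda>_. 1) / 2"
proof -
  have "(\<integral>x. indicator (prism_le i j) (x + (bary j x - bary i x) *\<^sub>R (i - j)) \<partial>lborel) = prism_integral_le i j (\<lambda>_. 1)"
    unfolding prism_integral_le_def by (subst integral_swap[OF assms]) auto
  then have "prism_integral_le j i (\<lambda>_. 1) = prism_integral_le i j (\<lambda>_. 1)"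
    using swap_mem_prism_iff[OF assms] bary_swap[OF assms] by (simp add: prism_integral_le_def indicator_def prism_le_def)
  then show ?thesis using prism_integral_split[OF assms, of "\<lambda>_. 1"] by simp
qed

lemma prism_integral_le_shift:
  assumes "i \<in> C" "j \<in> C" "i \<noteq> j" "continuous_on UNIV f"
  shows "prism_integral_le j i (\<lambda>x. f (x + bary j x *\<^sub>R (j - i))) = prism_integral f / 2"
proof -
  obtain c where c: "\<And>f. continuous_on UNIV f \<Longrightarrow>
      prism_integral_le j i (\<lambda>x. f (x + bary j x *\<^sub>R (j - i))) = c * prism_integral f"
    using prism_integral_le_halving[OF assms(1-3)] by blast
  have "c = 1 / 2"
    using c[of "\<lambda>_. 1"] prism_integral_le_vol[OF assms(1-3)] vol_pos by simp
  then show ?thesis using c[OF assms(4)] by simp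
qed

lemma prism_integral_le_bary_mult:
  assumes "i \<in> C" "j \<in> C" "i \<noteq> j"
  shows "prism_integral_le j i (\<lambda>x. bary i x * bary j x)
    = prism_integral (\<lambda>x. bary i x * bary j x) / 4 + prism_integral (\<lambda>x. bary j x ^ 2) / 8"
proof -
  \<comment> \<open>Obtained by solving the substitution for the old coordinates: if the new ones
    are s for \<open>i\<close> and t for \<open>j\<close>, the old ones are s + t/2 and t/2, with
    product s t / 2 + t^2 / 4.\<close>
  define f where "f x = 1 / 2 * (bary i x * bary j x) + 1 / 4 * bary j x ^ 2" for x
  have sh: "bary i (x + bary j x *\<^sub>R (j - i)) = bary i x - bary j x"
    "bary j (x + bary j x *\<^sub>R (j - i)) = 2 * bary j x" for x
    using bary_shift[of i j i x] bary_shift[of j j i x] assms by simp_all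
  have "f (x + bary j x *\<^sub>R (j - i)) = bary i x * bary j x" for x
    unfolding f_def sh by (simp add: field_simps power2_eq_square)
  then have "prism_integral_le j i (\<lambda>x. bary i x * bary j x) = prism_integral f / 2"
    using prism_integral_le_shift[OF assms, of f]
    by (simp add: f_def[abs_def] continuous_intros continuous_bary)
  also have "prism_integral f = 1 / 2 * prism_integral (\<lambda>x. bary i x * bary j x) + 1 / 4 * prism_integral (\<lambda>x. bary j x ^ 2)"
    unfolding f_def
    by (subst prism_integral_add) (simp_all only: prism_integral_cmult, (intro continuous_intros continuous_bary)+)
  finally show ?thesis by simp
qed

text \<open>With M the mixed moment and P the moment of the square, each half contributes M/4 + P/8,
  so M = M/2 + P/4.\<close>

lemma prism_integral_bary_mult:
  assumes "i \<in> C" "j \<in> C" "i \<noteq> j"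
  shows "prism_integral (\<lambda>x. bary i x * bary j x) = prism_integral (\<lambda>x. bary i x ^ 2) / 2"
proof -
  have "prism_integral (\<lambda>x. bary i x * bary j x)
      = prism_integral_le j i (\<lambda>x. bary i x * bary j x) + prism_integral_le i j (\<lambda>x. bary j x * bary i x)"
    using prism_integral_split[OF assms, of "\<lambda>x. bary i x * bary j x"]
    by (simp add: continuous_intros continuous_bary mult.commute)
  then show ?thesis
    using prism_integral_le_bary_mult[OF assms] prism_integral_le_bary_mult[OF assms(2,1)] assms(3)
      prism_integral_bary_eq[OF assms(1,2), of 2]
    by (simp add: mult.commute[of "bary j _"])
qed

section \<open>First and second moments\<close>

abbreviation vol :: real
  where "vol \<equiv> prism_integral (\<lambda>_. 1)"

lemma prism_integral_bary:
  assumes "i \<in> C"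
  shows "prism_integral (bary i) = vol / card C"
proof -
  have "vol = prism_integral (\<lambda>x. \<Sum>p\<in>C. bary p x)" by (simp only: sum_bary)
  also have "\<dots> = (\<Sum>p\<in>C. prism_integral (bary p))" by (intro prism_integral_sum continuous_bary)
  also have "\<dots> = (\<Sum>p\<in>C. prism_integral (bary i))"
    using prism_integral_bary_eq[OF _ assms, of _ 1] by (intro sum.cong) simp_all
  finally show ?thesis using card_pos by simp
qed

text \<open>The coordinates sum to 1. Multiplying this by \<open>bary i\<close> and integrating
  gives vol/d = (d+1) a/2, where d is the number of vertices and \<open>a\<close> the moment of the
  square: every vertex contributes a/2, and \<open>i\<close> itself a second time.\<close>

lemma prism_integral_bary_bary:
  assumes "i \<in> C" "j \<in> C"
  shows "prism_integral (\<lambda>x. bary i x * bary j x)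
    = vol / (real (card C) * (real (card C) + 1)) * (1 + of_bool (i = j))"
proof -
  define a where "a = prism_integral (\<lambda>x. bary i x ^ 2)"
  define d where "d = real (card C)"
  have d: "d > 0" using card_pos by (simp add: d_def)
  have mult: "prism_integral (\<lambda>x. bary i x * bary p x) = a / 2 + (if p = i then a / 2 else 0)" if "p \<in> C" for p
    using prism_integral_bary_mult[OF assms(1) that] by (auto simp: a_def power2_eq_square)
  have "vol / d = prism_integral (bary i)"
    using prism_integral_bary[OF assms(1)] by (simp add: d_def)
  also have "\<dots> = prism_integral (\<lambda>x. \<Sum>p\<in>C. bary i x * bary p x)"
    by (simp only: sum_distrib_left[symmetric] sum_bary mult_1_right)
  also have "\<dots> = (\<Sum>p\<in>C. prism_integral (\<lambda>x. bary i x * bary p x))"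
    by (intro prism_integral_sum continuous_intros continuous_bary)
  also have "\<dots> = (\<Sum>p\<in>C. a / 2 + (if p = i then a / 2 else 0))"
    by (rule sum.cong) (simp_all only: mult)
  also have "\<dots> = d * (a / 2) + a / 2"
    using assms(1) finite_C by (simp add: sum.distrib d_def)
  finally have "a / 2 * (d * (d + 1)) = vol"
    using d by (simp add: field_simps)
  moreover have "d * (d + 1) \<noteq> 0" using d by simp
  ultimately have "a / 2 = vol / (d * (d + 1))"
    using nonzero_eq_divide_eq by blast
  then show ?thesis
    using mult[OF assms(2)] by (auto simp: d_def)
qed

lemma prism_integral_affine: "prism_integral (\<lambda>x. w \<bullet> proj x + c) = vol / card C * (\<Sum>p\<in>C. w \<bullet> p + c)"
proof -
  have "w \<bullet> proj x + c = (\<Sum>p\<in>C. (w \<bullet> p + c) * bary p x)" for x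
  proof -
    have "(\<Sum>p\<in>C. (w \<bullet> p + c) * bary p x) = (\<Sum>p\<in>C. bary p x * (w \<bullet> p)) + c * (\<Sum>p\<in>C. bary p x)"
      by (simp add: algebra_simps sum.distrib flip: sum_distrib_left)
    then show ?thesis by (simp only: sum_bary) (simp add: proj_eq inner_sum_right)
  qed
  then have "prism_integral (\<lambda>x. w \<bullet> proj x + c) = (\<Sum>p\<in>C. (w \<bullet> p + c) * prism_integral (bary p))"
    by (simp only:) (subst prism_integral_sum, intro continuous_intros continuous_bary, simp only: prism_integral_cmult)
  also have "\<dots> = (\<Sum>p\<in>C. (w \<bullet> p + c) * (vol / card C))"
    by (rule sum.cong) (simp_all add: prism_integral_bary)
  finally show ?thesis by (simp add: sum_distrib_left sum_divide_distrib mult.commute)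
qed

text \<open>Expand \<open>proj x - m\<close> in the vectors \<open>p - m\<close> with barycentric
  weights. The two parts of the factor \<open>1 + of_bool (p = q)\<close> produce the full double
  sum and the diagonal. The double sum is the form at the sum of all \<open>p - m\<close>; if
  \<open>m\<close> is the centroid of an element and \<open>C\<close> one of its faces, it supplies
  the missing vertex.\<close>

lemma prism_integral_quadratic:
  "prism_integral (\<lambda>x. (proj x - m) \<bullet> (M *v (proj x - m))) = vol / (real (card C) * (real (card C) + 1)) *
    ((\<Sum>p\<in>C. (p - m) \<bullet> (M *v (p - m))) + (\<Sum>p\<in>C. p - m) \<bullet> (M *v (\<Sum>p\<in>C. p - m)))"
proof -
  define k where "k = vol / (real (card C) * (real (card C) + 1))"
  define b where "b p q = (p - m) \<bullet> (M *v (q - m))" for p q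
  have lin: "M *v (\<Sum>p\<in>C. f p) = (\<Sum>p\<in>C. M *v f p)" for f :: "real^'n \<Rightarrow> real^'n"
    by (rule linear_sum) (rule matrix_vector_mul_linear)
  have pm: "proj x - m = (\<Sum>p\<in>C. bary p x *\<^sub>R (p - m))" for x
    by (simp only: scaleR_right_diff_distrib sum_subtractf proj_eq scaleR_sum_left[symmetric]
        sum_bary scaleR_one)
  have "(proj x - m) \<bullet> (M *v (proj x - m))
      = (\<Sum>p\<in>C. \<Sum>q\<in>C. b p q * (bary p x * bary q x))" for x
  proof -
    have "(proj x - m) \<bullet> (M *v (proj x - m))
        = (\<Sum>q\<in>C. \<Sum>p\<in>C. b p q * (bary p x * bary q x))"
      by (simp add: pm lin inner_sum_left inner_sum_right b_def matrix_vector_mult_scaleR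
          sum_distrib_left mult.assoc mult.left_commute mult.commute)
    also have "\<dots> = (\<Sum>p\<in>C. \<Sum>q\<in>C. b p q * (bary p x * bary q x))"
      by (rule sum.swap)
    finally show ?thesis .
  qed
  then have "prism_integral (\<lambda>x. (proj x - m) \<bullet> (M *v (proj x - m)))
      = (\<Sum>p\<in>C. \<Sum>q\<in>C. b p q * prism_integral (\<lambda>x. bary p x * bary q x))"
    by (simp only:) (subst prism_integral_sum, intro continuous_intros continuous_bary,
        subst prism_integral_sum, intro continuous_intros continuous_bary, simp only: prism_integral_cmult)
  also have "\<dots> = (\<Sum>p\<in>C. \<Sum>q\<in>C. k * (b p q + (if p = q then b p q else 0)))"
    by (intro sum.cong refl) (simp only: prism_integral_bary_bary k_def[symmetric], simp add: algebra_simps)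
  also have "\<dots> = k * ((\<Sum>p\<in>C. \<Sum>q\<in>C. b p q) + (\<Sum>p\<in>C. b p p))"
    using finite_C by (simp add: sum.distrib flip: sum_distrib_left)
  also have "(\<Sum>p\<in>C. \<Sum>q\<in>C. b p q) = (\<Sum>p\<in>C. p - m) \<bullet> (M *v (\<Sum>p\<in>C. p - m))"
    unfolding lin inner_sum_left inner_sum_right b_def by (rule sum.swap)
  finally show ?thesis by (simp add: k_def b_def add.commute)
qed

end

section \<open>Faces and bubbles of an element\<close>

text \<open>Every point of a convex set with nonempty interior is a limit point of that interior, so
  the limit behind \<open>trace_on\<close> is unique and agrees with any continuous
  extension.\<close>

lemma trace_on_eq:
  assumes "convex K" "interior K \<noteq> {}" "x \<in> K" "continuous_on UNIV g"
    and "\<And>y. y \<in> interior K \<Longrightarrow> v y = g y"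
  shows "trace_on K v x = g x"
proof -
  have "x islimpt interior K"
  proof (cases "x \<in> interior K")
    case True
    then show ?thesis by (metis interior_limit_point interior_interior)
  next
    case False
    have "x \<in> closure (interior K)"
      using assms(1-3) closure_subset convex_closure_interior by blast
    then show ?thesis using False by (simp add: closure_def)
  qed
  then have "\<not> trivial_limit (at x within interior K)"
    by (simp add: trivial_limit_within)
  moreover have "(g \<longlongrightarrow> g x) (at x within interior K)"
    using assms(4) continuous_on_eq_continuous_at[OF open_UNIV] isContD tendsto_within_subset
    by (metis UNIV_I subset_UNIV)
  then have "(v \<longlongrightarrow> g x) (at x within interior K)"
    by (rule Lim_transform_eventually)
      (simp add: eventually_at_filter assms(5))
  ultimately show ?thesis unfolding trace_on_def by (rule tendsto_Lim)
qed

text \<open>In the applications \<open>f\<close> is built from traces and is known only on the face;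
  projected points of the prism never leave it. Passing from the completed measure to
  \<open>lborel\<close> makes the affine substitutions available.\<close>

lemma (in affinely_independent) face_integral_eq:
  assumes "\<And>x. x \<in> convex hull C \<Longrightarrow> f x = g x" "continuous_on UNIV g"
  shows "face_integral (convex hull C) f = prism_integral (\<lambda>x. g (proj x))"
proof -
  have "continuous_on UNIV (\<lambda>x. g (proj x))"
    by (rule continuous_on_compose2[OF assms(2) continuous_proj]) simp
  note [measurable] = continuous_borel[OF this]
  have "face_integral (convex hull C) f = integral\<^sup>L (lebesgue_on prism) (\<lambda>x. g (proj x))"
    unfolding face_integral_def affine_hull_convex_hull proj_def[symmetric]
    by (intro Bochner_Integration.integral_cong refl) (simp add: assms(1) proj_prism)
  also have "\<dots> = (\<integral>x. indicator prism x *\<^sub>R g (proj x) \<partial>lebesgue)"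
    by (rule integral_restrict_space) (simp add: borel_compact compact_prism)
  also have "\<dots> = (\<integral>x. indicator prism x *\<^sub>R g (proj x) \<partial>lborel)"
    by (rule integral_completion) measurable
  finally show ?thesis by (simp add: prism_integral_def)
qed

lemma inner_matrix_vector_mult:
  fixes B :: "real^'n^'n"
  shows "x \<bullet> (B *v y) = (\<Sum>i\<in>UNIV. \<Sum>j\<in>UNIV. B $ i $ j * (x $ i * y $ j))"
  by (simp add: inner_vec_def matrix_vector_mult_def sum_distrib_left mult_ac)

section \<open>Simplices of full dimension\<close>

locale full_simplex =
  fixes K :: "(real^'n) set"
  assumes simplex_K: "int CARD('n) simplex K"
begin

lemma
  shows indep_vertices: "\<not> affine_dependent (vertices K)"
    and card_vertices: "card (vertices K) = CARD('n) + 1"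
    and hull_vertices: "convex hull (vertices K) = K"
proof -
  obtain C where C: "\<not> affine_dependent C" "int (card C) = int CARD('n) + 1" "K = convex hull C"
    using simplex_K unfolding simplex_def by blast
  then have "vertices K = C"
    unfolding vertices_def using extreme_point_of_convex_hull_affine_independent[OF C(1)] by simp
  then show "\<not> affine_dependent (vertices K)" "card (vertices K) = CARD('n) + 1"
    "convex hull (vertices K) = K"
    using C by auto
qed

sublocale affinely_independent "vertices K"
  using indep_vertices card_vertices by unfold_locales auto

lemma affine_hull_vertices: "affine hull (vertices K) = UNIV"
  using affine_independent_span_eq[OF indep_vertices] card_vertices by simp

lemma proj_id [simp]: "proj x = x"
  by (rule proj_self) (simp add: affine_hull_vertices)

lemma affine_hull_K: "affine hull K = UNIV"
  using affine_hull_vertices affine_hull_convex_hull[of "vertices K"] by (simp add: hull_vertices)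

text \<open>The affine hull is the whole space and the projection is the identity, so the moments of
  the locale become volume moments of the element.\<close>

lemma prism_id: "prism = K"
  unfolding unit_prism_def hull_vertices affine_hull_K by (simp add: closest_point_self)

lemma compact_K: "compact K" and convex_K: "convex K"
  using compact_prism prism_id hull_vertices convex_convex_hull[of "vertices K"] by auto

lemma interior_nonempty: "interior K \<noteq> {}"
proof -
  have "rel_interior K = interior K" by (rule rel_interior_interior[OF affine_hull_K])
  moreover have "K \<noteq> {}" using nonempty hull_vertices by (metis convex_hull_eq_empty)
  ultimately show ?thesis using rel_interior_eq_empty[OF convex_K] by simp
qed

lemma trace_on_K:
  assumes "x \<in> K" "continuous_on UNIV g" "\<And>y. y \<in> interior K \<Longrightarrow> v y = g y"
  shows "trace_on K v x = g x"
  by (rule trace_on_eq[OF convex_K interior_nonempty]) (use assms in auto)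

lemma sum_vertices_mid: "(\<Sum>p\<in>vertices K. p - mid K) = 0"
proof -
  have "(\<Sum>p\<in>vertices K. mid K) = (\<Sum>p\<in>vertices K. p)"
    unfolding sum_constant_scaleR card_vertices mid_def
    by (simp add: add.commute add_nonneg_eq_0_iff)
  then show ?thesis by (simp add: sum_subtractf)
qed

lemma facetE:
  assumes "E facet_of K"
  obtains a where "a \<in> vertices K" "E = convex hull (vertices K - {a})"
  using assms facet_of_convex_hull_affine_independent_alt[OF indep_vertices] hull_vertices by auto

lemma facetI: "a \<in> vertices K \<Longrightarrow> (convex hull (vertices K - {a})) facet_of K"
  using facet_of_convex_hull_affine_independent_alt[OF indep_vertices] hull_vertices card_vertices
  by (auto simp: Suc_le_eq)

lemma affinely_independent_facet:
  assumes "a \<in> vertices K"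
  shows "affinely_independent (vertices K - {a})"
proof
  show "\<not> affine_dependent (vertices K - {a})"
    using indep_vertices affine_dependent_subset by blast
  have "card (vertices K - {a}) = CARD('n)"
    using card_vertices assms finite_C by simp
  then show "vertices K - {a} \<noteq> {}" by force
qed

lemma affine_eq_zero:
  assumes "\<And>p. p \<in> vertices K \<Longrightarrow> c + w \<bullet> p = 0"
  shows "c + w \<bullet> x = 0"
proof -
  have "c + w \<bullet> x = c * (\<Sum>p\<in>vertices K. bary p x) + w \<bullet> (\<Sum>p\<in>vertices K. bary p x *\<^sub>R p)"
    by (simp only: sum_bary proj_eq[symmetric]) simp
  also have "\<dots> = (\<Sum>p\<in>vertices K. bary p x * (c + w \<bullet> p))"
    by (simp add: inner_sum_right algebra_simps sum.distrib sum_distrib_left)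
  also have "\<dots> = 0" by (rule sum.neutral) (simp add: assms)
  finally show ?thesis .
qed

lemma affine_interpolation:
  obtains c w where "\<And>p. p \<in> vertices K \<Longrightarrow> c + w \<bullet> p = f p"
proof
  fix p assume p: "p \<in> vertices K"
  have "(\<Sum>q\<in>vertices K. f q * bary_const q) + (\<Sum>q\<in>vertices K. f q *\<^sub>R bary_grad q) \<bullet> p
      = (\<Sum>q\<in>vertices K. f q * bary q p)"
    by (simp add: bary_def inner_sum_left algebra_simps sum.distrib)
  also have "\<dots> = (\<Sum>q\<in>vertices K. if q = p then f q else 0)"
    by (rule sum.cong) (simp_all add: bary_vertex p)
  finally show "(\<Sum>q\<in>vertices K. f q * bary_const q) + (\<Sum>q\<in>vertices K. f q *\<^sub>R bary_grad q) \<bullet> p = f p"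
    using p finite_C by simp
qed

text \<open>Unisolvence of the Crouzeix-Raviart element. A vanishing mean on the face opposite
  \<open>a\<close> says that the other vertex values sum to zero, so \<open>g a\<close> equals the
  total \<open>s\<close>. Adding over the n+1 vertices gives s = (n+1) s.\<close>

lemma affine_face_integrals_zero:
  assumes "\<And>E. E facet_of K \<Longrightarrow> face_integral E (\<lambda>x. c + w \<bullet> x) = 0"
  shows "c + w \<bullet> x = 0"
proof -
  define g where "g p = w \<bullet> p + c" for p
  define s where "s = (\<Sum>p\<in>vertices K. g p)"
  have gs: "g a = s" if a: "a \<in> vertices K" for a
  proof -
    interpret F: affinely_independent "vertices K - {a}"
      using a by (rule affinely_independent_facet)
    have "0 = F.prism_integral (\<lambda>x. w \<bullet> F.proj x + c)"
      using assms[OF facetI[OF a]]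
      by (subst (asm) F.face_integral_eq[where g = "\<lambda>x. w \<bullet> x + c"]) (auto intro!: continuous_intros)
    then have "(\<Sum>p\<in>vertices K - {a}. g p) = 0"
      using F.prism_integral_affine[of w c] F.vol_pos F.card_pos by (simp add: g_def)
    then show ?thesis
      using sum.remove[OF finite_C a, of g] by (simp add: s_def)
  qed
  have "s = (\<Sum>p\<in>vertices K. g p)" by (simp add: s_def)
  also have "\<dots> = (\<Sum>p\<in>vertices K. s)" by (rule sum.cong) (simp_all only: gs)
  finally have "s = (real CARD('n) + 1) * s" by (simp add: card_vertices)
  then have "s = 0" by (simp add: algebra_simps)
  then have "c + w \<bullet> p = 0" if "p \<in> vertices K" for p
    using gs[OF that] unfolding g_def by linarith
  then show ?thesis by (rule affine_eq_zero)
qed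

text \<open>H adds up the values of the form on all edges. The parallel axis identity rewrites this
  in terms of deviations from the centroid, for which the cross terms cancel; the factor is the
  number of vertices.\<close>

lemma bubble_H_eq:
  "bubble_H B K = (real CARD('n) + 1) * (\<Sum>p\<in>vertices K. (p - mid K) \<bullet> (B *v (p - mid K)))"
proof -
  define b where "b p q = (p - mid K) \<bullet> (B *v (q - mid K))" for p q
  have lin: "M *v (\<Sum>p\<in>X. f p) = (\<Sum>p\<in>X. M *v f p)" for M :: "real^'n^'n" and f :: "real^'n \<Rightarrow> real^'n" and X
    by (rule linear_sum) (rule matrix_vector_mul_linear)
  have "bubble_H B K = (\<Sum>i\<in>UNIV. \<Sum>j\<in>UNIV. B $ i $ j * edge_sum K i j)"
    unfolding bubble_H_def sum.distrib[symmetric]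
    by (intro sum.cong refl sum.remove[symmetric]) auto
  also have "\<dots> = (\<Sum>i\<in>UNIV. \<Sum>j\<in>UNIV. \<Sum>p\<in>vertices K. \<Sum>q\<in>vertices K.
      B $ i $ j * ((p - q) $ i * (p - q) $ j)) / 2"
    by (simp add: edge_sum_def sum_distrib_left sum_divide_distrib)
  also have "(\<Sum>i\<in>UNIV. \<Sum>j\<in>UNIV. \<Sum>p\<in>vertices K. \<Sum>q\<in>vertices K.
      B $ i $ j * ((p - q) $ i * (p - q) $ j))
    = (\<Sum>p\<in>vertices K. \<Sum>q\<in>vertices K. \<Sum>i\<in>UNIV. \<Sum>j\<in>UNIV.
      B $ i $ j * ((p - q) $ i * (p - q) $ j))"
    by (simp only: sum.swap[of _ "vertices K" UNIV])
  also have "\<dots> = (\<Sum>p\<in>vertices K. \<Sum>q\<in>vertices K. (p - q) \<bullet> (B *v (p - q)))"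
    by (simp only: inner_matrix_vector_mult)
  also have "\<dots> = (\<Sum>p\<in>vertices K. \<Sum>q\<in>vertices K. b p p - b p q - b q p + b q q)"
    unfolding b_def by (simp add: algebra_simps matrix_vector_mult_diff_distrib)
  also have "\<dots> = 2 * (real CARD('n) + 1) * (\<Sum>p\<in>vertices K. b p p)
      - 2 * (\<Sum>p\<in>vertices K. \<Sum>q\<in>vertices K. b p q)"
    using sum.swap[of "\<lambda>p q. b q p" "vertices K" "vertices K"]
    by (simp add: sum.distrib sum_subtractf card_vertices algebra_simps flip: sum_distrib_left)
  also have "(\<Sum>p\<in>vertices K. \<Sum>q\<in>vertices K. b p q)
      = (\<Sum>p\<in>vertices K. p - mid K) \<bullet> (B *v (\<Sum>p\<in>vertices K. p - mid K))"
    unfolding b_def lin inner_sum_left inner_sum_right by (rule sum.swap)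
  finally show ?thesis by (simp add: sum_vertices_mid b_def field_simps)
qed

text \<open>There are at least two vertices, so one of them differs from \<open>mid K\<close>. This
  makes the division by \<open>bubble_H\<close> in the bubble a genuine one.\<close>

lemma bubble_H_pos:
  assumes "\<And>y. y \<noteq> 0 \<Longrightarrow> y \<bullet> (B *v y) > 0"
  shows "bubble_H B K > 0"
proof -
  have nonneg: "y \<bullet> (B *v y) \<ge> 0" for y using assms[of y] by (cases "y = 0") auto
  have "\<exists>p\<in>vertices K. p \<noteq> mid K"
  proof (rule ccontr)
    assume "\<not> ?thesis"
    then have "vertices K \<subseteq> {mid K}" by auto
    then have "card (vertices K) \<le> 1" using card_mono[of "{mid K}"] by simp
    then show False using card_vertices by simp
  qed
  then obtain p where "p \<in> vertices K" "p \<noteq> mid K" by blast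
  then have "(\<Sum>p\<in>vertices K. (p - mid K) \<bullet> (B *v (p - mid K))) > 0"
    using finite_C assms[of "p - mid K"] nonneg by (intro sum_pos2[of _ p]) auto
  then show ?thesis by (simp add: bubble_H_eq)
qed

lemma continuous_quadratic: "continuous_on UNIV (\<lambda>x. (x - m) \<bullet> (M *v (x - m)))"
  for M :: "real^'n^'n"
proof -
  have "continuous_on UNIV (\<lambda>x. M *v (x - m))"
    by (rule linear_continuous_on_compose[OF _ matrix_vector_mul_linear]) (intro continuous_intros)
  then show ?thesis by (intro continuous_on_inner continuous_on_diff continuous_on_id continuous_on_const)
qed

lemma continuous_bubble: "continuous_on UNIV (bubble B K)"
  unfolding bubble_def[abs_def] Let_def by (intro continuous_intros continuous_quadratic)

lemma face_integral_bubble: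
  assumes "\<And>y. y \<noteq> 0 \<Longrightarrow> y \<bullet> (B *v y) > 0" "E facet_of K"
  shows "face_integral E (\<lambda>x. c * bubble B K x) = 0"
proof -
  obtain a where a: "a \<in> vertices K" "E = convex hull (vertices K - {a})"
    using assms(2) by (rule facetE)
  interpret F: affinely_independent "vertices K - {a}"
    using a(1) by (rule affinely_independent_facet)
  define n where "n = real CARD('n)"
  define Q where "Q y = y \<bullet> (B *v y)" for y
  define S where "S = (\<Sum>p\<in>vertices K. Q (p - mid K))"
  have n: "n > 0" by (simp add: n_def)
  have cardF: "real (card (vertices K - {a})) = n"
    using card_vertices a(1) finite_C by (simp add: n_def)
  have H: "bubble_H B K = (n + 1) * S" by (simp add: bubble_H_eq S_def Q_def n_def)
  then have S: "S \<noteq> 0" using bubble_H_pos[OF assms(1)] by auto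
  have "(a - mid K) + (\<Sum>p\<in>vertices K - {a}. p - mid K) = 0"
    using sum.remove[OF finite_C a(1), of "\<lambda>p. p - mid K"] sum_vertices_mid by simp
  \<comment> \<open>Up to sign the deviation of the missing vertex \<open>a\<close> is the sum of
    the deviations on the face. As the form is even, the extra term of the quadratic moment
    completes the sum \<open>S\<close> over all vertices.\<close>
  then have sumF: "(\<Sum>p\<in>vertices K - {a}. p - mid K) = - (a - mid K)"
    by (rule minus_unique[symmetric])
  have Q_minus: "Q (- y) = Q y" for y
    unfolding Q_def using matrix_vector_mult_scaleR[of B "-1" y] by simp
  have "F.prism_integral (\<lambda>x. Q (F.proj x - mid K)) = F.vol / (n * (n + 1)) *
      ((\<Sum>p\<in>vertices K - {a}. Q (p - mid K)) + Q (- (a - mid K)))"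
    using F.prism_integral_quadratic[of "mid K" B] unfolding cardF sumF Q_def[symmetric] .
  also have "(\<Sum>p\<in>vertices K - {a}. Q (p - mid K)) + Q (- (a - mid K)) = S"
    unfolding Q_minus S_def using sum.remove[OF finite_C a(1), of "\<lambda>p. Q (p - mid K)"] by simp
  finally have IQ: "F.prism_integral (\<lambda>x. Q (F.proj x - mid K)) = F.vol / (n * (n + 1)) * S" .
  define k where "k = n * (n + 1)\<^sup>2 * (n + 2) / (2 * bubble_H B K)"
  have bubble: "bubble B K x = (n + 2) / 2 * 1 + (- k) * Q (x - mid K)" for x
    by (simp add: bubble_def Let_def n_def k_def Q_def)
  have cont: "continuous_on UNIV (\<lambda>x. Q (F.proj x - mid K))"
    unfolding Q_def
    by (rule continuous_on_compose2[OF continuous_quadratic F.continuous_proj]) auto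
  have "face_integral E (\<lambda>x. c * bubble B K x) = F.prism_integral (\<lambda>x. c * bubble B K (F.proj x))"
    unfolding a(2) by (rule F.face_integral_eq[OF refl]) (intro continuous_intros continuous_bubble)
  also have "\<dots> = c * F.prism_integral (\<lambda>x. (n + 2) / 2 * 1 + (- k) * Q (F.proj x - mid K))"
    unfolding F.prism_integral_cmult bubble ..
  also have "F.prism_integral (\<lambda>x. (n + 2) / 2 * 1 + (- k) * Q (F.proj x - mid K))
      = F.prism_integral (\<lambda>x. (n + 2) / 2 * 1) + F.prism_integral (\<lambda>x. (- k) * Q (F.proj x - mid K))"
    by (intro F.prism_integral_add continuous_intros cont)
  also have "\<dots> = (n + 2) / 2 * F.vol - k * F.prism_integral (\<lambda>x. Q (F.proj x - mid K))"
    unfolding F.prism_integral_cmult by simp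
  also have "k * F.prism_integral (\<lambda>x. Q (F.proj x - mid K)) = (n + 2) / 2 * F.vol"
  proof -
    \<comment> \<open>Here \<open>m\<close> stands for n+1 and \<open>q\<close> for n+2: all factors
      cancel except half of \<open>q\<close>, the constant term of the bubble.\<close>
    have "n * m\<^sup>2 * q / (2 * (m * S)) * (V / (n * m) * S) = q / 2 * V" if "m \<noteq> 0" for m q V :: real
      using n S that by (simp add: field_simps power2_eq_square)
    from this[of "n + 1"] n show ?thesis by (simp only: k_def H IQ)
  qed
  finally show ?thesis by simp
qed

end

section \<open>Piecewise continuous functions on a mesh\<close>

lemma grad_eqI:
  assumes "(f has_derivative (\<lambda>h. G \<bullet> h)) (at x)"
  shows "grad f x = G"
proof -
  have "frechet_derivative f (at x) = (\<lambda>h. G \<bullet> h)"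
    using frechet_derivative_at[OF assms] by simp
  then show ?thesis by (simp add: grad_def vec_eq_iff inner_axis)
qed

locale mesh =
  fixes \<Omega> :: "(real^'n) set" and \<T> :: "(real^'n) set set"
  assumes open_domain: "open \<Omega>"
    and partition: "exact_simplicial_partition \<Omega> \<T>"
begin

lemma finite_mesh: "finite \<T>"
  and simplex_mesh: "K \<in> \<T> \<Longrightarrow> full_simplex K"
  and face_Int: "K \<in> \<T> \<Longrightarrow> K' \<in> \<T> \<Longrightarrow> (K \<inter> K') face_of K"
  and closure_domain: "closure \<Omega> = \<Union>\<T>"
  and frontier_domain: "frontier \<Omega> = \<Union>(boundary_faces \<Omega> \<T>)"
  using partition unfolding exact_simplicial_partition_def triangulation_def
  by (auto intro: full_simplex.intro)

text \<open>The intersection is a face of \<open>K\<close> that meets the relative interior of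
  \<open>K\<close>, and \<open>K\<close> is the only such face.\<close>

lemma interior_meets_imp_subset:
  assumes "K \<in> \<T>" "K' \<in> \<T>" "x \<in> interior K" "x \<in> K'"
  shows "K \<subseteq> K'"
proof -
  interpret full_simplex K using assms(1) by (rule simplex_mesh)
  have "x \<in> rel_interior K"
    using assms(3) rel_interior_interior[OF affine_hull_K] by simp
  then have "\<not> disjnt (K \<inter> K') (rel_interior K)"
    using assms(3,4) interior_subset by (auto simp: disjnt_def)
  then have "K \<inter> K' = K"
    using face_of_disjoint_rel_interior[OF face_Int[OF assms(1,2)]] by (auto simp: disjnt_def)
  then show ?thesis by blast
qed

text \<open>Makes elementwise data free of conflicts: a point of an open element belongs to no other
  element.\<close>

lemma interior_meets_imp_eq:
  assumes "K \<in> \<T>" "K' \<in> \<T>" "x \<in> interior K" "x \<in> K'"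
  shows "K = K'"
proof -
  interpret full_simplex K using assms(1) by (rule simplex_mesh)
  interpret K': full_simplex K' using assms(2) by (rule simplex_mesh)
  have sub: "K \<subseteq> K'" by (rule interior_meets_imp_subset[OF assms])
  then have "x \<in> interior K'" using assms(3) interior_mono by blast
  moreover have "x \<in> K" using assms(3) interior_subset by blast
  ultimately have "K' \<subseteq> K" by (rule interior_meets_imp_subset[OF assms(2,1)])
  with sub show ?thesis by blast
qed

text \<open>The frontier consists of facets of elements. A facet through an interior point of
  \<open>K\<close> would have to belong to \<open>K\<close> itself, but proper faces miss the
  relative interior.\<close>

lemma interior_subset_domain:
  assumes "K \<in> \<T>"
  shows "interior K \<subseteq> \<Omega>"
proof
  fix x assume x: "x \<in> interior K"
  then have "x \<in> closure \<Omega>"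
    using assms interior_subset unfolding closure_domain by blast
  moreover have "x \<notin> frontier \<Omega>"
  proof
    assume "x \<in> frontier \<Omega>"
    then have "x \<in> \<Union>(boundary_faces \<Omega> \<T>)" using frontier_domain by blast
    then obtain E K' where E: "x \<in> E" "K' \<in> \<T>" "E facet_of K'"
      unfolding boundary_faces_def faces_def by blast
    then have "x \<in> K'" using facet_of_imp_subset by blast
    then have "K = K'" by (rule interior_meets_imp_eq[OF assms E(2) x])
    then have E: "E face_of K" "E \<noteq> K" "x \<in> E"
      using E by (auto simp: facet_of_imp_face_of)
    interpret full_simplex K using assms by (rule simplex_mesh)
    have "E \<inter> rel_interior K = {}"
      using face_of_disjoint_rel_interior[OF E(1,2)] .
    then show False using x E(3) rel_interior_interior[OF affine_hull_K] by auto
  qed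
  ultimately show "x \<in> \<Omega>"
    using open_domain by (simp add: frontier_def interior_open)
qed

text \<open>The extension \<open>g\<close> is continuous on the whole space, so it has boundary
  values and is integrable over the compact element. The value zero off the open elements matches
  the representatives chosen in \<open>elementwise\<close>.\<close>

definition pw_cont :: "(real^'n \<Rightarrow> 'b::real_normed_vector) \<Rightarrow> bool"
  where "pw_cont f \<longleftrightarrow> (\<forall>x. x \<notin> (\<Union>K\<in>\<T>. interior K) \<longrightarrow> f x = 0) \<and>
    (\<forall>K\<in>\<T>. \<exists>g. continuous_on UNIV g \<and> (\<forall>x\<in>interior K. f x = g x))"

lemma pw_cont_zero: "pw_cont (\<lambda>_. 0)"
  unfolding pw_cont_def by (auto intro!: exI[of _ "\<lambda>_. 0"])

lemma pw_cont_binary: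
  fixes f g :: "real^'n \<Rightarrow> 'b::real_normed_vector" and h :: "'b \<Rightarrow> 'b \<Rightarrow> 'c::real_normed_vector"
  assumes f: "pw_cont f" and g: "pw_cont g" and h0: "h 0 0 = 0"
    and h: "\<And>f' g' :: real^'n \<Rightarrow> 'b. continuous_on UNIV f' \<Longrightarrow> continuous_on UNIV g' \<Longrightarrow>
      continuous_on UNIV (\<lambda>x. h (f' x) (g' x))"
  shows "pw_cont (\<lambda>x. h (f x) (g x))"
  unfolding pw_cont_def
proof (intro conjI ballI allI impI)
  fix x assume "x \<notin> (\<Union>K\<in>\<T>. interior K)"
  then have "f x = 0" "g x = 0" using f g unfolding pw_cont_def by blast+
  then show "h (f x) (g x) = 0" by (simp add: h0)
next
  fix K assume K: "K \<in> \<T>"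
  obtain f' where f': "continuous_on UNIV f'" "\<And>x. x \<in> interior K \<Longrightarrow> f x = f' x"
    using f K unfolding pw_cont_def by blast
  obtain g' where g': "continuous_on UNIV g'" "\<And>x. x \<in> interior K \<Longrightarrow> g x = g' x"
    using g K unfolding pw_cont_def by blast
  show "\<exists>k. continuous_on UNIV k \<and> (\<forall>x\<in>interior K. h (f x) (g x) = k x)"
    by (intro exI[of _ "\<lambda>x. h (f' x) (g' x)"] conjI h f' g') (simp add: f' g')
qed

lemma pw_cont_add: "pw_cont f \<Longrightarrow> pw_cont g \<Longrightarrow> pw_cont (\<lambda>x. f x + g x)"
  by (rule pw_cont_binary[where h = "(+)"]) (auto intro: continuous_intros)

lemma pw_cont_scaleR: "pw_cont f \<Longrightarrow> pw_cont (\<lambda>x. c *\<^sub>R f x)"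
  by (rule pw_cont_binary[where h = "\<lambda>x _. c *\<^sub>R x" and g = f]) (auto intro: continuous_intros)

lemma pw_cont_inner: "pw_cont f \<Longrightarrow> pw_cont g \<Longrightarrow> pw_cont (\<lambda>x. f x \<bullet> g x)"
  by (rule pw_cont_binary[where h = "(\<bullet>)"]) (auto intro: continuous_intros)

lemma pw_cont_nth: "pw_cont f \<Longrightarrow> pw_cont (\<lambda>x. f x $ i :: real)"
  by (rule pw_cont_binary[where h = "\<lambda>x _. x $ i" and g = f]) (auto intro: continuous_intros)

text \<open>The function is a finite sum of its restrictions to the open elements. The frontier of a
  convex set is null, so the formula can be stated with closed elements, to which the moment lemmas
  apply.\<close>

lemma pw_cont_integrable_aux:
  fixes f :: "real^'n \<Rightarrow> real"
  assumes f: "pw_cont f"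
    and g: "\<And>K. K \<in> \<T> \<Longrightarrow> continuous_on UNIV (g K)"
    and fg: "\<And>K x. K \<in> \<T> \<Longrightarrow> x \<in> interior K \<Longrightarrow> f x = g K x"
  shows "integrable (lebesgue_on \<Omega>) f" (is ?int)
    and "integral\<^sup>L (lebesgue_on \<Omega>) f = (\<Sum>K\<in>\<T>. \<integral>x. indicator K x * g K x \<partial>lborel)" (is ?eq)
proof -
  have f_sum: "f x = (\<Sum>K\<in>\<T>. indicator (interior K) x * g K x)" for x
  proof (cases "x \<in> (\<Union>K\<in>\<T>. interior K)")
    case True
    then obtain K where K: "K \<in> \<T>" "x \<in> interior K" by blast
    have "(\<Sum>K'\<in>\<T>. indicator (interior K') x * g K' x) = (\<Sum>K'\<in>\<T>. if K' = K then f x else 0)"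
    proof (rule sum.cong)
      fix K' assume K': "K' \<in> \<T>"
      show "indicator (interior K') x * g K' x = (if K' = K then f x else 0)"
      proof (cases "x \<in> interior K'")
        case True
        then have "K' = K"
          using interior_meets_imp_eq[OF K' K(1) True] K(2) interior_subset by blast
        then show ?thesis using K fg[OF K] by simp
      next
        case False
        then show ?thesis using K by auto
      qed
    qed simp
    then show ?thesis using K(1) finite_mesh by simp
  next
    case False
    then have "f x = 0" using f unfolding pw_cont_def by blast
    moreover have "(\<Sum>K\<in>\<T>. indicator (interior K) x * g K x) = 0"
      using False by (intro sum.neutral) auto
    ultimately show ?thesis by simp
  qed
  have integrable_K: "integrable lborel (\<lambda>x. indicator (interior K) x * g K x)" if K: "K \<in> \<T>" for K
  proof -
    interpret full_simplex K using K by (rule simplex_mesh)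
    have "integrable lborel (\<lambda>x. indicator (interior K) x *\<^sub>R (indicator K x * g K x))"
      by (intro integrable_mult_indicator integrable_indicator_compact[OF compact_K g[OF K]]) simp
    then show ?thesis
      by (rule Bochner_Integration.integrable_cong[THEN iffD1, rotated -1])
        (use interior_subset[of K] in \<open>auto simp: indicator_def\<close>)
  qed
  have integral_K: "(\<integral>x. indicator (interior K) x * g K x \<partial>lborel) = (\<integral>x. indicator K x * g K x \<partial>lborel)"
    if K: "K \<in> \<T>" for K
  proof (rule integral_cong_AE)
    interpret full_simplex K using K by (rule simplex_mesh)
    have [measurable]: "g K \<in> borel_measurable borel" by (rule continuous_borel[OF g[OF K]])
    have [measurable]: "K \<in> sets borel" by (rule borel_compact[OF compact_K])
    show "(\<lambda>x. indicator (interior K) x * g K x) \<in> borel_measurable lborel"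
      "(\<lambda>x. indicator K x * g K x) \<in> borel_measurable lborel"
      by measurable
    have "negligible (frontier K)" by (rule negligible_convex_frontier[OF convex_K])
    moreover have "frontier K \<in> sets borel" by simp
    ultimately have "frontier K \<in> null_sets lborel"
      by (simp add: negligible_iff_null_sets null_sets_completion_iff)
    from AE_not_in[OF this]
    show "AE x in lborel. indicator (interior K) x * g K x = indicator K x * g K x"
    proof eventually_elim
      case (elim x)
      then have "x \<in> interior K \<longleftrightarrow> x \<in> K"
        using interior_subset[of K] closure_subset[of K] by (auto simp: frontier_def)
      then show ?case by (simp add: indicator_def)
    qed
  qed
  have int_f: "integrable lborel f"
    unfolding f_sum[abs_def] by (intro Bochner_Integration.integrable_sum integrable_K)
  then have meas: "f \<in> borel_measurable lborel" by (rule borel_measurable_integrable)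
  have "f x = 0" if "x \<notin> \<Omega>" for x
  proof -
    have "x \<notin> (\<Union>K\<in>\<T>. interior K)" using that interior_subset_domain by blast
    then show ?thesis using f unfolding pw_cont_def by blast
  qed
  \<comment> \<open>The function vanishes outside \<open>\<Omega>\<close>, so its integrals over
    \<open>\<Omega>\<close> and over the whole space agree.\<close>
  then have ind: "indicator \<Omega> x * f x = f x" for x
    by (cases "x \<in> \<Omega>") simp_all
  have \<Omega>: "\<Omega> \<in> sets lebesgue" using open_domain by (simp add: borel_open)
  have "integrable lebesgue f"
    using int_f integrable_completion[OF meas] by simp
  then show ?int
    using integrable_restrict_space[of \<Omega> lebesgue f] \<Omega> by (simp add: ind)
  have "integral\<^sup>L (lebesgue_on \<Omega>) f = integral\<^sup>L lebesgue f"
    using integral_restrict_space[of \<Omega> lebesgue f] \<Omega> by (simp add: ind)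
  also have "\<dots> = integral\<^sup>L lborel f"
    by (rule integral_completion[OF meas])
  also have "\<dots> = (\<Sum>K\<in>\<T>. \<integral>x. indicator (interior K) x * g K x \<partial>lborel)"
    unfolding f_sum[abs_def] by (intro Bochner_Integration.integral_sum integrable_K)
  also have "\<dots> = (\<Sum>K\<in>\<T>. \<integral>x. indicator K x * g K x \<partial>lborel)"
    by (rule sum.cong) (simp_all only: integral_K)
  finally show ?eq .
qed

lemma pw_cont_integrable:
  fixes f :: "real^'n \<Rightarrow> real"
  assumes "pw_cont f"
  shows "integrable (lebesgue_on \<Omega>) f"
proof -
  have "\<forall>K\<in>\<T>. \<exists>g. continuous_on UNIV g \<and> (\<forall>x\<in>interior K. f x = g x)"
    using assms unfolding pw_cont_def by blast
  then obtain g where "\<And>K. K \<in> \<T> \<Longrightarrow> continuous_on UNIV (g K)"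
    "\<And>K x. K \<in> \<T> \<Longrightarrow> x \<in> interior K \<Longrightarrow> f x = g K x"
    by metis
  then show ?thesis by (rule pw_cont_integrable_aux(1)[OF assms])
qed

section \<open>The L2 inner product on piecewise continuous functions\<close>

lemma L2_ip_add_left:
  fixes f g h :: "real^'n \<Rightarrow> 'b::euclidean_space"
  assumes "pw_cont f" "pw_cont g" "pw_cont h"
  shows "L2_ip \<Omega> (\<lambda>x. f x + g x) h = L2_ip \<Omega> f h + L2_ip \<Omega> g h"
  unfolding L2_ip_def inner_add_left
  by (intro Bochner_Integration.integral_add pw_cont_integrable pw_cont_inner assms)

lemma L2_ip_commute: "L2_ip \<Omega> f g = L2_ip \<Omega> g f"
  by (simp add: L2_ip_def inner_commute)

lemma L2_ip_scaleR_left: "L2_ip \<Omega> (\<lambda>x. c *\<^sub>R f x) g = c * L2_ip \<Omega> f g"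
  by (simp add: L2_ip_def)

lemma L2_ip_nonneg: "L2_ip \<Omega> f f \<ge> 0"
  unfolding L2_ip_def by (rule Bochner_Integration.integral_nonneg) simp

lemma L2_nrm_nonneg: "L2_nrm \<Omega> f \<ge> 0"
  unfolding L2_nrm_def by (simp add: L2_ip_nonneg)

lemma L2_nrm_square: "(L2_nrm \<Omega> f)\<^sup>2 = L2_ip \<Omega> f f"
  unfolding L2_nrm_def by (simp add: L2_ip_nonneg)

lemma L2_ip_add_self:
  fixes f g :: "real^'n \<Rightarrow> 'b::euclidean_space"
  assumes "pw_cont f" "pw_cont g"
  shows "L2_ip \<Omega> (\<lambda>x. f x + g x) (\<lambda>x. f x + g x)
    = L2_ip \<Omega> f f + 2 * L2_ip \<Omega> f g + L2_ip \<Omega> g g"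
proof -
  have "L2_ip \<Omega> (\<lambda>x. f x + g x) (\<lambda>x. f x + g x)
      = L2_ip \<Omega> f (\<lambda>x. f x + g x) + L2_ip \<Omega> g (\<lambda>x. f x + g x)"
    by (intro L2_ip_add_left pw_cont_add assms)
  moreover have "L2_ip \<Omega> h (\<lambda>x. f x + g x) = L2_ip \<Omega> f h + L2_ip \<Omega> g h" if "pw_cont h" for h
    using L2_ip_add_left[OF assms that] by (simp add: L2_ip_commute)
  ultimately show ?thesis
    using assms by (simp add: L2_ip_commute[of g f])
qed

text \<open>The squared norm of t f + g is a polynomial in t without negative values; its
  discriminant gives the bound.\<close>

lemma L2_cauchy_schwarz:
  fixes f g :: "real^'n \<Rightarrow> 'b::euclidean_space"
  assumes "pw_cont f" "pw_cont g"
  shows "L2_ip \<Omega> f g \<le> L2_nrm \<Omega> f * L2_nrm \<Omega> g"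
proof -
  define a where "a = L2_ip \<Omega> f f"
  define b where "b = L2_ip \<Omega> f g"
  define c where "c = L2_ip \<Omega> g g"
  have ac: "a \<ge> 0" "c \<ge> 0" by (simp_all add: a_def c_def L2_ip_nonneg)
  have q: "a * t\<^sup>2 + 2 * b * t + c \<ge> 0" for t
  proof -
    have "L2_ip \<Omega> (\<lambda>x. t *\<^sub>R f x) (\<lambda>x. t *\<^sub>R f x) = t\<^sup>2 * a"
      unfolding L2_ip_scaleR_left a_def
      by (subst L2_ip_commute) (simp add: L2_ip_scaleR_left power2_eq_square)
    then have "0 \<le> t\<^sup>2 * a + 2 * (t * b) + c"
      using L2_ip_nonneg[of "\<lambda>x. t *\<^sub>R f x + g x"]
        L2_ip_add_self[OF pw_cont_scaleR[OF assms(1), of t] assms(2)]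
      by (simp add: L2_ip_scaleR_left b_def c_def)
    then show ?thesis by (simp add: mult_ac)
  qed
  have "b\<^sup>2 \<le> a * c"
  proof (cases "a = 0")
    case True
    have "b = 0"
    proof (rule ccontr)
      assume "b \<noteq> 0"
      \<comment> \<open>For \<open>a = 0\<close> the polynomial is affine in t; this argument is
        chosen to make its value -1.\<close>
      have "2 * b * (- (c + 1) / (2 * b)) + c \<ge> 0"
        using q[of "- (c + 1) / (2 * b)"] True by simp
      then show False using \<open>b \<noteq> 0\<close> by simp
    qed
    then show ?thesis using True by simp
  next
    case False
    \<comment> \<open>The polynomial at its minimiser t = -b/a, multiplied by
      \<open>a\<close>.\<close>
    have "0 \<le> a * (a * (- b / a)\<^sup>2 + 2 * b * (- b / a) + c)"
      using q[of "- b / a"] ac by (intro mult_nonneg_nonneg) auto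
    also have "\<dots> = a * c - b\<^sup>2"
      using False by (simp add: field_simps power2_eq_square)
    finally show ?thesis by simp
  qed
  then have "\<bar>b\<bar> \<le> sqrt (a * c)"
    by (metis real_sqrt_abs real_sqrt_le_mono)
  then show ?thesis
    by (simp add: L2_nrm_def a_def b_def c_def real_sqrt_mult)
qed

lemma L2_nrm_triangle:
  fixes f g :: "real^'n \<Rightarrow> 'b::euclidean_space"
  assumes "pw_cont f" "pw_cont g"
  shows "L2_nrm \<Omega> (\<lambda>x. f x + g x) \<le> L2_nrm \<Omega> f + L2_nrm \<Omega> g"
proof (rule power2_le_imp_le)
  show "(L2_nrm \<Omega> (\<lambda>x. f x + g x))\<^sup>2 \<le> (L2_nrm \<Omega> f + L2_nrm \<Omega> g)\<^sup>2"
    using L2_cauchy_schwarz[OF assms]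
    by (simp add: L2_nrm_square L2_ip_add_self[OF assms] power2_sum)
qed (simp add: L2_nrm_nonneg)

end

section \<open>The Crouzeix-Raviart space and the conforming interpolation\<close>

text \<open>With z = \<open>matrix_inv M *v y\<close>, the value in question is the form of
  \<open>M\<close> at z.\<close>

lemma sym_pos_def_matrix_inv:
  fixes M :: "real^'n^'n"
  assumes "sym_pos_def M" "y \<noteq> 0"
  shows "y \<bullet> (matrix_inv M *v y) > 0"
proof -
  have pos: "z \<noteq> 0 \<Longrightarrow> z \<bullet> (M *v z) > 0" for z
    using assms(1) unfolding sym_pos_def_def by blast
  have "M *v z = 0 \<Longrightarrow> z = 0" for z
    using pos[of z] by auto
  then have "invertible M"
    unfolding invertible_left_inverse matrix_left_invertible_ker by blast
  then have "M ** matrix_inv M = mat 1"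
    unfolding invertible_def matrix_inv_def by (metis (mono_tags, lifting) someI_ex)
  then have y: "M *v (matrix_inv M *v y) = y"
    by (simp add: matrix_vector_mul_assoc)
  then have "matrix_inv M *v y \<noteq> 0" using assms(2) by force
  from pos[OF this] show ?thesis by (simp add: y inner_commute)
qed

lemma has_derivative_quadratic:
  fixes B :: "real^'n^'n"
  shows "((\<lambda>x. (x - m) \<bullet> (B *v (x - m))) has_derivative
    (\<lambda>h. (B *v (x - m) + (x - m) v* B) \<bullet> h)) (at x)"
proof -
  have "((\<lambda>x. B *v (x - m)) has_derivative (\<lambda>h. B *v h)) (at x)"
    by (rule bounded_linear.has_derivative[OF matrix_vector_mul_bounded_linear])
      (auto intro!: derivative_eq_intros)
  moreover have "((\<lambda>x. x - m) has_derivative (\<lambda>h. h)) (at x)"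
    by (auto intro!: derivative_eq_intros)
  ultimately have "((\<lambda>x. (x - m) \<bullet> (B *v (x - m))) has_derivative
      (\<lambda>h. (x - m) \<bullet> (B *v h) + h \<bullet> (B *v (x - m)))) (at x)"
    by (rule has_derivative_inner[rotated])
  moreover have "(x - m) \<bullet> (B *v h) + h \<bullet> (B *v (x - m)) = (B *v (x - m) + (x - m) v* B) \<bullet> h" for h
    by (simp only: inner_add_left dot_lmul_matrix inner_commute[of h])
  ultimately show ?thesis by simp
qed

lemma subspace_funI:
  fixes S :: "('a \<Rightarrow> real) set"
  assumes "(\<lambda>_. 0) \<in> S" "\<And>u v c. u \<in> S \<Longrightarrow> v \<in> S \<Longrightarrow> (\<lambda>x. u x + c * v x) \<in> S"
  shows "subspace S"
proof (rule subspaceI)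
  show "0 \<in> S" using assms(1) by (simp add: zero_fun_def)
  show "u + v \<in> S" if "u \<in> S" "v \<in> S" for u v
    using assms(2)[OF that, of 1] by (simp add: plus_fun_def)
  show "c *\<^sub>R v \<in> S" if "v \<in> S" for c v
    using assms(2)[OF assms(1) that, of c] by (simp add: scaleR_fun_def)
qed

section \<open>Traces, broken gradients and linearity of face integrals\<close>

context mesh
begin

lemma grad_NC_eqI:
  assumes "K \<in> \<T>" "x \<in> interior K" "\<And>y. y \<in> interior K \<Longrightarrow> v y = f y"
    and "(f has_derivative (\<lambda>h. G \<bullet> h)) (at x)"
  shows "grad_NC \<T> v x = G"
proof -
  have "(v has_derivative (\<lambda>h. G \<bullet> h)) (at x)"
    by (rule has_derivative_transform_within_open[OF assms(4) open_interior assms(2)])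
      (simp add: assms(3))
  then show ?thesis
    using assms(1,2) by (auto simp: grad_NC_def intro!: grad_eqI)
qed

lemma grad_NC_outside: "x \<notin> (\<Union>K\<in>\<T>. interior K) \<Longrightarrow> grad_NC \<T> v x = 0"
  by (simp add: grad_NC_def)

lemma pw_contI:
  assumes "\<And>x. x \<notin> (\<Union>K\<in>\<T>. interior K) \<Longrightarrow> f x = 0"
    and "\<And>K. K \<in> \<T> \<Longrightarrow> continuous_on UNIV (g K)"
    and "\<And>K x. K \<in> \<T> \<Longrightarrow> x \<in> interior K \<Longrightarrow> f x = g K x"
  shows "pw_cont f"
  unfolding pw_cont_def using assms by blast

lemma elementwise_outside: "v \<in> elementwise \<T> \<Longrightarrow> x \<notin> (\<Union>K\<in>\<T>. interior K) \<Longrightarrow> v x = 0"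
  unfolding elementwise_def by blast

lemma broken_P1E:
  assumes "v \<in> broken_P1 \<T>"
  obtains a b where "\<And>K x. K \<in> \<T> \<Longrightarrow> x \<in> interior K \<Longrightarrow> v x = a K + b K \<bullet> x"
proof -
  have "\<forall>K\<in>\<T>. \<exists>a b. \<forall>x\<in>interior K. v x = a + b \<bullet> x"
    using assms by (simp add: broken_P1_def)
  then obtain a b where "\<forall>K\<in>\<T>. \<forall>x\<in>interior K. v x = a K + b K \<bullet> x"
    by metis
  then show ?thesis using that by blast
qed

lemma broken_P1_elementwise: "v \<in> broken_P1 \<T> \<Longrightarrow> v \<in> elementwise \<T>"
  by (simp add: broken_P1_def)

lemma broken_P1_pw_cont:
  assumes "v \<in> broken_P1 \<T>"
  shows "pw_cont v"
proof -
  obtain a b where "\<And>K x. K \<in> \<T> \<Longrightarrow> x \<in> interior K \<Longrightarrow> v x = a K + b K \<bullet> x"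
    using broken_P1E[OF assms] by blast
  then show ?thesis
    using elementwise_outside[OF broken_P1_elementwise[OF assms]]
    by (intro pw_contI[where g = "\<lambda>K x. a K + b K \<bullet> x"]) (auto intro!: continuous_intros)
qed

lemma grad_NC_affine:
  assumes "K \<in> \<T>" "x \<in> interior K" "\<And>y. y \<in> interior K \<Longrightarrow> v y = a + b \<bullet> y"
  shows "grad_NC \<T> v x = b"
  by (rule grad_NC_eqI[OF assms]) (auto intro!: derivative_eq_intros)

lemma trace_on_mesh:
  assumes "K \<in> \<T>" "x \<in> K" "continuous_on UNIV g" "\<And>y. y \<in> interior K \<Longrightarrow> v y = g y"
  shows "trace_on K v x = g x"
proof -
  interpret full_simplex K using assms(1) by (rule simplex_mesh)
  show ?thesis by (rule trace_on_K[OF assms(2-4)])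
qed

text \<open>Replaces the trace by a globally continuous function, the form in which face integrals
  can be handled.\<close>

lemma trace_continuous:
  assumes "pw_cont u" "K \<in> \<T>"
  obtains g where "continuous_on UNIV g" "\<And>x. x \<in> K \<Longrightarrow> trace_on K u x = g x"
    "\<And>x. x \<in> interior K \<Longrightarrow> u x = g x"
proof -
  obtain g where g: "continuous_on UNIV g" "\<And>x. x \<in> interior K \<Longrightarrow> u x = g x"
    using assms unfolding pw_cont_def by blast
  show ?thesis by (rule that[OF g(1) _ g(2)]) (use trace_on_mesh[OF assms(2) _ g] in auto)
qed

lemma trace_linear:
  assumes "pw_cont u" "pw_cont v" "K \<in> \<T>" "x \<in> K"
  shows "trace_on K (\<lambda>x. u x + c * v x) x = trace_on K u x + c * trace_on K v x"
proof -
  obtain f where f: "continuous_on UNIV f" "\<And>x. x \<in> K \<Longrightarrow> trace_on K u x = f x"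
    "\<And>x. x \<in> interior K \<Longrightarrow> u x = f x"
    using trace_continuous[OF assms(1,3)] by blast
  obtain g where g: "continuous_on UNIV g" "\<And>x. x \<in> K \<Longrightarrow> trace_on K v x = g x"
    "\<And>x. x \<in> interior K \<Longrightarrow> v x = g x"
    using trace_continuous[OF assms(2,3)] by blast
  have "trace_on K (\<lambda>x. u x + c * v x) x = f x + c * g x"
    by (rule trace_on_mesh[OF assms(3,4)]) (use f g in \<open>auto intro!: continuous_intros\<close>)
  then show ?thesis using f(2)[OF assms(4)] g(2)[OF assms(4)] by simp
qed

lemma face_integral_linear:
  assumes "K \<in> \<T>" "E facet_of K"
    and f: "continuous_on UNIV f'" "\<And>x. x \<in> E \<Longrightarrow> f x = f' x"
    and g: "continuous_on UNIV g'" "\<And>x. x \<in> E \<Longrightarrow> g x = g' x"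
  shows "face_integral E (\<lambda>x. f x + c * g x) = face_integral E f + c * face_integral E g"
proof -
  interpret full_simplex K using assms(1) by (rule simplex_mesh)
  obtain a where a: "a \<in> vertices K" "E = convex hull (vertices K - {a})"
    using assms(2) by (rule facetE)
  interpret F: affinely_independent "vertices K - {a}"
    using a(1) by (rule affinely_independent_facet)
  have cont: "continuous_on UNIV (\<lambda>x. f' (F.proj x))" "continuous_on UNIV (\<lambda>x. g' (F.proj x))"
    by (rule continuous_on_compose2[OF _ F.continuous_proj], use f g in auto)+
  have "face_integral E (\<lambda>x. f x + c * g x) = F.prism_integral (\<lambda>x. f' (F.proj x) + c * g' (F.proj x))"
    unfolding a(2)
    by (rule F.face_integral_eq[where g = "\<lambda>x. f' x + c * g' x"])
      (use f g a in \<open>auto intro!: continuous_intros\<close>)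
  also have "\<dots> = F.prism_integral (\<lambda>x. f' (F.proj x)) + c * F.prism_integral (\<lambda>x. g' (F.proj x))"
    unfolding F.prism_integral_cmult[symmetric] by (intro F.prism_integral_add continuous_intros cont)
  also have "F.prism_integral (\<lambda>x. f' (F.proj x)) = face_integral E f"
    unfolding a(2) by (rule F.face_integral_eq[symmetric]) (use f a in auto)
  also have "F.prism_integral (\<lambda>x. g' (F.proj x)) = face_integral E g"
    unfolding a(2) by (rule F.face_integral_eq[symmetric]) (use g a in auto)
  finally show ?thesis .
qed

lemma face_integral_cong:
  assumes "K \<in> \<T>" "E facet_of K" "continuous_on UNIV g"
    "\<And>x. x \<in> E \<Longrightarrow> f x = g x" "\<And>x. x \<in> E \<Longrightarrow> f' x = g x"
  shows "face_integral E f = face_integral E f'"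
proof -
  interpret full_simplex K using assms(1) by (rule simplex_mesh)
  obtain a where a: "a \<in> vertices K" "E = convex hull (vertices K - {a})"
    using assms(2) by (rule facetE)
  interpret F: affinely_independent "vertices K - {a}"
    using a(1) by (rule affinely_independent_facet)
  show ?thesis
    using F.face_integral_eq[of f g] F.face_integral_eq[of f' g] assms a by simp
qed

lemma face_integral_trace_linear:
  assumes "pw_cont u" "pw_cont v" "K \<in> \<T>" "E facet_of K"
  shows "face_integral E (trace_on K (\<lambda>x. u x + c * v x))
    = face_integral E (trace_on K u) + c * face_integral E (trace_on K v)"
proof -
  have EK: "E \<subseteq> K" using assms(4) by (rule facet_of_imp_subset)
  obtain f where f: "continuous_on UNIV f" "\<And>x. x \<in> K \<Longrightarrow> trace_on K u x = f x"
    "\<And>x. x \<in> interior K \<Longrightarrow> u x = f x"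
    using trace_continuous[OF assms(1,3)] by blast
  obtain g where g: "continuous_on UNIV g" "\<And>x. x \<in> K \<Longrightarrow> trace_on K v x = g x"
    "\<And>x. x \<in> interior K \<Longrightarrow> v x = g x"
    using trace_continuous[OF assms(2,3)] by blast
  have "face_integral E (trace_on K (\<lambda>x. u x + c * v x))
      = face_integral E (\<lambda>x. trace_on K u x + c * trace_on K v x)"
    by (rule face_integral_cong[OF assms(3,4), where g = "\<lambda>x. f x + c * g x"])
      (use EK f g trace_linear[OF assms(1-3)] in \<open>auto intro!: continuous_intros simp: subset_iff\<close>)
  also have "\<dots> = face_integral E (trace_on K u) + c * face_integral E (trace_on K v)"
    by (rule face_integral_linear[OF assms(3,4) f(1) _ g(1)]) (use EK f g in auto)
  finally show ?thesis .
qed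

lemma face_integral_jump_linear:
  assumes "pw_cont u" "pw_cont v" "K \<in> \<T>" "K' \<in> \<T>" "E facet_of K" "E facet_of K'"
  shows "face_integral E (\<lambda>x. trace_on K (\<lambda>x. u x + c * v x) x - trace_on K' (\<lambda>x. u x + c * v x) x)
    = face_integral E (\<lambda>x. trace_on K u x - trace_on K' u x)
      + c * face_integral E (\<lambda>x. trace_on K v x - trace_on K' v x)"
proof -
  have EK: "E \<subseteq> K" "E \<subseteq> K'" using assms(5,6) by (simp_all add: facet_of_imp_subset)
  obtain f where f: "continuous_on UNIV f" "\<And>x. x \<in> K \<Longrightarrow> trace_on K u x = f x"
    "\<And>x. x \<in> interior K \<Longrightarrow> u x = f x"
    using trace_continuous[OF assms(1,3)] by blast
  obtain f' where f': "continuous_on UNIV f'" "\<And>x. x \<in> K' \<Longrightarrow> trace_on K' u x = f' x"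
    "\<And>x. x \<in> interior K' \<Longrightarrow> u x = f' x"
    using trace_continuous[OF assms(1,4)] by blast
  obtain g where g: "continuous_on UNIV g" "\<And>x. x \<in> K \<Longrightarrow> trace_on K v x = g x"
    "\<And>x. x \<in> interior K \<Longrightarrow> v x = g x"
    using trace_continuous[OF assms(2,3)] by blast
  obtain g' where g': "continuous_on UNIV g'" "\<And>x. x \<in> K' \<Longrightarrow> trace_on K' v x = g' x"
    "\<And>x. x \<in> interior K' \<Longrightarrow> v x = g' x"
    using trace_continuous[OF assms(2,4)] by blast
  have "face_integral E (\<lambda>x. trace_on K (\<lambda>x. u x + c * v x) x - trace_on K' (\<lambda>x. u x + c * v x) x)
      = face_integral E (\<lambda>x. (trace_on K u x - trace_on K' u x) + c * (trace_on K v x - trace_on K' v x))"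
    by (rule face_integral_cong[OF assms(3,5), where g = "\<lambda>x. (f x - f' x) + c * (g x - g' x)"])
      (use EK f g f' g' trace_linear[OF assms(1-3)] trace_linear[OF assms(1,2,4)] in
        \<open>auto intro!: continuous_intros simp: subset_iff algebra_simps\<close>)
  also have "\<dots> = face_integral E (\<lambda>x. trace_on K u x - trace_on K' u x)
      + c * face_integral E (\<lambda>x. trace_on K v x - trace_on K' v x)"
    by (rule face_integral_linear[OF assms(3,5), where f' = "\<lambda>x. f x - f' x" and g' = "\<lambda>x. g x - g' x"])
      (use EK f g f' g' in \<open>auto intro!: continuous_intros simp: subset_iff\<close>)
  finally show ?thesis .
qed

lemma elementwise_linear:
  "u \<in> elementwise \<T> \<Longrightarrow> v \<in> elementwise \<T> \<Longrightarrow> (\<lambda>x. u x + c * v x) \<in> elementwise \<T>"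
  by (simp add: elementwise_def)

lemma broken_P1_linear:
  assumes "u \<in> broken_P1 \<T>" "v \<in> broken_P1 \<T>"
  shows "(\<lambda>x. u x + c * v x) \<in> broken_P1 \<T>"
proof -
  obtain a b where ab: "\<And>K x. K \<in> \<T> \<Longrightarrow> x \<in> interior K \<Longrightarrow> u x = a K + b K \<bullet> x"
    using broken_P1E[OF assms(1)] by blast
  obtain a' b' where ab': "\<And>K x. K \<in> \<T> \<Longrightarrow> x \<in> interior K \<Longrightarrow> v x = a' K + b' K \<bullet> x"
    using broken_P1E[OF assms(2)] by blast
  have "\<exists>a b. \<forall>x\<in>interior K. u x + c * v x = a + b \<bullet> x" if "K \<in> \<T>" for K
    by (rule exI[of _ "a K + c * a' K"], rule exI[of _ "b K + c *\<^sub>R b' K"])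
      (simp add: ab[OF that] ab'[OF that] algebra_simps)
  then show ?thesis
    using assms unfolding broken_P1_def by (auto intro: elementwise_linear)
qed

lemma zero_V_CR: "(\<lambda>_. 0) \<in> V_CR \<Omega> \<T>"
proof -
  have trace: "trace_on K (\<lambda>_. 0) x = 0" if "K \<in> \<T>" "x \<in> K" for K x
    by (rule trace_on_mesh[OF that]) auto
  \<comment> \<open>Linearity gives I(f + f) = 2 I(f), while f + f and f agree on the face, so that
    I(f + f) = I(f).\<close>
  have zero: "face_integral E f = 0" if "K \<in> \<T>" "E facet_of K" "\<And>x. x \<in> E \<Longrightarrow> f x = 0" for K E f
    using face_integral_linear[OF that(1,2), of "\<lambda>_. 0" f "\<lambda>_. 0" f 1] face_integral_cong[OF that(1,2), of "\<lambda>_. 0" f "\<lambda>x. f x + 1 * f x"] that(3)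
    by simp
  have "(\<lambda>_. 0) \<in> broken_P1 \<T>"
    unfolding broken_P1_def elementwise_def by (auto intro!: exI[of _ 0])
  moreover have "face_integral E (\<lambda>x. trace_on K (\<lambda>_. 0) x - trace_on K' (\<lambda>_. 0) x) = 0"
    if "K \<in> \<T>" "K' \<in> \<T>" "E facet_of K" "E facet_of K'" for E K K'
    by (rule zero[OF that(1,3)])
      (use that facet_of_imp_subset[OF that(3)] facet_of_imp_subset[OF that(4)] in
        \<open>simp add: trace subset_iff\<close>)
  moreover have "face_integral E (trace_on K (\<lambda>_. 0)) = 0" if "K \<in> \<T>" "E facet_of K" for E K
    by (rule zero[OF that]) (use that facet_of_imp_subset[OF that(2)] in \<open>simp add: trace subset_iff\<close>)
  ultimately show ?thesis unfolding V_CR_def by blast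
qed

lemma V_CR_broken_P1: "v \<in> V_CR \<Omega> \<T> \<Longrightarrow> v \<in> broken_P1 \<T>"
  by (simp add: V_CR_def)

lemma V_CR_linear:
  assumes "u \<in> V_CR \<Omega> \<T>" "v \<in> V_CR \<Omega> \<T>"
  shows "(\<lambda>x. u x + c * v x) \<in> V_CR \<Omega> \<T>"
proof -
  note P1 = V_CR_broken_P1[OF assms(1)] V_CR_broken_P1[OF assms(2)]
  note pw = broken_P1_pw_cont[OF P1(1)] broken_P1_pw_cont[OF P1(2)]
  have "face_integral E (\<lambda>x. trace_on K (\<lambda>x. u x + c * v x) x
      - trace_on K' (\<lambda>x. u x + c * v x) x) = 0"
    if "E \<in> interior_faces \<Omega> \<T>" "K \<in> \<T>" "K' \<in> \<T>" "K \<noteq> K'" "E facet_of K" "E facet_of K'" for E K K'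
    unfolding face_integral_jump_linear[OF pw that(2,3,5,6)]
    using assms that unfolding V_CR_def by simp
  moreover have "face_integral E (trace_on K (\<lambda>x. u x + c * v x)) = 0"
    if "E \<in> boundary_faces \<Omega> \<T>" "K \<in> \<T>" "E facet_of K" for E K
    unfolding face_integral_trace_linear[OF pw that(2,3)]
    using assms that unfolding V_CR_def by simp
  ultimately show ?thesis
    unfolding V_CR_def
    by (intro CollectI conjI ballI impI broken_P1_linear[OF P1]) simp_all
qed

text \<open>Justifies the definite description in \<open>Pi_c\<close>. Existence glues the affine
  interpolants of the nodal averages; uniqueness holds because an affine function that vanishes at
  all vertices of an element is zero.\<close>

lemma Pi_c_ex1:
  "\<exists>!w. w \<in> broken_P1 \<T> \<and>
    (\<forall>K\<in>\<T>. \<forall>z\<in>vertices K. trace_on K w z = nodal_average \<Omega> \<T> v z)"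
proof -
  have vertices_sub: "vertices K \<subseteq> K" if "K \<in> \<T>" for K
    unfolding vertices_def by (auto simp: extreme_point_of_def)
  have "\<forall>K\<in>\<T>. \<exists>c w. \<forall>p\<in>vertices K. c + w \<bullet> p = nodal_average \<Omega> \<T> v p"
  proof
    fix K assume "K \<in> \<T>"
    then interpret full_simplex K by (rule simplex_mesh)
    obtain c w where "\<And>p. p \<in> vertices K \<Longrightarrow> c + w \<bullet> p = nodal_average \<Omega> \<T> v p"
      using affine_interpolation by blast
    then show "\<exists>c w. \<forall>p\<in>vertices K. c + w \<bullet> p = nodal_average \<Omega> \<T> v p" by blast
  qed
  then obtain c w where cw: "\<And>K p. K \<in> \<T> \<Longrightarrow> p \<in> vertices K \<Longrightarrow> c K + w K \<bullet> p = nodal_average \<Omega> \<T> v p"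
    by metis
  \<comment> \<open>The inner description selects the element around \<open>x\<close>, which is
    unique because open elements are disjoint.\<close>
  define f where "f x = (if \<exists>K\<in>\<T>. x \<in> interior K
    then (let K = (THE K. K \<in> \<T> \<and> x \<in> interior K) in c K + w K \<bullet> x) else 0)" for x
  have f: "f x = c K + w K \<bullet> x" if "K \<in> \<T>" "x \<in> interior K" for K x
  proof -
    have "(THE K. K \<in> \<T> \<and> x \<in> interior K) = K"
      using that interior_meets_imp_eq interior_subset by (intro the_equality) blast+
    then show ?thesis using that by (auto simp: f_def Let_def)
  qed
  show ?thesis
  proof (rule ex1I[of _ f])
    have "f \<in> broken_P1 \<T>"
      unfolding broken_P1_def elementwise_def
    proof (intro CollectI conjI ballI allI impI)
      show "\<exists>a b. \<forall>x\<in>interior K. f x = a + b \<bullet> x" if "K \<in> \<T>" for K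
        using f[OF that] by blast
    qed (auto simp: f_def)
    moreover have "trace_on K f z = nodal_average \<Omega> \<T> v z" if K: "K \<in> \<T>" "z \<in> vertices K" for K z
    proof -
      have "trace_on K f z = c K + w K \<bullet> z"
        by (rule trace_on_mesh[OF K(1)])
          (use K vertices_sub f in \<open>auto intro!: continuous_intros\<close>)
      then show ?thesis using cw[OF K] by simp
    qed
    ultimately show "f \<in> broken_P1 \<T> \<and>
        (\<forall>K\<in>\<T>. \<forall>z\<in>vertices K. trace_on K f z = nodal_average \<Omega> \<T> v z)"
      by blast
  next
    fix g assume g: "g \<in> broken_P1 \<T> \<and>
        (\<forall>K\<in>\<T>. \<forall>z\<in>vertices K. trace_on K g z = nodal_average \<Omega> \<T> v z)"
    then obtain a b where ab: "\<And>K x. K \<in> \<T> \<Longrightarrow> x \<in> interior K \<Longrightarrow> g x = a K + b K \<bullet> x"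
      using broken_P1E by blast
    show "g = f"
    proof
      fix x
      show "g x = f x"
      proof (cases "x \<in> (\<Union>K\<in>\<T>. interior K)")
        case True
        then obtain K where K: "K \<in> \<T>" "x \<in> interior K" by blast
        interpret full_simplex K using K(1) by (rule simplex_mesh)
        have "(a K - c K) + (b K - w K) \<bullet> x = 0"
        proof (rule affine_eq_zero)
          fix p assume p: "p \<in> vertices K"
          have "trace_on K g p = a K + b K \<bullet> p"
            by (rule trace_on_mesh[OF K(1)])
              (use K p vertices_sub ab in \<open>auto intro!: continuous_intros\<close>)
          then show "(a K - c K) + (b K - w K) \<bullet> p = 0"
            using g cw[OF K(1) p] K p by (simp add: inner_diff_left)
        qed
        then show ?thesis using ab[OF K] f[OF K] by (simp add: inner_diff_left)
      next
        case False
        then have "g x = 0" using g by (blast intro: elementwise_outside broken_P1_elementwise)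
        moreover have "f x = 0" using False by (simp add: f_def)
        ultimately show ?thesis by simp
      qed
    qed
  qed
qed

lemma Pi_c_broken_P1: "Pi_c \<Omega> \<T> v \<in> broken_P1 \<T>"
  and trace_Pi_c: "K \<in> \<T> \<Longrightarrow> z \<in> vertices K \<Longrightarrow>
    trace_on K (Pi_c \<Omega> \<T> v) z = nodal_average \<Omega> \<T> v z"
  using theI'[OF Pi_c_ex1[of v]] unfolding Pi_c_def by blast+

lemma nodal_average_linear:
  assumes "pw_cont u" "pw_cont v"
  shows "nodal_average \<Omega> \<T> (\<lambda>x. u x + c * v x) z
    = nodal_average \<Omega> \<T> u z + c * nodal_average \<Omega> \<T> v z"
proof -
  have "(\<Sum>K\<in>{K\<in>\<T>. z \<in> K}. trace_on K (\<lambda>x. u x + c * v x) z)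
      = (\<Sum>K\<in>{K\<in>\<T>. z \<in> K}. trace_on K u z + c * trace_on K v z)"
    by (rule sum.cong) (auto simp: trace_linear[OF assms])
  then show ?thesis
    by (simp add: nodal_average_def sum.distrib add_divide_distrib flip: sum_distrib_left)
qed

text \<open>The combination of the two interpolants meets the conditions that single out the
  interpolant of the combination.\<close>

lemma Pi_c_linear:
  assumes "pw_cont u" "pw_cont v"
  shows "Pi_c \<Omega> \<T> (\<lambda>x. u x + c * v x) = (\<lambda>x. Pi_c \<Omega> \<T> u x + c * Pi_c \<Omega> \<T> v x)"
proof -
  have "(\<lambda>x. Pi_c \<Omega> \<T> u x + c * Pi_c \<Omega> \<T> v x) \<in> broken_P1 \<T>"
    by (intro broken_P1_linear Pi_c_broken_P1)
  moreover have "trace_on K (\<lambda>x. Pi_c \<Omega> \<T> u x + c * Pi_c \<Omega> \<T> v x) z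
      = nodal_average \<Omega> \<T> (\<lambda>x. u x + c * v x) z" if "K \<in> \<T>" "z \<in> vertices K" for K z
  proof -
    have "z \<in> K" using that(2) by (simp add: vertices_def extreme_point_of_def)
    then show ?thesis
      using that by (simp add: trace_linear broken_P1_pw_cont Pi_c_broken_P1 trace_Pi_c
          nodal_average_linear[OF assms])
  qed
  ultimately show ?thesis
    unfolding Pi_c_def[of _ _ "\<lambda>x. u x + c * v x"]
    by (intro the1_equality Pi_c_ex1) blast
qed

end

section \<open>The generalized Crouzeix-Raviart space\<close>

text \<open>Linearity of \<open>F\<close> is known on \<open>V\<close> only; an operator given by a
  definite description may behave arbitrarily elsewhere. So the values on \<open>B\<close> are
  extended to a globally linear \<open>g\<close>. The two maps agree on a subspace that contains
  \<open>B\<close>, hence on its span, and injectivity passes to \<open>g\<close>.\<close>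

lemma dim_image_span_of_trivial_kernel:
  fixes F :: "'a::real_vector \<Rightarrow> 'b::real_vector"
  assumes V: "subspace V" "B \<subseteq> V"
    and lin: "\<And>u v c. u \<in> V \<Longrightarrow> v \<in> V \<Longrightarrow> F (u + c *\<^sub>R v) = F u + c *\<^sub>R F v"
    and B: "independent B"
    and ker: "\<And>v. v \<in> span B \<Longrightarrow> F v = 0 \<Longrightarrow> v = 0"
  shows "dim (F ` span B) = card B"
proof -
  obtain g where g: "linear g" "\<And>x. x \<in> B \<Longrightarrow> g x = F x"
    using linear_independent_extend[OF B, of F] by blast
  have F0: "F 0 = 0"
    using lin[of 0 0 1] subspace_0[OF V(1)] by simp
  have "subspace {v \<in> V. F v = g v}"
  proof (rule subspaceI)
    show "0 \<in> {v \<in> V. F v = g v}"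
      using subspace_0[OF V(1)] F0 linear_0[OF g(1)] by simp
  next
    fix u v assume "u \<in> {v \<in> V. F v = g v}" "v \<in> {v \<in> V. F v = g v}"
    then show "u + v \<in> {v \<in> V. F v = g v}"
      using lin[of u v 1] subspace_add[OF V(1)] linear_add[OF g(1)] by simp
  next
    fix c v assume "v \<in> {v \<in> V. F v = g v}"
    then show "c *\<^sub>R v \<in> {v \<in> V. F v = g v}"
      using lin[of 0 v c] subspace_0[OF V(1)] F0 subspace_scale[OF V(1)] linear_scale[OF g(1)] by simp
  qed
  moreover have "B \<subseteq> {v \<in> V. F v = g v}" using g(2) V(2) by auto
  ultimately have "span B \<subseteq> {v \<in> V. F v = g v}" by (rule span_minimal[rotated])
  then have Fg: "F v = g v" if "v \<in> span B" for v using that by blast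
  have "inj_on g (span B)"
    unfolding linear_injective_on_subspace_0[OF g(1) subspace_span]
    using ker Fg by simp
  then have ind: "independent (g ` B)"
    by (rule linear_independent_injective_image[OF g(1) B])
  have "F ` span B = span (g ` B)"
    using Fg by (simp add: linear_span_image[OF g(1)] cong: image_cong)
  then have "dim (F ` span B) = card (g ` B)"
    using dim_span_eq_card_independent[OF ind] by simp
  moreover have "inj_on g B"
    using \<open>inj_on g (span B)\<close> span_superset inj_on_subset by blast
  ultimately show ?thesis by (simp add: card_image)
qed

text \<open>A Lipschitz function on a bounded piece is bounded, and there are finitely many pieces.
  On the null set outside them nothing is known about \<open>A\<close>.\<close>

lemma piecewise_lipschitz_integrable_mult:
  assumes "open \<Omega>" "bounded \<Omega>" "piecewise_lipschitz \<Omega> A" "integrable (lebesgue_on \<Omega>) f"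
  shows "integrable (lebesgue_on \<Omega>) (\<lambda>x. A x $ i $ j * f x)"
proof -
  define a where "a x = A x $ i $ j" for x
  obtain D where D': "finite D \<and> pairwise disjnt D \<and> negligible (\<Omega> - \<Union>D) \<and>
      (\<forall>S\<in>D. open S \<and> connected S \<and> S \<subseteq> \<Omega> \<and>
        (\<forall>i j. \<exists>L. L-lipschitz_on S (\<lambda>x. A x $ i $ j)))"
    using assms(3) unfolding piecewise_lipschitz_def by (rule exE)
  then have D: "finite D" "negligible (\<Omega> - \<Union>D)" "\<And>S. S \<in> D \<Longrightarrow> open S"
    "\<And>S. S \<in> D \<Longrightarrow> S \<subseteq> \<Omega>" "\<And>S. S \<in> D \<Longrightarrow> \<exists>L. L-lipschitz_on S a"
    unfolding a_def[abs_def] by simp_all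
  have "bounded (a ` \<Union>D)"
  proof -
    have "bounded (a ` S)" if S: "S \<in> D" for S
    proof -
      obtain L where "L-lipschitz_on S a" using D(5)[OF S] by blast
      then have "uniformly_continuous_on S a" by (rule lipschitz_on_uniformly_continuous)
      then show ?thesis
        using bounded_uniformly_continuous_image bounded_subset[OF assms(2) D(4)[OF S]] by blast
    qed
    then show ?thesis
      unfolding image_Union using D(1) by (intro bounded_Union) auto
  qed
  then obtain M where M: "\<And>x. x \<in> \<Union>D \<Longrightarrow> \<bar>a x\<bar> \<le> M"
    unfolding bounded_iff by auto
  have opD: "open (\<Union>D)" using D(3) by blast
  have cont: "continuous_on (\<Union>D) a"
    by (rule continuous_on_open_Union) (use D lipschitz_on_continuous_on in blast)+
  \<comment> \<open>Setting the entry to zero off the pieces makes it Borel measurable and bounded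
    everywhere. The original product is recovered by a change on a null set.\<close>
  define a' where "a' x = indicator (\<Union>D) x *\<^sub>R a x" for x
  have "a' \<in> borel_measurable borel"
    unfolding a'_def[abs_def]
    by (rule borel_measurable_continuous_on_indicator[OF borel_open[OF opD] cont])
  then have [measurable]: "a' \<in> borel_measurable (lebesgue_on \<Omega>)"
    by (intro measurable_restrict_space1 measurable_completion) simp
  have [measurable]: "f \<in> borel_measurable (lebesgue_on \<Omega>)"
    by (rule borel_measurable_integrable[OF assms(4)])
  have "integrable (lebesgue_on \<Omega>) (\<lambda>x. a' x * f x)"
  proof (rule Bochner_Integration.integrable_bound)
    show "integrable (lebesgue_on \<Omega>) (\<lambda>x. M * f x)" using assms(4) by simp
    show "AE x in lebesgue_on \<Omega>. norm (a' x * f x) \<le> norm (M * f x)"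
    proof (rule AE_I2)
      fix x
      have "\<bar>a' x\<bar> \<le> \<bar>M\<bar>"
        using M[of x] by (cases "x \<in> \<Union>D") (auto simp: a'_def)
      then show "norm (a' x * f x) \<le> norm (M * f x)"
        by (simp add: abs_mult mult_right_mono)
    qed
  qed measurable
  moreover have \<Omega>: "\<Omega> \<inter> space lebesgue \<in> sets lebesgue" using assms(1) by (simp add: borel_open)
  ultimately have "(\<lambda>x. a' x * f x) absolutely_integrable_on \<Omega>"
    unfolding set_integrable_def by (subst integrable_restrict_space[symmetric])
  then have "(\<lambda>x. a x * f x) absolutely_integrable_on \<Omega>"
    by (rule absolutely_integrable_spike[OF _ D(2)]) (simp add: a'_def)
  then show ?thesis
    unfolding set_integrable_def a_def[symmetric] by (subst integrable_restrict_space[OF \<Omega>])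
qed

section \<open>The energy form and piecewise differentiable functions\<close>

context mesh
begin

text \<open>Integrals of nonintegrable functions are 0 by convention, so additivity of the energy
  form rests on this.\<close>

lemma energy_integrable:
  assumes "bounded \<Omega>" "piecewise_lipschitz \<Omega> A" "pw_cont p" "pw_cont q"
  shows "integrable (lebesgue_on \<Omega>) (\<lambda>x. (A x *v p x) \<bullet> q x)"
proof -
  have "(A x *v p x) \<bullet> q x = (\<Sum>i\<in>UNIV. \<Sum>j\<in>UNIV. A x $ i $ j * (q x $ i \<bullet> p x $ j))" for x
    by (subst inner_commute) (simp add: inner_matrix_vector_mult)
  then show ?thesis
    by (simp only:) (intro Bochner_Integration.integrable_sum
        piecewise_lipschitz_integrable_mult[OF open_domain assms(1,2)]
        pw_cont_integrable pw_cont_inner pw_cont_nth assms(3,4))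
qed

lemma energy_ip_sum_left:
  assumes "bounded \<Omega>" "piecewise_lipschitz \<Omega> A" "\<And>i. i \<in> J \<Longrightarrow> pw_cont (p i)" "pw_cont q"
  shows "energy_ip \<Omega> A (\<lambda>x. \<Sum>i\<in>J. c i *\<^sub>R p i x) q = (\<Sum>i\<in>J. c i * energy_ip \<Omega> A (p i) q)"
proof -
  have "(A x *v (\<Sum>i\<in>J. c i *\<^sub>R p i x)) \<bullet> q x = (\<Sum>i\<in>J. c i * ((A x *v p i x) \<bullet> q x))" for x
  proof -
    have "A x *v (\<Sum>i\<in>J. c i *\<^sub>R p i x) = (\<Sum>i\<in>J. A x *v (c i *\<^sub>R p i x))"
      by (rule linear_sum) (rule matrix_vector_mul_linear)
    then show ?thesis by (simp add: inner_sum_left matrix_vector_mult_scaleR)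
  qed
  then show ?thesis
    unfolding energy_ip_def L2_ip_def
    using energy_integrable[OF assms(1,2) assms(3) assms(4)]
    by (simp only:) (subst Bochner_Integration.integral_sum, auto)
qed

lemma L2_ip_sum_left:
  fixes g :: "real^'n \<Rightarrow> real"
  assumes "\<And>i. i \<in> J \<Longrightarrow> pw_cont (f i)" "pw_cont g"
  shows "L2_ip \<Omega> (\<lambda>x. \<Sum>i\<in>J. c i * f i x) g = (\<Sum>i\<in>J. c i * L2_ip \<Omega> (f i) g)"
proof -
  have "L2_ip \<Omega> (\<lambda>x. \<Sum>i\<in>J. c i * f i x) g
      = integral\<^sup>L (lebesgue_on \<Omega>) (\<lambda>x. \<Sum>i\<in>J. c i * (f i x \<bullet> g x))"
    unfolding L2_ip_def by (simp add: sum_distrib_right mult.assoc)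
  also have "\<dots> = (\<Sum>i\<in>J. integral\<^sup>L (lebesgue_on \<Omega>) (\<lambda>x. c i * (f i x \<bullet> g x)))"
    by (intro Bochner_Integration.integral_sum Bochner_Integration.integrable_mult_right
        pw_cont_integrable pw_cont_inner assms)
  finally show ?thesis by (simp add: L2_ip_def)
qed

text \<open>The derivative has to extend continuously beyond each open element. Thus the broken
  gradient is again \<open>pw_cont\<close> and may enter L2 products.\<close>

definition pw_C1 :: "(real^'n \<Rightarrow> real) \<Rightarrow> bool"
  where "pw_C1 v \<longleftrightarrow> pw_cont v \<and> (\<forall>K\<in>\<T>. \<exists>G. continuous_on UNIV G \<and>
    (\<forall>x\<in>interior K. (v has_derivative (\<lambda>h. G x \<bullet> h)) (at x)))"

lemma pw_C1_pw_cont: "pw_C1 v \<Longrightarrow> pw_cont v"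
  by (simp add: pw_C1_def)

lemma pw_C1_has_derivative:
  assumes "pw_C1 v" "K \<in> \<T>" "x \<in> interior K"
  shows "(v has_derivative (\<lambda>h. grad_NC \<T> v x \<bullet> h)) (at x)"
proof -
  obtain G where G: "(v has_derivative (\<lambda>h. G \<bullet> h)) (at x)"
    using assms unfolding pw_C1_def by blast
  have "grad_NC \<T> v x = G" by (rule grad_NC_eqI[OF assms(2,3) refl G])
  then show ?thesis using G by simp
qed

lemma pw_C1_grad_pw_cont:
  assumes "pw_C1 v"
  shows "pw_cont (grad_NC \<T> v)"
proof -
  have "\<exists>G. continuous_on UNIV G \<and> (\<forall>x\<in>interior K. grad_NC \<T> v x = G x)" if K: "K \<in> \<T>" for K
  proof -
    obtain G where G: "continuous_on UNIV G"
      "\<And>x. x \<in> interior K \<Longrightarrow> (v has_derivative (\<lambda>h. G x \<bullet> h)) (at x)"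
      using assms K unfolding pw_C1_def by blast
    then show ?thesis using grad_NC_eqI[OF K _ refl] by blast
  qed
  then show ?thesis
    unfolding pw_cont_def using grad_NC_outside by blast
qed

lemma pw_C1_linear:
  assumes "pw_C1 u" "pw_C1 v"
  shows "pw_C1 (\<lambda>x. u x + c * v x)"
    and "grad_NC \<T> (\<lambda>x. u x + c * v x) = (\<lambda>x. grad_NC \<T> u x + c *\<^sub>R grad_NC \<T> v x)"
proof -
  have der: "((\<lambda>x. u x + c * v x) has_derivative (\<lambda>h. (G + c *\<^sub>R H) \<bullet> h)) (at x)"
    if "(u has_derivative (\<lambda>h. G \<bullet> h)) (at x)" "(v has_derivative (\<lambda>h. H \<bullet> h)) (at x)" for G H x
    using has_derivative_add[OF that(1) has_derivative_mult_right[OF that(2), of c]]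
    by (simp add: inner_add_left)
  show "grad_NC \<T> (\<lambda>x. u x + c * v x) = (\<lambda>x. grad_NC \<T> u x + c *\<^sub>R grad_NC \<T> v x)"
  proof
    fix x
    show "grad_NC \<T> (\<lambda>x. u x + c * v x) x = grad_NC \<T> u x + c *\<^sub>R grad_NC \<T> v x"
    proof (cases "x \<in> (\<Union>K\<in>\<T>. interior K)")
      case True
      then obtain K where K: "K \<in> \<T>" "x \<in> interior K" by blast
      show ?thesis
        by (rule grad_NC_eqI[OF K refl]) (intro der pw_C1_has_derivative[OF _ K] assms)
    qed (simp add: grad_NC_outside)
  qed
  have "pw_cont (\<lambda>x. u x + c *\<^sub>R v x)"
    using assms by (intro pw_cont_add pw_cont_scaleR pw_C1_pw_cont)
  moreover have "\<exists>G. continuous_on UNIV G \<and>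
      (\<forall>x\<in>interior K. ((\<lambda>x. u x + c * v x) has_derivative (\<lambda>h. G x \<bullet> h)) (at x))"
    if K: "K \<in> \<T>" for K
  proof -
    obtain G where G: "continuous_on UNIV G"
      "\<forall>x\<in>interior K. (u has_derivative (\<lambda>h. G x \<bullet> h)) (at x)"
      using assms(1) K unfolding pw_C1_def by blast
    obtain H where H: "continuous_on UNIV H"
      "\<forall>x\<in>interior K. (v has_derivative (\<lambda>h. H x \<bullet> h)) (at x)"
      using assms(2) K unfolding pw_C1_def by blast
    show ?thesis
      by (rule exI[of _ "\<lambda>x. G x + c *\<^sub>R H x"])
        (use G H in \<open>auto intro!: continuous_intros der\<close>)
  qed
  ultimately show "pw_C1 (\<lambda>x. u x + c * v x)" by (simp add: pw_C1_def)
qed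

lemma pw_C1_zero: "pw_C1 (\<lambda>_. 0)" and grad_NC_zero: "grad_NC \<T> (\<lambda>_. 0) = (\<lambda>_. 0)"
proof -
  have der: "((\<lambda>_. 0 :: real) has_derivative (\<lambda>h. 0 \<bullet> h)) (at x)" for x :: "real^'n"
    by simp
  show "pw_C1 (\<lambda>_. 0)"
    unfolding pw_C1_def
    by (intro conjI pw_cont_zero ballI exI[of _ "\<lambda>_. 0"] continuous_on_const der)
  \<comment> \<open>Linearity with factor -1, applied to the zero function written as a
    difference.\<close>
  then show "grad_NC \<T> (\<lambda>_. 0) = (\<lambda>_. 0)"
    using pw_C1_linear(2)[of "\<lambda>_. 0" "\<lambda>_. 0" "-1"] by simp
qed

lemma pw_C1_sum:
  assumes "finite J" "\<And>i. i \<in> J \<Longrightarrow> pw_C1 (u i)"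
  shows "pw_C1 (\<lambda>x. \<Sum>i\<in>J. c i * u i x) \<and>
    grad_NC \<T> (\<lambda>x. \<Sum>i\<in>J. c i * u i x) = (\<lambda>x. \<Sum>i\<in>J. c i *\<^sub>R grad_NC \<T> (u i) x)"
  using assms
proof (induction J rule: finite_induct)
  case empty
  then show ?case by (simp add: pw_C1_zero grad_NC_zero)
next
  case (insert i J)
  have IH: "pw_C1 (\<lambda>x. \<Sum>i\<in>J. c i * u i x)"
    "grad_NC \<T> (\<lambda>x. \<Sum>i\<in>J. c i * u i x) = (\<lambda>x. \<Sum>i\<in>J. c i *\<^sub>R grad_NC \<T> (u i) x)"
    and ui: "pw_C1 (u i)"
    using insert.IH insert.prems by simp_all
  show ?case
    using pw_C1_linear[OF IH(1) ui, of "c i"] insert.hyps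
    by (simp add: IH(2) add.commute)
qed

lemma broken_P1_pw_C1:
  assumes "v \<in> broken_P1 \<T>"
  shows "pw_C1 v"
  unfolding pw_C1_def
proof (intro conjI ballI broken_P1_pw_cont[OF assms])
  fix K assume K: "K \<in> \<T>"
  obtain a b where ab: "\<And>K x. K \<in> \<T> \<Longrightarrow> x \<in> interior K \<Longrightarrow> v x = a K + b K \<bullet> x"
    using broken_P1E[OF assms] by blast
  have "(v has_derivative (\<lambda>h. b K \<bullet> h)) (at x)" if "x \<in> interior K" for x
    by (rule has_derivative_transform_within_open[OF _ open_interior that,
          where f = "\<lambda>x. a K + b K \<bullet> x"])
      (auto intro!: derivative_eq_intros simp: ab[OF K])
  then show "\<exists>G. continuous_on UNIV G \<and> (\<forall>x\<in>interior K. (v has_derivative (\<lambda>h. G x \<bullet> h)) (at x))"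
    by (intro exI[of _ "\<lambda>_. b K"]) auto
qed

end

section \<open>Bubbles on the mesh and their gradients\<close>

locale gcr_mesh = mesh \<Omega> \<T> for \<Omega> :: "(real^'n) set" and \<T> +
  fixes Abar :: "(real^'n) set \<Rightarrow> real^'n^'n"
  assumes Abar: "K \<in> \<T> \<Longrightarrow> sym_pos_def (Abar K)"
begin

abbreviation Bbar :: "(real^'n) set \<Rightarrow> real^'n^'n"
  where "Bbar K \<equiv> matrix_inv (Abar K)"

lemma V_BE:
  assumes "b \<in> V_B \<T> Abar"
  obtains c where "\<And>K x. K \<in> \<T> \<Longrightarrow> x \<in> interior K \<Longrightarrow> b x = c K * bubble (Bbar K) K x"
proof -
  have "\<forall>K\<in>\<T>. \<exists>c. \<forall>x\<in>interior K. b x = c * bubble (Bbar K) K x"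
    using assms by (simp add: V_B_def)
  then show ?thesis using that by metis
qed

lemma V_B_elementwise: "b \<in> V_B \<T> Abar \<Longrightarrow> b \<in> elementwise \<T>"
  by (simp add: V_B_def)

lemma V_B_linear:
  assumes "u \<in> V_B \<T> Abar" "v \<in> V_B \<T> Abar"
  shows "(\<lambda>x. u x + c * v x) \<in> V_B \<T> Abar"
proof -
  obtain a where a: "\<And>K x. K \<in> \<T> \<Longrightarrow> x \<in> interior K \<Longrightarrow> u x = a K * bubble (Bbar K) K x"
    using V_BE[OF assms(1)] by blast
  obtain b where b: "\<And>K x. K \<in> \<T> \<Longrightarrow> x \<in> interior K \<Longrightarrow> v x = b K * bubble (Bbar K) K x"
    using V_BE[OF assms(2)] by blast
  have "\<exists>d. \<forall>x\<in>interior K. u x + c * v x = d * bubble (Bbar K) K x" if "K \<in> \<T>" for K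
    by (rule exI[of _ "a K + c * b K"]) (simp add: a[OF that] b[OF that] algebra_simps)
  moreover have "(\<lambda>x. u x + c * v x) \<in> elementwise \<T>"
    by (intro elementwise_linear V_B_elementwise assms)
  ultimately show ?thesis unfolding V_B_def by simp
qed

lemma zero_V_B: "(\<lambda>_. 0) \<in> V_B \<T> Abar"
  unfolding V_B_def elementwise_def by (auto intro!: exI[of _ 0])

text \<open>The two products are the matrix of the form and its transpose, both applied to
  \<open>x - mid K\<close>.\<close>

definition bubble_grad :: "(real^'n) set \<Rightarrow> real^'n \<Rightarrow> real^'n"
  where "bubble_grad K x = (let n = real CARD('n) in
    (- (n * (n + 1)\<^sup>2 * (n + 2) / (2 * bubble_H (Bbar K) K))) *\<^sub>R
      (Bbar K *v (x - mid K) + (x - mid K) v* Bbar K))"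

lemma has_derivative_bubble:
  "(bubble (Bbar K) K has_derivative (\<lambda>h. bubble_grad K x \<bullet> h)) (at x)"
proof -
  define k where "k = (let n = real CARD('n) in n * (n + 1)\<^sup>2 * (n + 2) / (2 * bubble_H (Bbar K) K))"
  have "((\<lambda>x. (real CARD('n) + 2) / 2 - k * ((x - mid K) \<bullet> (Bbar K *v (x - mid K)))) has_derivative
      (\<lambda>h. 0 - k * ((Bbar K *v (x - mid K) + (x - mid K) v* Bbar K) \<bullet> h))) (at x)"
    by (intro has_derivative_diff has_derivative_const has_derivative_mult_right
        has_derivative_quadratic)
  then show ?thesis
    by (simp add: bubble_def[abs_def] bubble_grad_def k_def Let_def)
qed

lemma continuous_bubble_grad: "continuous_on UNIV (bubble_grad K)"
proof -
  have "continuous_on UNIV (\<lambda>x. Bbar K *v (x - mid K))"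
    by (rule linear_continuous_on_compose[OF _ matrix_vector_mul_linear]) (intro continuous_intros)
  moreover have "continuous_on UNIV (\<lambda>x. transpose (Bbar K) *v (x - mid K))"
    by (rule linear_continuous_on_compose[OF _ matrix_vector_mul_linear]) (intro continuous_intros)
  ultimately show ?thesis
    unfolding bubble_grad_def[abs_def] Let_def
    by (intro continuous_intros) (simp_all add: transpose_matrix_vector)
qed

lemma has_derivative_V_B:
  assumes "K \<in> \<T>" "x \<in> interior K" "\<And>y. y \<in> interior K \<Longrightarrow> b y = c * bubble (Bbar K) K y"
  shows "(b has_derivative (\<lambda>h. (c *\<^sub>R bubble_grad K x) \<bullet> h)) (at x)"
proof (rule has_derivative_transform_within_open[OF _ open_interior assms(2)])
  show "((\<lambda>x. c * bubble (Bbar K) K x) has_derivative (\<lambda>h. (c *\<^sub>R bubble_grad K x) \<bullet> h)) (at x)"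
    using has_derivative_mult_right[OF has_derivative_bubble] by simp
qed (simp add: assms(3))

lemma V_B_pw_C1:
  assumes "b \<in> V_B \<T> Abar"
  shows "pw_C1 b"
proof -
  obtain c where c: "\<And>K x. K \<in> \<T> \<Longrightarrow> x \<in> interior K \<Longrightarrow> b x = c K * bubble (Bbar K) K x"
    using V_BE[OF assms] by blast
  have "pw_cont b"
  proof (rule pw_contI[where g = "\<lambda>K x. c K * bubble (Bbar K) K x"])
    fix K assume "K \<in> \<T>"
    then interpret full_simplex K by (rule simplex_mesh)
    show "continuous_on UNIV (\<lambda>x. c K * bubble (Bbar K) K x)"
      by (intro continuous_intros continuous_bubble)
  qed (use c elementwise_outside[OF V_B_elementwise[OF assms]] in auto)
  moreover have "\<exists>G. continuous_on UNIV G \<and> (\<forall>x\<in>interior K. (b has_derivative (\<lambda>h. G x \<bullet> h)) (at x))"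
    if "K \<in> \<T>" for K
    by (rule exI[of _ "\<lambda>x. c K *\<^sub>R bubble_grad K x"])
      (intro conjI ballI continuous_intros continuous_bubble_grad has_derivative_V_B[OF that _ c[OF that]])
  ultimately show ?thesis by (simp add: pw_C1_def)
qed

lemma V_GCR_E:
  assumes "v \<in> V_GCR \<Omega> \<T> Abar"
  obtains w b where "w \<in> V_CR \<Omega> \<T>" "b \<in> V_B \<T> Abar" "v = w + b"
  using assms unfolding V_GCR_def by blast

lemma V_GCR_linear:
  assumes "u \<in> V_GCR \<Omega> \<T> Abar" "v \<in> V_GCR \<Omega> \<T> Abar"
  shows "(\<lambda>x. u x + c * v x) \<in> V_GCR \<Omega> \<T> Abar"
proof -
  obtain w b where 1: "w \<in> V_CR \<Omega> \<T>" "b \<in> V_B \<T> Abar" "u = w + b"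
    using assms(1) by (rule V_GCR_E)
  obtain w' b' where 2: "w' \<in> V_CR \<Omega> \<T>" "b' \<in> V_B \<T> Abar" "v = w' + b'"
    using assms(2) by (rule V_GCR_E)
  have "(\<lambda>x. u x + c * v x) = (\<lambda>x. w x + c * w' x) + (\<lambda>x. b x + c * b' x)"
    by (simp add: 1 2 plus_fun_def algebra_simps)
  then show ?thesis
    unfolding V_GCR_def using V_CR_linear[OF 1(1) 2(1)] V_B_linear[OF 1(2) 2(2)] by blast
qed

lemma subspace_V_GCR: "subspace (V_GCR \<Omega> \<T> Abar)"
proof (rule subspace_funI)
  have "(\<lambda>_. 0) = (\<lambda>_. 0) + (\<lambda>_::real^'n. 0::real)" by (simp add: plus_fun_def)
  then show "(\<lambda>_. 0) \<in> V_GCR \<Omega> \<T> Abar"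
    unfolding V_GCR_def using zero_V_CR zero_V_B by blast
qed (rule V_GCR_linear)

lemma V_GCR_pw_C1:
  assumes "v \<in> V_GCR \<Omega> \<T> Abar"
  shows "pw_C1 v"
proof -
  obtain w b where wb: "w \<in> V_CR \<Omega> \<T>" "b \<in> V_B \<T> Abar" "v = w + b"
    using assms by (rule V_GCR_E)
  have "pw_C1 (\<lambda>x. w x + 1 * b x)"
    using wb by (intro pw_C1_linear(1) broken_P1_pw_C1 V_CR_broken_P1 V_B_pw_C1)
  then show ?thesis by (simp add: wb(3) plus_fun_def)
qed

lemma face_integral_V_B:
  assumes "b \<in> V_B \<T> Abar" "K \<in> \<T>" "E facet_of K"
  shows "face_integral E (trace_on K b) = 0"
proof -
  interpret full_simplex K using assms(2) by (rule simplex_mesh)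
  obtain c where c: "\<And>K x. K \<in> \<T> \<Longrightarrow> x \<in> interior K \<Longrightarrow> b x = c K * bubble (Bbar K) K x"
    using V_BE[OF assms(1)] by blast
  have cont: "continuous_on UNIV (\<lambda>x. c K * bubble (Bbar K) K x)"
    by (intro continuous_intros continuous_bubble)
  have "trace_on K b x = c K * bubble (Bbar K) K x" if "x \<in> E" for x
    by (rule trace_on_mesh[OF assms(2) _ cont])
      (use that c[OF assms(2)] facet_of_imp_subset[OF assms(3)] in auto)
  then have "face_integral E (trace_on K b) = face_integral E (\<lambda>x. c K * bubble (Bbar K) K x)"
    by (intro face_integral_cong[OF assms(2,3) cont]) simp_all
  also have "\<dots> = 0"
    by (rule face_integral_bubble[OF _ assms(3)])
      (rule sym_pos_def_matrix_inv[OF Abar[OF assms(2)]])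
  finally show ?thesis .
qed

text \<open>The face integrals of \<open>b\<close> vanish, so \<open>w\<close> meets the conditions
  of the definite description. Any other candidate differs from \<open>w\<close> by a function that
  is affine with zero face integrals on each element, and unisolvence applies. Linearity of the
  interpolation then follows from any choice of decompositions.\<close>

lemma Pi_CR_eq:
  assumes w: "w \<in> V_CR \<Omega> \<T>" and b: "b \<in> V_B \<T> Abar"
  shows "Pi_CR \<Omega> \<T> (w + b) = w"
  unfolding Pi_CR_def
proof (rule the_equality)
  have pw: "pw_cont w" "pw_cont b"
    using w b by (simp_all add: pw_C1_pw_cont V_B_pw_C1 broken_P1_pw_cont V_CR_broken_P1)
  have eq: "face_integral E (trace_on K (w + b)) = face_integral E (trace_on K w)"
    if "K \<in> \<T>" "E facet_of K" for K E
    using face_integral_trace_linear[OF pw that, of 1] face_integral_V_B[OF b that]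
    by (simp add: plus_fun_def)
  show "w \<in> V_CR \<Omega> \<T> \<and> (\<forall>E\<in>faces \<T>. \<forall>K\<in>\<T>. E facet_of K \<longrightarrow>
      face_integral E (trace_on K w) = face_integral E (trace_on K (w + b)))"
    using w eq by simp
  fix w' assume w': "w' \<in> V_CR \<Omega> \<T> \<and> (\<forall>E\<in>faces \<T>. \<forall>K\<in>\<T>. E facet_of K \<longrightarrow>
      face_integral E (trace_on K w') = face_integral E (trace_on K (w + b)))"
  define d where "d x = w' x + (-1) * w x" for x
  have d: "d \<in> V_CR \<Omega> \<T>" unfolding d_def[abs_def] using w w' by (intro V_CR_linear) auto
  then have P1: "d \<in> broken_P1 \<T>" by (rule V_CR_broken_P1)
  obtain c v where cv: "\<And>K x. K \<in> \<T> \<Longrightarrow> x \<in> interior K \<Longrightarrow> d x = c K + v K \<bullet> x"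
    using broken_P1E[OF P1] by blast
  have pw': "pw_cont w'" using w' broken_P1_pw_cont V_CR_broken_P1 by blast
  have "d x = 0" for x
  proof (cases "x \<in> (\<Union>K\<in>\<T>. interior K)")
    case True
    then obtain K where K: "K \<in> \<T>" "x \<in> interior K" by blast
    interpret full_simplex K using K(1) by (rule simplex_mesh)
    have cont: "continuous_on UNIV (\<lambda>x. c K + v K \<bullet> x)" by (intro continuous_intros)
    have "c K + v K \<bullet> x = 0"
    proof (rule affine_face_integrals_zero)
      fix E assume E: "E facet_of K"
      have "trace_on K d x = c K + v K \<bullet> x" if "x \<in> E" for x
        by (rule trace_on_mesh[OF K(1) _ cont])
          (use that cv[OF K(1)] facet_of_imp_subset[OF E] in auto)
      then have "face_integral E (\<lambda>x. c K + v K \<bullet> x) = face_integral E (trace_on K d)"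
        by (intro face_integral_cong[OF K(1) E cont]) simp_all
      also have "\<dots> = face_integral E (trace_on K w') - face_integral E (trace_on K w)"
        unfolding d_def[abs_def] using face_integral_trace_linear[OF pw' pw(1) K(1) E, of "-1"] by simp
      also have "\<dots> = 0"
        using w' K(1) E eq[OF K(1) E] by (auto simp: faces_def)
      finally show "face_integral E (\<lambda>x. c K + v K \<bullet> x) = 0" .
    qed
    then show ?thesis using cv[OF K] by simp
  next
    case False
    then show ?thesis using elementwise_outside[OF broken_P1_elementwise[OF P1]] by blast
  qed
  then show "w' = w" by (simp add: d_def fun_eq_iff)
qed

lemma Pi_CR_V_CR:
  assumes "v \<in> V_GCR \<Omega> \<T> Abar"
  shows "Pi_CR \<Omega> \<T> v \<in> V_CR \<Omega> \<T>" "v - Pi_CR \<Omega> \<T> v \<in> V_B \<T> Abar"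
proof -
  obtain w b where wb: "w \<in> V_CR \<Omega> \<T>" "b \<in> V_B \<T> Abar" "v = w + b"
    using assms by (rule V_GCR_E)
  then show "Pi_CR \<Omega> \<T> v \<in> V_CR \<Omega> \<T>" "v - Pi_CR \<Omega> \<T> v \<in> V_B \<T> Abar"
    using Pi_CR_eq[OF wb(1,2)] by simp_all
qed

lemma Pi_CR_linear:
  assumes "u \<in> V_GCR \<Omega> \<T> Abar" "v \<in> V_GCR \<Omega> \<T> Abar"
  shows "Pi_CR \<Omega> \<T> (\<lambda>x. u x + c * v x) = (\<lambda>x. Pi_CR \<Omega> \<T> u x + c * Pi_CR \<Omega> \<T> v x)"
proof -
  obtain w b where 1: "w \<in> V_CR \<Omega> \<T>" "b \<in> V_B \<T> Abar" "u = w + b"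
    using assms(1) by (rule V_GCR_E)
  obtain w' b' where 2: "w' \<in> V_CR \<Omega> \<T>" "b' \<in> V_B \<T> Abar" "v = w' + b'"
    using assms(2) by (rule V_GCR_E)
  have "(\<lambda>x. u x + c * v x) = (\<lambda>x. w x + c * w' x) + (\<lambda>x. b x + c * b' x)"
    by (simp add: 1 2 plus_fun_def algebra_simps)
  then show ?thesis
    using Pi_CR_eq[OF V_CR_linear[OF 1(1) 2(1)] V_B_linear[OF 1(2) 2(2)]]
      Pi_CR_eq[OF 1(1,2)] Pi_CR_eq[OF 2(1,2)] 1(3) 2(3) by simp
qed

text \<open>On each element the gradient of a bubble is linear in \<open>x - mid K\<close>, and \<open>mid K\<close> is the
  barycentre.\<close>

lemma grad_orthogonal:
  assumes w: "w \<in> broken_P1 \<T>" and b: "b \<in> V_B \<T> Abar"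
  shows "L2_ip \<Omega> (grad_NC \<T> w) (grad_NC \<T> b) = 0"
proof -
  obtain a v where av: "\<And>K x. K \<in> \<T> \<Longrightarrow> x \<in> interior K \<Longrightarrow> w x = a K + v K \<bullet> x"
    using broken_P1E[OF w] by blast
  obtain c where c: "\<And>K x. K \<in> \<T> \<Longrightarrow> x \<in> interior K \<Longrightarrow> b x = c K * bubble (Bbar K) K x"
    using V_BE[OF b] by blast
  define k where "k K = (let n = real CARD('n) in n * (n + 1)\<^sup>2 * (n + 2) / (2 * bubble_H (Bbar K) K))" for K
  define q where "q K = (- c K * k K) *\<^sub>R (v K v* Bbar K + Bbar K *v v K)" for K
  have grads: "grad_NC \<T> w x \<bullet> grad_NC \<T> b x = q K \<bullet> x + - (q K \<bullet> mid K)"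
    if K: "K \<in> \<T>" "x \<in> interior K" for K x
  proof -
    have "grad_NC \<T> w x = v K"
      by (rule grad_NC_affine[OF K av[OF K(1)]])
    moreover have "grad_NC \<T> b x = c K *\<^sub>R bubble_grad K x"
      by (rule grad_NC_eqI[OF K refl has_derivative_V_B[OF K c[OF K(1)]]])
    moreover have "bubble_grad K x = (- k K) *\<^sub>R (Bbar K *v (x - mid K) + (x - mid K) v* Bbar K)"
      by (simp add: bubble_grad_def k_def Let_def)
    ultimately have "grad_NC \<T> w x \<bullet> grad_NC \<T> b x
        = (- c K * k K) * (v K \<bullet> (Bbar K *v (x - mid K) + (x - mid K) v* Bbar K))"
      by simp
    \<comment> \<open>Both matrix products are moved onto the constant vector \<open>v K\<close>,
      which leaves an affine function of \<open>x\<close> that vanishes at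
      \<open>mid K\<close>.\<close>
    also have "v K \<bullet> (Bbar K *v (x - mid K) + (x - mid K) v* Bbar K)
        = (v K v* Bbar K + Bbar K *v v K) \<bullet> (x - mid K)"
      by (simp only: inner_add_left inner_add_right dot_lmul_matrix
          inner_commute[of "v K" "(x - mid K) v* Bbar K"] inner_commute[of "Bbar K *v v K"])
    also have "(- c K * k K) * \<dots> = q K \<bullet> (x - mid K)"
      by (simp add: q_def)
    finally show ?thesis by (simp add: inner_diff_right)
  qed
  have pw: "pw_cont (\<lambda>x. grad_NC \<T> w x \<bullet> grad_NC \<T> b x)"
    using w b by (intro pw_cont_inner pw_C1_grad_pw_cont broken_P1_pw_C1 V_B_pw_C1)
  have "L2_ip \<Omega> (grad_NC \<T> w) (grad_NC \<T> b)
      = (\<Sum>K\<in>\<T>. \<integral>x. indicator K x * (q K \<bullet> x + - (q K \<bullet> mid K)) \<partial>lborel)"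
    unfolding L2_ip_def
    by (rule pw_cont_integrable_aux(2)[OF pw]) (auto intro!: continuous_intros simp: grads)
  also have "\<dots> = 0"
  proof (rule sum.neutral, rule ballI)
    fix K assume "K \<in> \<T>"
    then interpret full_simplex K by (rule simplex_mesh)
    \<comment> \<open>By \<open>prism_integral_affine\<close> the integral over the element is a
      multiple of this sum of vertex values.\<close>
    have "(\<Sum>p\<in>vertices K. q K \<bullet> p + - (q K \<bullet> mid K)) = q K \<bullet> (\<Sum>p\<in>vertices K. p - mid K)"
      by (simp add: inner_sum_right inner_diff_right)
    also have "\<dots> = 0" by (simp add: sum_vertices_mid)
    finally show "(\<integral>x. indicator K x * (q K \<bullet> x + - (q K \<bullet> mid K)) \<partial>lborel) = 0"
      using prism_integral_affine[of "q K" "- (q K \<bullet> mid K)"] by (simp add: prism_integral_def prism_id)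
  qed
  finally show ?thesis .
qed

end

section \<open>Injectivity of the interpolation on the discrete eigenspace\<close>

lemma sum_scaleR_fun_apply:
  fixes u :: "'i \<Rightarrow> 'a \<Rightarrow> real"
  shows "(\<Sum>i\<in>J. c i *\<^sub>R u i) = (\<lambda>x. \<Sum>i\<in>J. c i * u i x)"
  by (induction J rule: infinite_finite_induct)
    (simp_all add: zero_fun_def plus_fun_def scaleR_fun_def)

text \<open>The bound with \<open>C\<^sub>A\<close> concerns sums of an H^1_0 function and a
  discrete function; with zero as the first summand it can be applied to the discrete one
  alone.\<close>

lemma H10_with_grad_zero:
  fixes \<Omega> :: "(real^'n) set"
  shows "H10_with_grad \<Omega> (\<lambda>_. 0) (\<lambda>_. 0)"
proof -
  have grad0: "grad (\<lambda>_. 0) = (\<lambda>_. 0 :: real^'n)"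
    by (rule ext) (rule grad_eqI, simp)
  have "k_times_cont_diff k (\<lambda>_::real^'n. 0)" for k
    by (induction k) (simp_all add: grad0)
  then have "test_function \<Omega> (\<lambda>_. 0)"
    by (simp add: test_function_def)
  then show ?thesis
    unfolding H10_with_grad_def in_L2_def
    by (auto intro!: exI[of _ "\<lambda>_ _. 0"] simp: grad0 L2_nrm_def L2_ip_def)
qed

context gcr_mesh
begin

lemma Pi_c_Pi_CR_linear:
  assumes "u \<in> V_GCR \<Omega> \<T> Abar" "v \<in> V_GCR \<Omega> \<T> Abar"
  shows "Pi_c \<Omega> \<T> (Pi_CR \<Omega> \<T> (u + c *\<^sub>R v))
    = Pi_c \<Omega> \<T> (Pi_CR \<Omega> \<T> u) + c *\<^sub>R Pi_c \<Omega> \<T> (Pi_CR \<Omega> \<T> v)"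
proof -
  have "pw_cont (Pi_CR \<Omega> \<T> u)" "pw_cont (Pi_CR \<Omega> \<T> v)"
    using assms by (simp_all add: Pi_CR_V_CR V_CR_broken_P1 broken_P1_pw_cont)
  then show ?thesis
    by (simp add: plus_fun_def scaleR_fun_def Pi_CR_linear[OF assms] Pi_c_linear)
qed

text \<open>On the kernel \<open>Pi_CR \<Omega> \<T> v\<close> is its own conforming interpolation
  error, so both parts of \<open>v\<close> are interpolation errors. Pythagoras bounds either
  gradient by that of \<open>v\<close> with constant 1. In the application \<open>a\<^sub>1\<close>
  and \<open>a\<^sub>2\<close> are \<open>\<beta>\<^sub>1\<close> and \<open>\<beta>\<^sub>2\<close>
  times the mesh size.\<close>

lemma interpolation_estimate:
  assumes v: "v \<in> V_GCR \<Omega> \<T> Abar" and ker: "Pi_c \<Omega> \<T> (Pi_CR \<Omega> \<T> v) = 0"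
    and nonneg: "0 \<le> a\<^sub>1" "0 \<le> a\<^sub>2"
    and a\<^sub>1: "L2_nrm \<Omega> (v - Pi_CR \<Omega> \<T> v) \<le> a\<^sub>1 * L2_nrm \<Omega> (grad_NC \<T> (v - Pi_CR \<Omega> \<T> v))"
    and a\<^sub>2: "L2_nrm \<Omega> (Pi_CR \<Omega> \<T> v - Pi_c \<Omega> \<T> (Pi_CR \<Omega> \<T> v))
      \<le> a\<^sub>2 * L2_nrm \<Omega> (grad_NC \<T> (Pi_CR \<Omega> \<T> v))"
  shows "L2_nrm \<Omega> v \<le> (a\<^sub>1 + a\<^sub>2) * L2_nrm \<Omega> (grad_NC \<T> v)"
proof -
  define w where "w = Pi_CR \<Omega> \<T> v"
  define b where "b = v - w"
  have w: "w \<in> broken_P1 \<T>" and b: "b \<in> V_B \<T> Abar"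
    using Pi_CR_V_CR[OF v] by (simp_all add: w_def b_def V_CR_broken_P1)
  have C1: "pw_C1 w" "pw_C1 b" using w b by (simp_all add: broken_P1_pw_C1 V_B_pw_C1)
  have v_eq: "v = (\<lambda>x. w x + 1 * b x)" by (simp add: b_def fun_eq_iff)
  have grad_v: "grad_NC \<T> v = (\<lambda>x. grad_NC \<T> w x + grad_NC \<T> b x)"
    unfolding v_eq using pw_C1_linear(2)[OF C1, of 1] by simp
  have pyth: "(L2_nrm \<Omega> (grad_NC \<T> v))\<^sup>2 = (L2_nrm \<Omega> (grad_NC \<T> w))\<^sup>2 + (L2_nrm \<Omega> (grad_NC \<T> b))\<^sup>2"
    unfolding L2_nrm_square grad_v
    using L2_ip_add_self[OF C1[THEN pw_C1_grad_pw_cont]] grad_orthogonal[OF w b] by simp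
  have "L2_nrm \<Omega> (grad_NC \<T> w) \<le> L2_nrm \<Omega> (grad_NC \<T> v)"
    by (rule power2_le_imp_le) (simp_all add: pyth L2_nrm_nonneg)
  moreover have "L2_nrm \<Omega> (grad_NC \<T> b) \<le> L2_nrm \<Omega> (grad_NC \<T> v)"
    by (rule power2_le_imp_le) (simp_all add: pyth L2_nrm_nonneg)
  moreover have "L2_nrm \<Omega> v \<le> L2_nrm \<Omega> w + L2_nrm \<Omega> b"
    using L2_nrm_triangle[OF C1[THEN pw_C1_pw_cont]] unfolding v_eq by simp
  moreover have "L2_nrm \<Omega> b \<le> a\<^sub>1 * L2_nrm \<Omega> (grad_NC \<T> b)"
    using a\<^sub>1 by (simp add: b_def w_def)
  moreover have "L2_nrm \<Omega> w \<le> a\<^sub>2 * L2_nrm \<Omega> (grad_NC \<T> w)"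
    using a\<^sub>2 by (simp add: ker w_def)
  ultimately show ?thesis
    using nonneg mult_left_mono[of "L2_nrm \<Omega> (grad_NC \<T> w)" "L2_nrm \<Omega> (grad_NC \<T> v)" a\<^sub>2]
      mult_left_mono[of "L2_nrm \<Omega> (grad_NC \<T> b)" "L2_nrm \<Omega> (grad_NC \<T> v)" a\<^sub>1]
    by (simp add: distrib_right)
qed

text \<open>Only the first argument is expanded. The eigenvalue equation is then tested with
  \<open>v c\<close> itself, and orthonormality turns the product of \<open>u i\<close> and
  \<open>v c\<close> into \<open>c i\<close>, so no double sum arises. The bound follows because the
  eigenvalues are ordered.\<close>

lemma eigenfunctions_energy:
  assumes "bounded \<Omega>" "piecewise_lipschitz \<Omega> A"
    and eigen: "discrete_eigensystem \<Omega> \<T> A (V_GCR \<Omega> \<T> Abar) lam u"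
    and l: "1 \<le> l" "l \<le> dim (V_GCR \<Omega> \<T> Abar)"
  defines "v \<equiv> \<lambda>c. \<Sum>i\<in>{1..l}. c i *\<^sub>R u i"
  shows "v c \<in> V_GCR \<Omega> \<T> Abar"
    and "L2_ip \<Omega> (v c) (v c) = (\<Sum>i\<in>{1..l}. (c i)\<^sup>2)"
    and "energy_ip \<Omega> A (grad_NC \<T> (v c)) (grad_NC \<T> (v c)) \<le> lam l * L2_ip \<Omega> (v c) (v c)"
proof -
  let ?V = "V_GCR \<Omega> \<T> Abar" and ?I = "{1..l}"
  have sub: "?I \<subseteq> {1..dim ?V}" using l by auto
  have u: "u i \<in> ?V" if "i \<in> ?I" for i
    using eigen sub that unfolding discrete_eigensystem_def by blast
  have eig: "energy_ip \<Omega> A (grad_NC \<T> (u i)) (grad_NC \<T> w) = lam i * L2_ip \<Omega> (u i) w"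
    if "i \<in> ?I" "w \<in> ?V" for i w
    using eigen sub that unfolding discrete_eigensystem_def by blast
  have lam_le: "lam i \<le> lam l" if "i \<in> ?I" for i
  proof -
    have "i \<in> {1..dim ?V}" "l \<in> {1..dim ?V}" "i \<le> l" using that l by auto
    then show ?thesis using eigen unfolding discrete_eigensystem_def by blast
  qed
  have orth: "L2_ip \<Omega> (u i) (u j) = (if i = j then 1 else 0)" if "i \<in> ?I" "j \<in> ?I" for i j
    using eigen sub that unfolding discrete_eigensystem_def by blast
  have pw: "pw_C1 (u i)" if "i \<in> ?I" for i using V_GCR_pw_C1[OF u[OF that]] .
  have v_eq: "v c = (\<lambda>x. \<Sum>i\<in>?I. c i * u i x)"
    unfolding v_def by (rule sum_scaleR_fun_apply)
  show vV: "v c \<in> ?V"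
    unfolding v_def by (intro subspace_sum subspace_scale subspace_V_GCR u)
  have pw_v: "pw_C1 (v c)" by (rule V_GCR_pw_C1[OF vV])
  have comp: "L2_ip \<Omega> (u i) (v c) = c i" if i: "i \<in> ?I" for i
  proof -
    have "L2_ip \<Omega> (v c) (u i) = (\<Sum>j\<in>?I. c j * L2_ip \<Omega> (u j) (u i))"
      unfolding v_eq by (intro L2_ip_sum_left pw_C1_pw_cont pw i)
    also have "\<dots> = (\<Sum>j\<in>?I. if j = i then c j else 0)"
      by (intro sum.cong refl) (simp only: orth[OF _ i], simp)
    finally show ?thesis using i by (simp add: L2_ip_commute)
  qed
  have "L2_ip \<Omega> (v c) (v c) = (\<Sum>i\<in>?I. c i * L2_ip \<Omega> (u i) (v c))"
    by (subst (1) v_eq) (intro L2_ip_sum_left pw_C1_pw_cont pw pw_v)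
  also have "\<dots> = (\<Sum>i\<in>?I. (c i)\<^sup>2)"
    by (intro sum.cong refl) (simp only: comp power2_eq_square)
  finally show L2: "L2_ip \<Omega> (v c) (v c) = (\<Sum>i\<in>?I. (c i)\<^sup>2)" .
  have "grad_NC \<T> (v c) = (\<lambda>x. \<Sum>i\<in>?I. c i *\<^sub>R grad_NC \<T> (u i) x)"
    unfolding v_eq using pw_C1_sum[of ?I u c] pw by simp
  then have "energy_ip \<Omega> A (grad_NC \<T> (v c)) (grad_NC \<T> (v c))
      = energy_ip \<Omega> A (\<lambda>x. \<Sum>i\<in>?I. c i *\<^sub>R grad_NC \<T> (u i) x) (grad_NC \<T> (v c))"
    by simp
  also have "\<dots> = (\<Sum>i\<in>?I. c i * energy_ip \<Omega> A (grad_NC \<T> (u i)) (grad_NC \<T> (v c)))"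
    by (intro energy_ip_sum_left assms(1,2) pw_C1_grad_pw_cont pw pw_v)
  also have "\<dots> = (\<Sum>i\<in>?I. lam i * (c i)\<^sup>2)"
    by (intro sum.cong refl) (simp only: eig[OF _ vV] comp power2_eq_square mult_ac)
  also have "\<dots> \<le> (\<Sum>i\<in>?I. lam l * (c i)\<^sup>2)"
    by (intro sum_mono mult_right_mono lam_le) auto
  finally show "energy_ip \<Omega> A (grad_NC \<T> (v c)) (grad_NC \<T> (v c)) \<le> lam l * L2_ip \<Omega> (v c) (v c)"
    by (simp add: L2 sum_distrib_left)
qed

end

theorem lemma6p2:
  fixes \<Omega> :: "(real^'n) set"
    and \<T> :: "(real^'n) set set"
    and A :: "real^'n \<Rightarrow> real^'n^'n"
    and Abar :: "(real^'n) set \<Rightarrow> real^'n^'n"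
    and lam :: "nat \<Rightarrow> real"
    and u :: "nat \<Rightarrow> real^'n \<Rightarrow> real"
    and \<kappa> C\<^sub>A \<beta>\<^sub>1 \<beta>\<^sub>2 :: real
    and l :: nat
  assumes domain: "open \<Omega>" "connected \<Omega>" "\<Omega> \<noteq> {}" "bounded \<Omega>"
    and partition: "exact_simplicial_partition \<Omega> \<T>" "shape_regular \<kappa> \<T>"
    and A_sym: "\<And>x. x \<in> \<Omega> \<Longrightarrow> transpose (A x) = A x"
    and A_lipschitz: "piecewise_lipschitz \<Omega> A"
    and A_coercive: "coercive \<Omega> A"
    and Abar: "\<And>K. K \<in> \<T> \<Longrightarrow> sym_pos_def (Abar K)"
    and C\<^sub>A: "\<And>v g w. H10_with_grad \<Omega> v g \<Longrightarrow> w \<in> V_GCR \<Omega> \<T> Abar \<Longrightarrow>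
      L2_nrm \<Omega> (\<lambda>x. g x + grad_NC \<T> w x) \<le> C\<^sub>A * energy_nrm \<Omega> A (\<lambda>x. g x + grad_NC \<T> w x)"
    and eigen: "discrete_eigensystem \<Omega> \<T> A (V_GCR \<Omega> \<T> Abar) lam u"
    and l: "1 \<le> l" "l \<le> dim (V_GCR \<Omega> \<T> Abar)"
    and \<beta>_nonneg: "0 \<le> \<beta>\<^sub>1" "0 \<le> \<beta>\<^sub>2"
    and \<beta>\<^sub>1: "\<And>v. v \<in> V_GCR \<Omega> \<T> Abar \<Longrightarrow>
      L2_nrm \<Omega> (v - Pi_CR \<Omega> \<T> v) \<le>
        \<beta>\<^sub>1 * mesh_size \<T> * L2_nrm \<Omega> (grad_NC \<T> (v - Pi_CR \<Omega> \<T> v))"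
    and \<beta>\<^sub>2: "\<And>w. w \<in> V_CR \<Omega> \<T> \<Longrightarrow>
      L2_nrm \<Omega> (w - Pi_c \<Omega> \<T> w) \<le> \<beta>\<^sub>2 * mesh_size \<T> * L2_nrm \<Omega> (grad_NC \<T> w)"
    and h: "mesh_size \<T> < 1 / ((\<beta>\<^sub>1 + \<beta>\<^sub>2) * C\<^sub>A * sqrt (lam l))"
  shows "dim (Pi_c \<Omega> \<T> ` Pi_CR \<Omega> \<T> ` span (u ` {1..l})) = l"
proof -
  interpret gcr_mesh \<Omega> \<T> Abar
    by unfold_locales (use domain partition Abar in auto)
  let ?V = "V_GCR \<Omega> \<T> Abar" and ?I = "{1..l}"
  define v where "v c = (\<Sum>i\<in>?I. c i *\<^sub>R u i)" for c :: "nat \<Rightarrow> real"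
  note energy = eigenfunctions_energy[OF domain(4) A_lipschitz eigen l, folded v_def]
  have v_zero: "c i = 0" if "L2_ip \<Omega> (v c) (v c) = 0" "i \<in> ?I" for c i
  proof -
    have "(\<Sum>i\<in>?I. (c i)\<^sup>2) = 0" using that(1) unfolding energy(2) .
    then have "(c i)\<^sup>2 = 0" using that(2) by (subst (asm) sum_nonneg_eq_0_iff) auto
    then show ?thesis by simp
  qed
  have L2_zero: "L2_ip \<Omega> 0 0 = 0" for \<Omega> :: "(real^'n) set"
    by (simp add: L2_ip_def)
  \<comment> \<open>The eigenfunctions span as a set, and this set must have l elements.\<close>
  have inj: "inj_on u ?I"
  proof (rule inj_onI)
    fix i j assume ij: "i \<in> ?I" "j \<in> ?I" "u i = u j"
    have "L2_ip \<Omega> (u i) (u k) = (if i = k then 1 else 0)" if "k \<in> ?I" for k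
      using eigen ij(1) that l unfolding discrete_eigensystem_def by auto
    from this[OF ij(1)] this[OF ij(2)] ij(3) show "i = j" by (auto split: if_splits)
  qed
  have reindex: "(\<Sum>x\<in>u ` ?I. c x *\<^sub>R x) = v (c \<circ> u)" for c
    unfolding v_def using inj by (simp add: sum.reindex)
  \<comment> \<open>A vanishing combination has zero norm, and its squared norm is the sum of the
    squares of its coefficients.\<close>
  have indep: "independent (u ` ?I)"
  proof (rule independent_if_scalars_zero)
    fix c x assume "(\<Sum>x\<in>u ` ?I. c x *\<^sub>R x) = 0" and x: "x \<in> u ` ?I"
    then have "v (c \<circ> u) = 0" unfolding reindex by simp
    then have "L2_ip \<Omega> (v (c \<circ> u)) (v (c \<circ> u)) = 0" by (simp add: L2_zero)
    then show "c x = 0" using v_zero[of "c \<circ> u"] x by auto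
  qed simp
  have spanE: "\<exists>c. x = v c" if "x \<in> span (u ` ?I)" for x
    using that unfolding span_finite[OF finite_imageI[OF finite_atLeastAtMost]] reindex by blast
  define h where "h = mesh_size \<T>"
  have lam_pos: "lam l > 0"
    using eigen l unfolding discrete_eigensystem_def by auto
  have h_nonneg: "h \<ge> 0"
  proof -
    \<comment> \<open>The mesh size is a maximum, which says nothing about an empty set; a nonempty
      domain provides an element.\<close>
    have "\<T> \<noteq> {}" using closure_domain domain(3) by auto
    then obtain K where K: "K \<in> \<T>" by blast
    then interpret K: full_simplex K by (rule simplex_mesh)
    have "0 \<le> diameter K" by (rule diameter_ge_0[OF compact_imp_bounded[OF K.compact_K]])
    also have "\<dots> \<le> h" unfolding h_def mesh_size_def using K finite_mesh by simp
    finally show ?thesis .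
  qed
  define s where "s = (\<beta>\<^sub>1 + \<beta>\<^sub>2) * C\<^sub>A * sqrt (lam l)"
  \<comment> \<open>Were \<open>s\<close> nonpositive, so would be 1/s, also for
    \<open>s = 0\<close> since division by zero gives 0. This contradicts 0 \<le> h < 1/s.\<close>
  have s_pos: "s > 0"
    using h h_nonneg unfolding s_def[symmetric] h_def
    by (metis (full_types) divide_le_0_1_iff linorder_not_le order.strict_trans1 order_less_irrefl)
  then have hs: "h * s < 1"
    using h unfolding s_def[symmetric] h_def[symmetric] by (simp add: field_simps)
  \<comment> \<open>The sign of \<open>C\<^sub>A\<close> is forced by \<open>s > 0\<close>, as the
    other factors of \<open>s\<close> are nonnegative.\<close>
  have C_pos: "C\<^sub>A > 0"
  proof -
    have "0 < (\<beta>\<^sub>1 + \<beta>\<^sub>2) * C\<^sub>A"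
      using s_pos lam_pos unfolding s_def by (simp add: zero_less_mult_iff)
    then show ?thesis using \<beta>_nonneg by (simp add: zero_less_mult_iff)
  qed
  have ker: "x = 0" if x: "x \<in> span (u ` ?I)" and F: "(Pi_c \<Omega> \<T> \<circ> Pi_CR \<Omega> \<T>) x = 0" for x
  proof -
    obtain c where c: "x = v c" using spanE[OF x] by blast
    have xV: "x \<in> ?V" unfolding c by (rule energy(1))
    define N where "N = L2_nrm \<Omega> x"
    have N: "N \<ge> 0" by (simp add: N_def L2_nrm_nonneg)
    have "energy_nrm \<Omega> A (grad_NC \<T> x) \<le> sqrt (lam l * L2_ip \<Omega> x x)"
      unfolding energy_nrm_def c by (intro real_sqrt_le_mono energy(3))
    then have en: "energy_nrm \<Omega> A (grad_NC \<T> x) \<le> sqrt (lam l) * N"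
      by (simp add: real_sqrt_mult N_def L2_nrm_def)
    have "L2_nrm \<Omega> (grad_NC \<T> x) \<le> C\<^sub>A * energy_nrm \<Omega> A (grad_NC \<T> x)"
      using C\<^sub>A[OF H10_with_grad_zero xV] by simp
    also have "\<dots> \<le> C\<^sub>A * (sqrt (lam l) * N)"
      using en C_pos by (intro mult_left_mono) auto
    finally have grad: "L2_nrm \<Omega> (grad_NC \<T> x) \<le> C\<^sub>A * (sqrt (lam l) * N)" .
    have "N \<le> (\<beta>\<^sub>1 * h + \<beta>\<^sub>2 * h) * L2_nrm \<Omega> (grad_NC \<T> x)"
      unfolding N_def
    proof (rule interpolation_estimate[OF xV])
      show "Pi_c \<Omega> \<T> (Pi_CR \<Omega> \<T> x) = 0" using F by simp
    qed (use \<beta>\<^sub>1[OF xV] \<beta>\<^sub>2[OF Pi_CR_V_CR(1)[OF xV]] \<beta>_nonneg h_nonneg in \<open>simp_all add: h_def\<close>)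
    also have "\<dots> \<le> (\<beta>\<^sub>1 * h + \<beta>\<^sub>2 * h) * (C\<^sub>A * (sqrt (lam l) * N))"
      using \<beta>_nonneg h_nonneg by (intro mult_left_mono grad) simp
    also have "\<dots> = h * s * N" by (simp add: s_def algebra_simps)
    \<comment> \<open>As h s < 1, the bound N \<le> h s N leaves only N = 0.\<close>
    finally have "N * (1 - h * s) \<le> 0" by (simp add: algebra_simps)
    then have "N = 0" using N hs by (simp add: mult_le_0_iff)
    \<comment> \<open>Going through the coefficients shows that \<open>x\<close> is the zero
      function itself, not merely zero almost everywhere.\<close>
    then have "L2_ip \<Omega> (v c) (v c) = 0" by (simp add: N_def c L2_nrm_def)
    then have "c i = 0" if "i \<in> ?I" for i using v_zero that by blast
    then show "x = 0" unfolding c v_def by simp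
  qed
  have "dim ((Pi_c \<Omega> \<T> \<circ> Pi_CR \<Omega> \<T>) ` span (u ` ?I)) = card (u ` ?I)"
  proof (rule dim_image_span_of_trivial_kernel[OF subspace_V_GCR _ _ indep ker])
    show "u ` ?I \<subseteq> ?V"
      using eigen l unfolding discrete_eigensystem_def by auto
  qed (simp_all add: Pi_c_Pi_CR_linear)
  then show ?thesis using inj by (simp add: card_image image_comp)
qed

end
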